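(* There exist absolute constants $C,c>0$ such that the following holds. Let $n\ge p\ge 1$ and $k\ge 1$ be integers, and let $(\boldsymbol{x}_1,y_1),\ldots,(\boldsymbol{x}_n,y_n)$ be i.i.d. samples from a distribution satisfying Model 1, with generic sample $(\boldsymbol{x},y)$ and covariance $\Sigma=\mathbb{E}[\boldsymbol{x}\boldsymbol{x}^\top]$. Define $$\omega=\|\Sigma^{-1/2}\boldsymbol{x}\|_{\psi_2},\qquad \eta=(1+\omega^3)\,\|\Sigma^{-1/2}\|\,\|y\|_{\psi_2}.$$ Assume $k\le n/2$ and $$\omega^2\Big(\sqrt{\tfrac{k}{n}\log\big(\tfrac{en}{k}\big)}+\sqrt{\tfrac{p}{n}}\Big)\le c .$$ Then, for any $t>0$, with probability at least $1-3(en/k)^{-kt^2}-4e^{-cn/\omega^4}$, $$\max_{\mathcal{S}\subseteq[n],\,|\mathcal{S}|\ge n-k}\big\|\widehat{\boldsymbol\beta}-\widehat{\boldsymbol\beta}_{\mathcal{S}}\big\|\le C\,\eta\,\bigg(\frac{k}{n}\log\Big(\frac{en}{k}\Big)+\frac1n\sqrt{kp\log\Big(\frac{en}{k}\Big)}\bigg)(1+t)^2 .$$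
   Context: Model 1: $P(\boldsymbol{x},y)$ is a probability distribution over $\mathbb{R}^{p+1}$ ($\boldsymbol{x}\in\mathbb{R}^p$, $y\in\mathbb{R}$) such that (i) $\boldsymbol{x}$ is sub-Gaussian, has zero mean, and has positive-definite covariance $\Sigma=\mathbb{E}[\boldsymbol{x}\boldsymbol{x}^\top]$; (ii) $y$ is sub-Gaussian. (No linear relation between $y$ and $\boldsymbol{x}$ is assumed.) Norms: for a real random variable $z$, $\|z\|_{\psi_2}=\inf\{t>0:\mathbb{E}[\exp(z^2/t^2)]\le e\}$; for a random vector $\boldsymbol{z}\in\mathbb{R}^p$, $\|\boldsymbol{z}\|_{\psi_2}=\sup_{\boldsymbol{v}\in\mathbb{S}^{p-1}}\|\boldsymbol{v}^\top\boldsymbol{z}\|_{\psi_2}$. A random variable or vector is sub-Gaussian if its $\psi_2$ norm is finite. For vectors $\|\cdot\|$ is the Euclidean norm; for matrices it is the spectral norm. OLS: $X\in\mathbb{R}^{n\times p}$ has rows $\boldsymbol{x}_1,\ldots,\boldsymbol{x}_n$ and $\boldsymbol{y}=(y_1,\ldots,y_n)^\top$. For $\mathcal{S}\subseteq[n]=\{1,\ldots,n\}$, $X_{\mathcal{S}}$ and $\boldsymbol{y}_{\mathcal{S}}$ are the restrictions to the rows/entries indexed by $\mathcal{S}$. $\widehat{\boldsymbol\beta}=(X^\top X)^{-1}X^\top\boldsymbol{y}$ and $\widehat{\boldsymbol\beta}_{\mathcal{S}}=(X_{\mathcal{S}}^\top X_{\mathcal{S}})^{-1}X_{\mathcal{S}}^\top\boldsymbol{y}_{\mathcal{S}}$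 whenever $X$, respectively $X_{\mathcal{S}}$, has full column rank; otherwise the estimator may be assigned an arbitrary value. *)

theory Defs
  imports
    "HOL-Probability.Probability"
    "Jordan_Normal_Form.Gauss_Jordan_Elimination"
    "Jordan_Normal_Form.DL_Rank"
    "Jordan_Normal_Form.DL_Submatrix"
begin

text \<open>
  The constants of the theorem are uniform in the dimension \<open>p\<close>, so \<open>p\<close> must be a bound variable
  of type \<^typ>\<open>nat\<close> and cannot be a type. Linear algebra is therefore done with the
  carrier-based types \<open>real vec\<close> and \<open>real mat\<close>, indexed from \<open>0\<close>; in particular
  the index set \<open>[n]\<close> is \<open>{..<n}\<close>.
\<close>

definition vec_norm2 :: "real Matrix.vec \<Rightarrow> real" where
  "vec_norm2 v = sqrt (scalar_prod v v)"

definition unit_sphere :: "nat \<Rightarrow> real Matrix.vec set" where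
  "unit_sphere p = {v \<in> carrier_vec p. vec_norm2 v = 1}"

definition spectral_norm :: "real mat \<Rightarrow> real" where
  "spectral_norm A = (SUP v \<in> unit_sphere (dim_col A). vec_norm2 (A *\<^sub>v v))"

definition pos_def_mat :: "nat \<Rightarrow> real mat \<Rightarrow> bool" where
  "pos_def_mat p A \<longleftrightarrow> A \<in> carrier_mat p p \<and> transpose_mat A = A \<and>
     (\<forall>v \<in> carrier_vec p. v \<noteq> 0\<^sub>v p \<longrightarrow> 0 < scalar_prod v (A *\<^sub>v v))"

text \<open>Used only for positive-definite \<open>A\<close>, where such an \<open>R\<close> exists and is unique.\<close>

definition inv_sqrt_mat :: "nat \<Rightarrow> real mat \<Rightarrow> real mat" where
  "inv_sqrt_mat p A = (THE R. pos_def_mat p R \<and> R * R = the (mat_inverse A))"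

text \<open>
  The \<open>\<psi>\<^sub>2\<close> norms take values in \<^typ>\<open>ennreal\<close>: the infimum is \<open>\<infinity>\<close> if no admissible \<open>t\<close> exists.
\<close>

definition psi2_norm :: "'a measure \<Rightarrow> ('a \<Rightarrow> real) \<Rightarrow> ennreal" where
  "psi2_norm M Z =
     (INF t \<in> {t::real. 0 < t \<and> (\<integral>\<^sup>+ s. ennreal (exp ((Z s)\<^sup>2 / t\<^sup>2)) \<partial>M) \<le> ennreal (exp 1)}. ennreal t)"

definition psi2_norm_vec :: "nat \<Rightarrow> 'a measure \<Rightarrow> ('a \<Rightarrow> real Matrix.vec) \<Rightarrow> ennreal" where
  "psi2_norm_vec p M Z = (SUP v \<in> unit_sphere p. psi2_norm M (\<lambda>s. scalar_prod v (Z s)))"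

text \<open>
  A point of \<open>\<real>\<^sup>p\<^sup>+\<^sup>1\<close> is a pair \<open>(f, y)\<close>, where \<open>f\<close> lists the \<open>p\<close> coordinates of \<open>x\<close>; such pairs form
  the space below.
\<close>

type_synonym sample = "(nat \<Rightarrow> real) \<times> real"

definition sample_space :: "nat \<Rightarrow> sample measure" where
  "sample_space p = (\<Pi>\<^sub>M j \<in> {..<p}. (borel :: real measure)) \<Otimes>\<^sub>M (borel :: real measure)"

definition covariate :: "nat \<Rightarrow> sample \<Rightarrow> real Matrix.vec" where
  "covariate p z = Matrix.vec p (fst z)"

definition covariance :: "nat \<Rightarrow> sample measure \<Rightarrow> real mat" where
  "covariance p P = Matrix.mat p p (\<lambda>(i, j). \<integral> z. fst z i * fst z j \<partial>P)"

definition model1 :: "nat \<Rightarrow> sample measure \<Rightarrow> bool" where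
  "model1 p P \<longleftrightarrow>
     prob_space P \<and> sets P = sets (sample_space p) \<and>
     psi2_norm_vec p P (covariate p) < \<infinity> \<and>
     (\<forall>j<p. (\<integral> z. fst z j \<partial>P) = 0) \<and>
     pos_def_mat p (covariance p P) \<and>
     psi2_norm P snd < \<infinity>"

text \<open>The norms below are finite under \<^const>\<open>model1\<close>, so \<^const>\<open>enn2real\<close> loses nothing.\<close>

definition model_omega :: "nat \<Rightarrow> sample measure \<Rightarrow> real" where
  "model_omega p P = enn2real
     (psi2_norm_vec p P (\<lambda>z. inv_sqrt_mat p (covariance p P) *\<^sub>v covariate p z))"

definition model_eta :: "nat \<Rightarrow> sample measure \<Rightarrow> real" where
  "model_eta p P = (1 + model_omega p P ^ 3) *
     spectral_norm (inv_sqrt_mat p (covariance p P)) * enn2real (psi2_norm P snd)"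

text \<open>The \<open>n\<close> i.i.d. samples are the coordinates \<open>d 0, \<dots>, d (n - 1)\<close> of a point \<open>d\<close> of this space.\<close>

definition iid_samples :: "nat \<Rightarrow> sample measure \<Rightarrow> (nat \<Rightarrow> sample) measure" where
  "iid_samples n P = (\<Pi>\<^sub>M i \<in> {..<n}. P)"

definition design :: "nat \<Rightarrow> nat \<Rightarrow> (nat \<Rightarrow> sample) \<Rightarrow> real mat" where
  "design n p d = Matrix.mat n p (\<lambda>(i, j). fst (d i) j)"

definition response :: "nat \<Rightarrow> (nat \<Rightarrow> sample) \<Rightarrow> real Matrix.vec" where
  "response n d = Matrix.vec n (\<lambda>i. snd (d i))"

definition restrict_rows :: "real mat \<Rightarrow> nat set \<Rightarrow> real mat" where
  "restrict_rows X S = submatrix X S UNIV"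

definition restrict_entries :: "real Matrix.vec \<Rightarrow> nat set \<Rightarrow> real Matrix.vec" where
  "restrict_entries y S =
     Matrix.vec (card {i. i < dim_vec y \<and> i \<in> S}) (\<lambda>i. vec_index y (pick S i))"

definition full_column_rank :: "real mat \<Rightarrow> bool" where
  "full_column_rank X \<longleftrightarrow> vec_space.rank (dim_row X) X = dim_col X"

text \<open>
  A relation rather than a function: without full column rank the estimator is an arbitrary vector.
\<close>

definition is_ols :: "real mat \<Rightarrow> real Matrix.vec \<Rightarrow> real Matrix.vec \<Rightarrow> bool" where
  "is_ols X y b \<longleftrightarrow> b \<in> carrier_vec (dim_col X) \<and>
     (full_column_rank X \<longrightarrow>
        b = the (mat_inverse (transpose_mat X * X)) *\<^sub>v (transpose_mat X *\<^sub>v y))"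

text \<open>
  Inner probability. It agrees with \<open>q \<le> measure M E\<close> for measurable \<open>E\<close>; the general form is needed
  since arbitrary values of the estimators need not depend measurably on the data.
\<close>

definition holds_with_prob_at_least :: "'a measure \<Rightarrow> real \<Rightarrow> ('a \<Rightarrow> bool) \<Rightarrow> bool" where
  "holds_with_prob_at_least M q E \<longleftrightarrow>
     (\<exists>A \<in> sets M. (\<forall>s \<in> A. E s) \<and> q \<le> measure M A)"

end

theory Submission
  imports Defs
begin

text \<open>
  Write \<open>z = \<Sigma>\<^sup>-\<^sup>1\<^sup>/\<^sup>2 x\<close>, let \<open>\<theta>\<close> and \<open>\<theta>\<^sub>S\<close> be the two estimators in the whitened coordinates, \<open>R = [n] - S\<close> the removed
  rows and \<open>h = \<theta> - \<theta>\<^sub>S\<close>. Subtracting the normal equations of \<open>\<theta>\<^sub>S\<close> from those of \<open>\<theta>\<close> gives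
  \<open>\<Sum>\<^sub>i \<langle>z\<^sub>i, h\<rangle>\<^sup>2 = \<Sum>\<^sub>i\<^sub>\<in>\<^sub>R \<langle>z\<^sub>i, h\<rangle> (y\<^sub>i - \<langle>z\<^sub>i, \<theta>\<^sub>S\<rangle>)\<close>, where the sum on the left runs over all rows. If the empirical
  covariance is bounded below, this yields
  \<open>(n/4) |h| \<le> \<parallel>Z\<^sub>R\<parallel> (|y\<^sub>R| + |Z\<^sub>R \<theta>\<^sub>S|)\<close> (lemmas \<open>normal_eq_difference\<close>, \<open>ols_removal_bound\<close>).

  The residuals on the right are those of \<open>\<theta>\<^sub>S\<close> and not of \<open>\<theta>\<close>, and this is what makes the rate
  possible. The estimator \<open>\<theta>\<^sub>S\<close> is independent of the rows in \<open>R\<close>; conditionally on the other rows,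
  \<open>Z\<^sub>R \<theta>\<^sub>S\<close> is a block of at most \<open>k\<close> independent sub-Gaussian variables of scale \<open>\<omega> |\<theta>\<^sub>S|\<close>, so that
  uniformly over \<open>R\<close> its length is of order \<open>\<omega> |\<theta>\<^sub>S| \<surd>(k log(en/k))\<close>, without a contribution of \<open>p\<close>.
  The same holds for \<open>|y\<^sub>R|\<close>, while \<open>\<parallel>Z\<^sub>R\<parallel>\<close> is of order \<open>\<omega> (\<surd>p + \<surd>(k log(en/k)))\<close>. The product of the
  two is the claimed rate. Estimating \<open>|Z\<^sub>R \<theta>|\<close> by \<open>\<parallel>Z\<^sub>R\<parallel> |\<theta>|\<close> would instead leave a term of order \<open>p\<close>.
  Finally \<open>|\<theta>\<^sub>S|\<close> is bounded by a multiple of \<open>\<parallel>y\<parallel>\<close> in the \<open>\<psi>\<^sub>2\<close> norm, because the fitted values are a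
  projection of \<open>y\<^sub>S\<close> and the design is bounded below.

  Every probabilistic estimate is an exponential Markov inequality for sums of squares, followed by
  a union bound over the at most \<open>(en/k)\<^sup>k\<close> sets \<open>R\<close> and, for matrices, over a net of the unit ball
  with at most \<open>e\<^sup>1\<^sup>8\<^sup>p\<close> points. The bounds for \<open>\<parallel>Z\<^sub>R\<parallel>\<close>, \<open>|y\<^sub>R|\<close> and \<open>|Z\<^sub>R \<theta>\<^sub>S|\<close> fail with probability
  \<open>(en/k)\<close> to the power \<open>-kt\<^sup>2\<close> each. The lower bound for the covariance (two tails), a bound
  \<open>\<parallel>Z\<^sub>R\<parallel>\<^sup>2 \<le> n/2\<close> that transfers it from all rows to the rows in \<open>S\<close>, and \<open>|y|\<^sup>2 \<le> 2n\<sigma>\<^sup>2\<close> account for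
  the four terms \<open>exp(-cn/\<omega>\<^sup>4)\<close>. All of this is lemma \<open>stable_removal_rare\<close>.

  The remaining work relates the definitions to this argument: the inverse square root of the
  covariance exists and is unique (\<open>inv_sqrt_mat_whitens\<close>), whitening turns the model into an
  isotropic one (\<open>model1_isotropic\<close>), and least-squares estimators satisfy the normal equations
  (\<open>is_ols_normal_eq\<close>).
\<close>

section \<open>Vectors, nets and quadratic forms\<close>

text \<open>
  The dimension \<open>p\<close> has to vary, so a vector is a function on \<open>nat\<close> of which only the values below \<open>p\<close>
  matter. This avoids carrier conditions in the analytic part of the proof.
\<close>

definition ip :: "nat \<Rightarrow> (nat \<Rightarrow> real) \<Rightarrow> (nat \<Rightarrow> real) \<Rightarrow> real" where
  "ip p u v = (\<Sum>j<p. u j * v j)"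

abbreviation norm2 :: "nat \<Rightarrow> (nat \<Rightarrow> real) \<Rightarrow> real" where
  "norm2 p v \<equiv> L2_set v {..<p}"

lemma norm2_sq: "(norm2 p v)\<^sup>2 = ip p v v"
  by (simp add: L2_set_def ip_def power2_eq_square sum_nonneg)

lemma ip_commute: "ip p u v = ip p v u"
  by (simp add: ip_def mult.commute)

lemma ip_simps:
  "ip p (\<lambda>j. u j + v j) w = ip p u w + ip p v w"
  "ip p (\<lambda>j. u j - v j) w = ip p u w - ip p v w"
  "ip p (\<lambda>j. c * u j) w = c * ip p u w"
  "ip p u (\<lambda>j. v j + w j) = ip p u v + ip p u w"
  "ip p u (\<lambda>j. v j - w j) = ip p u v - ip p u w"
  "ip p u (\<lambda>j. c * v j) = c * ip p u v"
  by (simp_all add: ip_def sum.distrib sum_subtractf sum_distrib_left algebra_simps)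

lemma abs_ip_le: "\<bar>ip p u v\<bar> \<le> norm2 p u * norm2 p v"
proof -
  have "\<bar>ip p u v\<bar> \<le> (\<Sum>j<p. \<bar>u j\<bar> * \<bar>v j\<bar>)"
    unfolding ip_def by (rule order_trans[OF sum_abs]) (simp add: abs_mult)
  also have "\<dots> \<le> norm2 p u * norm2 p v" by (rule L2_set_mult_ineq)
  finally show ?thesis .
qed

lemma norm2_scale: "norm2 p (\<lambda>j. c * v j) = \<bar>c\<bar> * norm2 p v"
  by (simp add: L2_set_def power_mult_distrib sum_distrib_left[symmetric] real_sqrt_mult)

lemma norm2_le_iff: "0 \<le> a \<Longrightarrow> norm2 p v \<le> a \<longleftrightarrow> ip p v v \<le> a\<^sup>2"
  by (metis norm2_sq L2_set_nonneg power2_le_imp_le power_mono)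

lemma norm2_eq_0: "norm2 p v = 0 \<longleftrightarrow> (\<forall>j<p. v j = 0)"
  by (auto simp: L2_set_eq_0_iff)

text \<open>
  Rounding is towards zero, so that rounding the coordinates of a vector never increases its norm.
\<close>

lemma truncation_to_integer:
  fixes x :: real
  shows "\<exists>m::int. \<bar>real_of_int m\<bar> \<le> \<bar>x\<bar> \<and> \<bar>x - m\<bar> \<le> 1"
proof (cases "0 \<le> x")
  case True
  then have "0 \<le> \<lfloor>x\<rfloor>" by simp
  then have "0 \<le> real_of_int \<lfloor>x\<rfloor>" by linarith
  then show ?thesis
    using True by (intro exI[of _ "\<lfloor>x\<rfloor>"]) (simp add: abs_le_iff, linarith)
next
  case False
  then have "\<lceil>x\<rceil> \<le> 0" by simp
  then have "real_of_int \<lceil>x\<rceil> \<le> 0" by linarith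
  then show ?thesis
    using False by (intro exI[of _ "\<lceil>x\<rceil>"]) (simp add: abs_le_iff, linarith)
qed

lemma sum_half_powers_symmetric: "(\<Sum>j\<in>{-int N..int N}. (1/2::real) ^ nat \<bar>j\<bar>) \<le> 3"
proof -
  have "(\<Sum>j\<in>{-int N..int N}. (1/2::real) ^ nat \<bar>j\<bar>) = 3 - 2 * (1/2) ^ N"
  proof (induction N)
    case 0 then show ?case by simp
  next
    case (Suc N)
    have "{-int (Suc N)..int (Suc N)} = insert (-int (Suc N)) (insert (int (Suc N)) {-int N..int N})"
      by auto
    then have "(\<Sum>j\<in>{-int (Suc N)..int (Suc N)}. (1/2::real) ^ nat \<bar>j\<bar>)
       = (1/2) ^ nat \<bar>-int (Suc N)\<bar> + ((1/2) ^ nat \<bar>int (Suc N)\<bar>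
          + (\<Sum>j\<in>{-int N..int N}. (1/2::real) ^ nat \<bar>j\<bar>))"
      by simp
    moreover have "nat \<bar>-int (Suc N)\<bar> = Suc N" "nat \<bar>int (Suc N)\<bar> = Suc N" by auto
    ultimately show ?case unfolding Suc.IH by simp
  qed
  then show ?thesis by simp
qed

text \<open>
  Each admissible point has weight at least \<open>2\<close> to the power \<open>-N\<close> under the product of the symmetric geometric
  weights, and the total mass of that product measure is at most \<open>3\<^sup>p\<close>. This replaces a volume
  argument for covering numbers.
\<close>

lemma card_integer_points_le:
  fixes p N :: nat
  defines "B \<equiv> {m \<in> PiE {..<p} (\<lambda>_. {-int N..int N}). (\<Sum>j<p. nat \<bar>m j\<bar>) \<le> N}"
  shows "finite B" "real (card B) \<le> 2 ^ N * 3 ^ p"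
proof -
  have fin: "finite (PiE {..<p} (\<lambda>_. {-int N..int N}))" by (intro finite_PiE) auto
  then show fB: "finite B" unfolding B_def by (rule rev_finite_subset) auto
  define wt :: "(nat \<Rightarrow> int) \<Rightarrow> real" where "wt m = (\<Prod>j<p. (1/2) ^ nat \<bar>m j\<bar>)" for m
  have wt: "1 \<le> 2 ^ N * wt m" if "m \<in> B" for m
  proof -
    have le: "(\<Sum>j<p. nat \<bar>m j\<bar>) \<le> N" using that by (simp add: B_def)
    have "(1::real) = 2 ^ N * (1/2) ^ N" by (simp add: power_one_over)
    also have "\<dots> \<le> 2 ^ N * (1/2) ^ (\<Sum>j<p. nat \<bar>m j\<bar>)"
      by (intro mult_left_mono power_decreasing le) auto
    finally show ?thesis by (simp add: wt_def power_sum)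
  qed
  have "(\<Sum>m\<in>B. wt m) \<le> (\<Sum>m\<in>PiE {..<p} (\<lambda>_. {-int N..int N}). wt m)"
  proof (rule sum_mono2[OF fin])
    show "B \<subseteq> PiE {..<p} (\<lambda>_. {-int N..int N})" unfolding B_def by blast
    show "0 \<le> wt m" for m unfolding wt_def by (rule prod_nonneg) simp
  qed
  moreover have "(\<Sum>m\<in>PiE {..<p} (\<lambda>_. {-int N..int N}). wt m)
      = (\<Prod>j<p. \<Sum>i\<in>{-int N..int N}. (1/2) ^ nat \<bar>i\<bar>)"
    unfolding wt_def by (rule prod_sum_PiE[symmetric]) auto
  moreover have "(\<Prod>j<p. \<Sum>i\<in>{-int N..int N}. (1/2::real) ^ nat \<bar>i\<bar>) \<le> (\<Prod>j<p. 3)"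
    using sum_half_powers_symmetric[of N] by (intro prod_mono) (auto intro!: sum_nonneg)
  ultimately have "(\<Sum>m\<in>B. wt m) \<le> 3 ^ p" by simp
  moreover have "real (card B) \<le> 2 ^ N * (\<Sum>m\<in>B. wt m)"
    using sum_mono[of B "\<lambda>_. 1" "\<lambda>m. 2 ^ N * wt m"] wt by (simp add: sum_distrib_left)
  moreover have "(2::real) ^ N * (\<Sum>m\<in>B. wt m) \<le> 2 ^ N * 3 ^ p"
    using calculation(1) by (intro mult_left_mono) auto
  ultimately show "real (card B) \<le> 2 ^ N * 3 ^ p" by linarith
qed

text \<open>
  The net is the part in the unit ball of the grid of mesh \<open>1 / (4 \<surd>p)\<close>. A point of the ball, scaled by \<open>4 \<surd>p\<close>
  and rounded, becomes an integer vector with sum of absolute values at most its sum of squares, hence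
  at most \<open>16 p\<close>; there are at most \<open>2\<^sup>1\<^sup>6\<^sup>p 3\<^sup>p\<close> of these.
\<close>

lemma grid_net:
  assumes p: "1 \<le> p"
  obtains N :: "(nat \<Rightarrow> real) set"
  where "finite N" "N \<noteq> {}" "real (card N) \<le> exp (18 * real p)" "\<And>w. w \<in> N \<Longrightarrow> norm2 p w \<le> 1"
    "\<And>v. norm2 p v \<le> 1 \<Longrightarrow> \<exists>w\<in>N. norm2 p (\<lambda>j. v j - w j) \<le> 1 / 4"
proof -
  define B where "B = {m \<in> PiE {..<p} (\<lambda>_. {-int (16 * p)..int (16 * p)}).
    (\<Sum>j<p. nat \<bar>m j\<bar>) \<le> 16 * p}"
  define s where "s = 4 * sqrt (real p)"
  have s: "s > 0" "s\<^sup>2 = 16 * real p" using p by (simp_all add: s_def power_mult_distrib)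
  define pt where "pt = (\<lambda>m :: nat \<Rightarrow> int. \<lambda>j. real_of_int (m j) / s)"
  define N where "N = {w \<in> pt ` B. norm2 p w \<le> 1}"
  have fB: "finite B" and cB: "real (card B) \<le> 2 ^ (16 * p) * 3 ^ p"
    using card_integer_points_le[of p "16 * p"] by (simp_all add: B_def)
  have fN: "finite N" using fB by (simp add: N_def)
  have "card N \<le> card B"
    using card_mono[of "pt ` B" N] card_image_le[OF fB, of pt] fB by (auto simp: N_def)
  also have "real (card B) \<le> (2 ^ 16 * 3) ^ p" 
  proof -
    have "(2 ^ 16 * 3 :: real) ^ p = 2 ^ (16 * p) * 3 ^ p" by (simp only: power_mult_distrib power_mult)
    then show ?thesis using cB by linarith
  qed
  also have "\<dots> \<le> (exp 1 ^ 18) ^ p"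
  proof (rule power_mono)
    have "(2::real) ^ 18 \<le> exp 1 ^ 18" using exp_ge_add_one_self[of 1] by (intro power_mono) auto
    then show "(2::real) ^ 16 * 3 \<le> exp 1 ^ 18" by simp
  qed simp
  also have "\<dots> = exp (18 * real p)"
    by (simp add: exp_of_nat_mult[symmetric] power_mult[symmetric])
  finally have card: "real (card N) \<le> exp (18 * real p)" by simp
  have approx: "\<exists>w\<in>N. norm2 p (\<lambda>j. v j - w j) \<le> 1 / 4" if v: "norm2 p v \<le> 1" for v
  proof -
    define m0 where "m0 = (\<lambda>j. SOME m::int. \<bar>real_of_int m\<bar> \<le> \<bar>s * v j\<bar> \<and> \<bar>s * v j - m\<bar> \<le> 1)"
    have m0: "\<bar>real_of_int (m0 j)\<bar> \<le> \<bar>s * v j\<bar>" "\<bar>s * v j - m0 j\<bar> \<le> 1" for j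
      using someI_ex[OF truncation_to_integer[of "s * v j"]] by (simp_all add: m0_def)
    define m where "m = restrict m0 {..<p}"
    have vv: "ip p v v \<le> 1" using v norm2_le_iff[of 1 v p] by simp
    have "real (\<Sum>j<p. nat \<bar>m j\<bar>) = (\<Sum>j<p. \<bar>real_of_int (m0 j)\<bar>)"
      by (simp add: m_def)
    also have "\<dots> \<le> (\<Sum>j<p. (s * v j)\<^sup>2)"
    proof (intro sum_mono)
      fix j
      \<comment> \<open>This step uses that \<open>m0 j\<close> is an integer.\<close>
      have "\<bar>m0 j\<bar> \<le> (m0 j)\<^sup>2"
      proof (cases "m0 j = 0")
        case False
        then have "\<bar>m0 j\<bar> * 1 \<le> \<bar>m0 j\<bar> * \<bar>m0 j\<bar>" by (intro mult_left_mono) auto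
        then show ?thesis by (simp add: power2_eq_square)
      qed simp
      then have "\<bar>real_of_int (m0 j)\<bar> \<le> (real_of_int (m0 j))\<^sup>2"
        by (metis of_int_abs of_int_le_iff of_int_power)
      also have "\<dots> \<le> (s * v j)\<^sup>2" using m0(1)[of j] by (simp add: abs_le_square_iff)
      finally show "\<bar>real_of_int (m0 j)\<bar> \<le> (s * v j)\<^sup>2" .
    qed
    also have "\<dots> = s\<^sup>2 * ip p v v"
      by (simp add: ip_def sum_distrib_left power2_eq_square mult_ac)
    also have "\<dots> \<le> real (16 * p)" using vv s by (simp add: mult_left_le)
    finally have le: "(\<Sum>j<p. nat \<bar>m j\<bar>) \<le> 16 * p" by linarith
    have each: "\<bar>m j\<bar> \<le> int (16 * p)" if "j < p" for j
    proof -
      have "nat \<bar>m j\<bar> \<le> (\<Sum>j<p. nat \<bar>m j\<bar>)" using that by (intro member_le_sum) auto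
      then show ?thesis using le by linarith
    qed
    have "- int (16 * p) \<le> m j \<and> m j \<le> int (16 * p)" if "j < p" for j
      using each[OF that] by linarith
    then have "m \<in> B" unfolding B_def using le by (auto simp: m_def PiE_iff)
    have "(pt m j)\<^sup>2 \<le> (v j)\<^sup>2" if "j < p" for j
    proof -
      have "\<bar>pt m j\<bar> \<le> \<bar>v j\<bar>"
        using m0(1)[of j] s(1) that by (simp add: pt_def m_def abs_mult divide_le_eq mult.commute)
      then show ?thesis by (simp add: abs_le_square_iff)
    qed
    then have "ip p (pt m) (pt m) \<le> ip p v v"
      unfolding ip_def by (intro sum_mono) (simp add: power2_eq_square)
    then have "norm2 p (pt m) \<le> 1" using vv norm2_le_iff[of 1 "pt m" p] by simp
    then have "pt m \<in> N" using \<open>m \<in> B\<close> by (simp add: N_def)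
    moreover have "norm2 p (\<lambda>j. v j - pt m j) \<le> 1 / 4"
    proof -
      have "(v j - pt m j) * (v j - pt m j) \<le> 1 / s\<^sup>2" if "j < p" for j
      proof -
        have "v j - pt m j = (s * v j - m0 j) / s"
          using s that by (simp add: pt_def m_def field_simps)
        then have "(v j - pt m j) * (v j - pt m j) = (s * v j - m0 j)\<^sup>2 / s\<^sup>2"
          by (simp add: power2_eq_square)
        also have "\<dots> \<le> 1 / s\<^sup>2"
          using m0(2)[of j] by (intro divide_right_mono) (auto simp: abs_square_le_1)
        finally show ?thesis .
      qed
      then have "ip p (\<lambda>j. v j - pt m j) (\<lambda>j. v j - pt m j) \<le> (\<Sum>j<p. 1 / s\<^sup>2)"
        unfolding ip_def by (intro sum_mono) auto
      also have "\<dots> = (1/4)\<^sup>2" using s p by (simp add: power2_eq_square)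
      finally show ?thesis by (subst norm2_le_iff) auto
    qed
    ultimately show ?thesis by blast
  qed
  have "N \<noteq> {}" using approx[of "\<lambda>_. 0"] by (auto simp: L2_set_def)
  show ?thesis
    by (rule that[OF fN \<open>N \<noteq> {}\<close> card]) (use approx in \<open>auto simp: N_def\<close>)
qed

definition qform :: "nat \<Rightarrow> (nat \<Rightarrow> nat \<Rightarrow> real) \<Rightarrow> (nat \<Rightarrow> real) \<Rightarrow> real" where
  "qform p A v = (\<Sum>i<p. \<Sum>j<p. v i * A i j * v j)"

text \<open>
  Let \<open>M\<close> be the supremum of the form over the unit ball. By polarization the associated bilinear form is
  at most \<open>M\<close> times the product of the norms, so moving from \<open>v\<close> to a net point \<open>u\<close> changes the value by at most
  \<open>M |v - u| |v + u| \<le> M / 2\<close>. Hence \<open>M \<le> m + M / 2\<close>.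
\<close>

lemma qform_le_twice_net:
  assumes sym: "\<And>i j. A i j = A j i"
    and net: "\<And>v. norm2 p v \<le> 1 \<Longrightarrow> \<exists>w\<in>N. norm2 p (\<lambda>j. v j - w j) \<le> 1 / 4"
      "\<And>w. w \<in> N \<Longrightarrow> norm2 p w \<le> 1"
    and bnd: "\<And>w. w \<in> N \<Longrightarrow> \<bar>qform p A w\<bar> \<le> m"
  shows "\<bar>qform p A v\<bar> \<le> 2 * m * ip p v v"
proof -
  define bf where "bf = (\<lambda>u v. \<Sum>i<p. \<Sum>j<p. u i * A i j * v j)"
  have bf_sym: "bf u v = bf v u" for u v
  proof -
    have "bf u v = (\<Sum>j<p. \<Sum>i<p. u i * A i j * v j)" unfolding bf_def by (rule sum.swap)
    also have "\<dots> = bf v u" unfolding bf_def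
    proof (intro sum.cong refl)
      fix i j show "u j * A j i * v i = v i * A i j * u j" using sym[of i j] by simp
    qed
    finally show ?thesis .
  qed
  have q: "qform p A v = bf v v" for v by (simp add: bf_def qform_def)
  have bf_simps: "bf (\<lambda>j. u j + v j) w = bf u w + bf v w" "bf (\<lambda>j. u j - v j) w = bf u w - bf v w"
    "bf w (\<lambda>j. u j + v j) = bf w u + bf w v" "bf w (\<lambda>j. u j - v j) = bf w u - bf w v"
    "bf (\<lambda>j. c * u j) w = c * bf u w" "bf w (\<lambda>j. c * u j) = c * bf w u" for u v w c
    by (simp_all add: bf_def algebra_simps sum.distrib sum_subtractf sum_distrib_left)
  have ball: "norm2 p v \<le> 1 \<Longrightarrow> \<bar>bf v v\<bar> \<le> (\<Sum>i<p. \<Sum>j<p. \<bar>A i j\<bar>)" for v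
  proof -
    assume v: "norm2 p v \<le> 1"
    have vi: "\<bar>v i\<bar> \<le> 1" if "i < p" for i
    proof -
      have "\<bar>v i\<bar> \<le> norm2 p (\<lambda>i. \<bar>v i\<bar>)" using that by (intro member_le_L2_set) auto
      also have "norm2 p (\<lambda>i. \<bar>v i\<bar>) = norm2 p v" by (simp add: L2_set_def)
      finally show ?thesis using v by simp
    qed
    have "\<bar>bf v v\<bar> \<le> (\<Sum>i<p. \<Sum>j<p. \<bar>v i * A i j * v j\<bar>)"
      unfolding bf_def by (rule order_trans[OF sum_abs]) (rule sum_mono, rule sum_abs)
    also have "\<dots> \<le> (\<Sum>i<p. \<Sum>j<p. \<bar>A i j\<bar>)"
    proof (intro sum_mono)
      fix i j assume "i \<in> {..<p}" "j \<in> {..<p}"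
      then have "\<bar>v i\<bar> * \<bar>A i j\<bar> * \<bar>v j\<bar> \<le> 1 * \<bar>A i j\<bar> * 1"
        by (intro mult_mono vi) auto
      then show "\<bar>v i * A i j * v j\<bar> \<le> \<bar>A i j\<bar>" by (simp add: abs_mult)
    qed
    finally show ?thesis .
  qed
  define M where "M = (SUP v\<in>{v. norm2 p v \<le> 1}. \<bar>bf v v\<bar>)"
  have bdd: "bdd_above ((\<lambda>v. \<bar>bf v v\<bar>) ` {v. norm2 p v \<le> 1})"
    using ball by (auto intro!: bdd_aboveI)
  have zero: "norm2 p (\<lambda>_. 0) \<le> 1" by (simp add: L2_set_def)
  have M: "\<bar>bf v v\<bar> \<le> M" if "norm2 p v \<le> 1" for v
    unfolding M_def by (rule cSUP_upper[OF _ bdd]) (use that in simp)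
  have M0: "0 \<le> M" using M[OF zero] by simp
  have scale: "\<bar>bf v v\<bar> \<le> M * ip p v v" if "\<And>v. norm2 p v \<le> 1 \<Longrightarrow> \<bar>bf v v\<bar> \<le> M" for v M
  proof (cases "norm2 p v = 0")
    case True
    then have "bf v v = 0" by (auto simp: norm2_eq_0 bf_def intro!: sum.neutral)
    moreover have "ip p v v = 0" using True by (simp flip: norm2_sq)
    ultimately show ?thesis by simp
  next
    case False
    define a where "a = norm2 p v"
    have a: "a > 0" using False by (simp add: a_def less_le)
    have "norm2 p (\<lambda>j. (1/a) * v j) = 1" using a norm2_scale[of "1/a" v p] by (simp add: a_def)
    then have "\<bar>bf (\<lambda>j. (1/a) * v j) (\<lambda>j. (1/a) * v j)\<bar> \<le> M" by (intro that) simp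
    then have "\<bar>bf v v\<bar> / a\<^sup>2 \<le> M" unfolding bf_simps using a by (simp add: power2_eq_square abs_mult)
    then show ?thesis using a by (simp add: divide_le_eq norm2_sq[symmetric] a_def[symmetric])
  qed
  have pol: "\<bar>bf u v\<bar> \<le> M * (ip p u u + ip p v v) / 2" for u v
  proof -
    have "4 * bf u v = bf (\<lambda>j. u j + v j) (\<lambda>j. u j + v j) - bf (\<lambda>j. u j - v j) (\<lambda>j. u j - v j)"
      unfolding bf_simps using bf_sym[of u v] by simp
    then have "4 * \<bar>bf u v\<bar> \<le> M * ip p (\<lambda>j. u j + v j) (\<lambda>j. u j + v j)
        + M * ip p (\<lambda>j. u j - v j) (\<lambda>j. u j - v j)"
      using scale[OF M, of "\<lambda>j. u j + v j"] scale[OF M, of "\<lambda>j. u j - v j"] by linarith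
    also have "\<dots> = 2 * (M * (ip p u u + ip p v v))"
      unfolding ip_simps by (simp add: algebra_simps ip_commute[of p v u])
    finally show ?thesis by simp
  qed
  have "M \<le> m + M / 2"
  proof -
    have "\<bar>bf v v\<bar> \<le> m + M / 2" if v: "norm2 p v \<le> 1" for v
    proof -
      obtain w where w: "w \<in> N" "norm2 p (\<lambda>j. v j - w j) \<le> 1 / 4" using net(1)[OF v] by blast
      have w1: "norm2 p w \<le> 1" using net(2)[OF w(1)] .
      have s: "norm2 p (\<lambda>j. v j + w j) \<le> 2" using L2_set_triangle_ineq[of v w "{..<p}"] v w1 by simp
      \<comment> \<open>The factor balances \<open>|v - w| \<le> 1/4\<close> against \<open>|v + w| \<le> 2\<close> in the polarized bound, which contains
        the mean of the two squared norms instead of their product.\<close>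
      define a :: real where "a = sqrt 8"
      have a: "a > 0" "a\<^sup>2 = 8" by (simp_all add: a_def)
      have "bf v v - bf w w = bf (\<lambda>j. v j - w j) (\<lambda>j. v j + w j)"
        unfolding bf_simps using bf_sym[of v w] by simp
      also have "\<dots> = bf (\<lambda>j. a * (v j - w j)) (\<lambda>j. (1/a) * (v j + w j))"
        unfolding bf_simps using a by (simp add: field_simps)
      also have "\<bar>\<dots>\<bar> \<le> M * ((norm2 p (\<lambda>j. a * (v j - w j)))\<^sup>2 + (norm2 p (\<lambda>j. (1/a) * (v j + w j)))\<^sup>2) / 2"
        unfolding norm2_sq by (rule pol)
      also have "\<dots> = M * (8 * (norm2 p (\<lambda>j. v j - w j))\<^sup>2 + 1/8 * (norm2 p (\<lambda>j. v j + w j))\<^sup>2) / 2"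
        unfolding norm2_scale using a by (simp add: power_mult_distrib power_divide)
      also have "\<dots> \<le> M * (8 * (1/4)\<^sup>2 + 1/8 * 2\<^sup>2) / 2"
        using w(2) s M0 by (intro divide_right_mono mult_left_mono add_mono power_mono) auto
      also have "\<dots> = M / 2" by (simp add: power2_eq_square)
      finally show ?thesis using bnd[OF w(1)] unfolding q by linarith
    qed
    then show ?thesis unfolding M_def using zero by (intro cSUP_least) auto
  qed
  then have "M \<le> 2 * m" by simp
  moreover have "0 \<le> ip p v v" by (simp flip: norm2_sq)
  ultimately have "M * ip p v v \<le> 2 * m * ip p v v" by (rule mult_right_mono)
  then show ?thesis using scale[OF M, of v] unfolding q by linarith
qed

section \<open>Square roots of positive-definite matrices by contraction\<close>

definition mv :: "nat \<Rightarrow> (nat \<Rightarrow> nat \<Rightarrow> real) \<Rightarrow> (nat \<Rightarrow> real) \<Rightarrow> nat \<Rightarrow> real" where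
  "mv p A v i = (\<Sum>j<p. A i j * v j)"

definition mm :: "nat \<Rightarrow> (nat \<Rightarrow> nat \<Rightarrow> real) \<Rightarrow> (nat \<Rightarrow> nat \<Rightarrow> real) \<Rightarrow> nat \<Rightarrow> nat \<Rightarrow> real" where
  "mm p A B i k = (\<Sum>j<p. A i j * B j k)"

text \<open>
  The operator norm is only ever needed through upper bounds, which pass to limits and to
  compositions without reference to a supremum.
\<close>

definition op_le :: "nat \<Rightarrow> (nat \<Rightarrow> nat \<Rightarrow> real) \<Rightarrow> real \<Rightarrow> bool" where
  "op_le p A q \<longleftrightarrow> (\<forall>v. norm2 p (mv p A v) \<le> q * norm2 p v)"

lemma mv_mm: "mv p (mm p A B) v i = mv p A (mv p B v) i"
proof -
  have "mv p (mm p A B) v i = (\<Sum>k<p. \<Sum>j<p. A i j * B j k * v k)"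
    by (simp add: mv_def mm_def sum_distrib_right)
  also have "\<dots> = (\<Sum>j<p. \<Sum>k<p. A i j * B j k * v k)" by (rule sum.swap)
  also have "\<dots> = mv p A (mv p B v) i" by (simp add: mv_def sum_distrib_left mult.assoc)
  finally show ?thesis .
qed

lemma op_leD: "op_le p A q \<Longrightarrow> norm2 p (mv p A v) \<le> q * norm2 p v"
  by (simp add: op_le_def)

lemma op_le_add:
  assumes "op_le p A a" "op_le p B b"
  shows "op_le p (\<lambda>i j. A i j + B i j) (a + b)"
  unfolding op_le_def
proof
  fix v
  have "mv p (\<lambda>i j. A i j + B i j) v = (\<lambda>i. mv p A v i + mv p B v i)"
    by (simp add: mv_def fun_eq_iff algebra_simps sum.distrib)
  then have "norm2 p (mv p (\<lambda>i j. A i j + B i j) v) \<le> norm2 p (mv p A v) + norm2 p (mv p B v)"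
    by (simp add: L2_set_triangle_ineq)
  also have "\<dots> \<le> (a + b) * norm2 p v"
    using op_leD[OF assms(1), of v] op_leD[OF assms(2), of v] by (simp add: algebra_simps)
  finally show "norm2 p (mv p (\<lambda>i j. A i j + B i j) v) \<le> (a + b) * norm2 p v" .
qed

lemma op_le_half:
  assumes "op_le p A a"
  shows "op_le p (\<lambda>i j. A i j / 2) (a / 2)"
  unfolding op_le_def
proof
  fix v
  have "mv p (\<lambda>i j. A i j / 2) v = (\<lambda>i. (1/2) * mv p A v i)"
    by (simp add: mv_def fun_eq_iff sum_divide_distrib)
  then show "norm2 p (mv p (\<lambda>i j. A i j / 2) v) \<le> a / 2 * norm2 p v"
    using op_leD[OF assms, of v] norm2_scale[of "1/2" "mv p A v" p] by simp
qed

lemma op_le_mm: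
  assumes "op_le p A a" "op_le p B b" "0 \<le> a"
  shows "op_le p (mm p A B) (a * b)"
  unfolding op_le_def
proof
  fix v
  have "norm2 p (mv p (mm p A B) v) = norm2 p (mv p A (mv p B v))"
    by (simp add: mv_mm[abs_def])
  also have "\<dots> \<le> a * norm2 p (mv p B v)" by (rule op_leD[OF assms(1)])
  also have "\<dots> \<le> a * (b * norm2 p v)" by (intro mult_left_mono op_leD[OF assms(2)] assms(3))
  finally show "norm2 p (mv p (mm p A B) v) \<le> a * b * norm2 p v" by (simp add: mult.assoc)
qed

lemma op_le_mono: "op_le p A a \<Longrightarrow> a \<le> b \<Longrightarrow> op_le p A b"
  unfolding op_le_def by (meson L2_set_nonneg mult_right_mono order_trans)

lemma op_le_entry:
  assumes "op_le p A q" "i < p" "j < p"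
  shows "\<bar>A i j\<bar> \<le> q"
proof -
  define e where "e = (\<lambda>k. if k = j then 1 else 0 :: real)"
  have "mv p A e = (\<lambda>i. A i j)" using assms(3) by (simp add: mv_def e_def fun_eq_iff sum.delta if_distrib cong: if_cong)
  moreover have "norm2 p e = 1"
    using assms(3) by (simp add: L2_set_def e_def if_distrib[of "\<lambda>x. x\<^sup>2"] cong: if_cong)
  ultimately have "norm2 p (\<lambda>i. A i j) \<le> q" using op_leD[OF assms(1), of e] by simp
  moreover have "\<bar>A i j\<bar> \<le> norm2 p (\<lambda>i. \<bar>A i j\<bar>)"
    using assms(2) by (intro member_le_L2_set) auto
  moreover have "norm2 p (\<lambda>i. \<bar>A i j\<bar>) = norm2 p (\<lambda>i. A i j)" by (simp add: L2_set_def)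
  ultimately show ?thesis by linarith
qed

lemma op_le_exists: "\<exists>M>0. op_le p A M"
proof -
  define M where "M = L2_set (\<lambda>i. norm2 p (A i)) {..<p}"
  have "op_le p A (M + 1)"
    unfolding op_le_def
  proof
    fix v
    have "norm2 p (mv p A v) = norm2 p (\<lambda>i. \<bar>mv p A v i\<bar>)" by (simp add: L2_set_def)
    also have "\<dots> \<le> norm2 p (\<lambda>i. norm2 p v * norm2 p (A i))"
      by (intro L2_set_mono) (use abs_ip_le[of p] in \<open>auto simp: mv_def ip_def mult.commute\<close>)
    also have "\<dots> = norm2 p v * M" by (subst norm2_scale) (simp add: M_def)
    also have "\<dots> \<le> (M + 1) * norm2 p v" by (simp add: algebra_simps)
    finally show "norm2 p (mv p A v) \<le> (M + 1) * norm2 p v" .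
  qed
  then show ?thesis by (intro exI[of _ "M + 1"]) (simp add: M_def add_nonneg_pos)
qed

text \<open>
  A fixed point \<open>X\<close> of \<open>Y \<mapsto> (B + Y\<^sup>2) / 2\<close> satisfies \<open>(I - X)\<^sup>2 = I - B\<close>. The iteration yields square roots
  without any spectral theory.
\<close>

primrec sqrt_iter :: "nat \<Rightarrow> (nat \<Rightarrow> nat \<Rightarrow> real) \<Rightarrow> nat \<Rightarrow> nat \<Rightarrow> nat \<Rightarrow> real" where
  "sqrt_iter p B 0 = (\<lambda>i j. 0)"
| "sqrt_iter p B (Suc n) = (\<lambda>i j. (B i j + mm p (sqrt_iter p B n) (sqrt_iter p B n) i j) / 2)"

text \<open>
  For \<open>\<parallel>B\<parallel> \<le> q < 1\<close> the map preserves the ball of radius \<open>q\<close> and contracts it with factor \<open>q\<close>, because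
  \<open>Y\<^sup>2 - Y'\<^sup>2 = Y (Y - Y') + (Y - Y') Y'\<close>. Successive differences are therefore
  geometrically small in every entry.
\<close>

lemma sqrt_iter_limit:
  assumes B: "op_le p B q" and q: "0 \<le> q" "q < 1" and sym: "\<And>i j. B i j = B j i"
  obtains X where "op_le p X q" "\<And>i j. X i j = X j i"
    "\<And>i j. i < p \<Longrightarrow> j < p \<Longrightarrow> 2 * X i j = B i j + mm p X X i j"
proof -
  define Y where "Y = sqrt_iter p B"
  define D where "D = (\<lambda>n i j. Y (Suc n) i j - Y n i j)"
  have Ysuc: "Y (Suc n) = (\<lambda>i j. (B i j + mm p (Y n) (Y n) i j) / 2)" for n by (simp add: Y_def)
  have Ysym: "Y n i j = Y n j i" for n i j
  proof (induction n arbitrary: i j)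
    case (Suc n)
    have "mm p (Y n) (Y n) i j = mm p (Y n) (Y n) j i"
      unfolding mm_def
    proof (rule sum.cong)
      fix k show "Y n i k * Y n k j = Y n j k * Y n k i" using Suc[of i k] Suc[of k j] by simp
    qed simp
    then show ?case unfolding Ysuc using sym[of i j] by simp
  qed (simp add: Y_def)
  have Yb: "op_le p (Y n) q" for n
  proof (induction n)
    case 0
    then show ?case using q by (simp add: Y_def op_le_def mv_def[abs_def]) (simp add: L2_set_def sum_nonneg)
  next
    case (Suc n)
    have "op_le p (Y (Suc n)) ((q + q * q) / 2)"
      unfolding Ysuc using op_le_half[OF op_le_add[OF B op_le_mm[OF Suc Suc q(1)]]] .
    moreover have "q * q \<le> q" using q mult_left_mono[of q 1 q] by simp
    ultimately show ?case by (elim op_le_mono) simp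
  qed
  have Db: "op_le p (D n) (q ^ n)" for n
  proof (induction n)
    case 0
    have "D 0 = (\<lambda>i j. B i j / 2)" by (simp add: D_def Y_def mm_def)
    then show ?case using op_le_mono[OF op_le_half[OF B], of "q ^ 0"] q by simp
  next
    case (Suc n)
    have "D (Suc n) i j = (mm p (Y (Suc n)) (D n) i j + mm p (D n) (Y n) i j) / 2" for i j
    proof -
      have "mm p (Y (Suc n)) (D n) i j + mm p (D n) (Y n) i j
          = mm p (Y (Suc n)) (Y (Suc n)) i j - mm p (Y n) (Y n) i j"
        by (simp add: mm_def D_def algebra_simps flip: sum_subtractf sum.distrib)
      moreover have "D (Suc n) i j = (B i j + mm p (Y (Suc n)) (Y (Suc n)) i j) / 2
          - (B i j + mm p (Y n) (Y n) i j) / 2"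
        unfolding D_def fun_cong[OF fun_cong[OF Ysuc[of "Suc n"]], of i j] fun_cong[OF fun_cong[OF Ysuc[of n]], of i j] ..
      ultimately show ?thesis by (simp add: field_simps)
    qed
    then have "D (Suc n) = (\<lambda>i j. (mm p (Y (Suc n)) (D n) i j + mm p (D n) (Y n) i j) / 2)"
      by (intro ext)
    then show ?case
      using op_le_half[OF op_le_add[OF op_le_mm[OF Yb Suc q(1)] op_le_mm[OF Suc Yb[of n] zero_le_power[OF q(1)]]], of "Suc n"]
      by (simp add: mult.commute)
  qed
  have conv: "convergent (\<lambda>n. Y n i j)" if "i < p" "j < p" for i j
  proof -
    have "summable (\<lambda>n. D n i j)"
      by (rule summable_comparison_test[OF _ summable_geometric[of q]])
        (use q op_le_entry[OF Db that] in auto)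
    then have "convergent (\<lambda>n. \<Sum>k<n. D k i j)" by (simp add: summable_iff_convergent)
    moreover have "(\<Sum>k<n. D k i j) = Y n i j" for n
      unfolding D_def by (subst sum_lessThan_telescope) (simp add: Y_def)
    ultimately show ?thesis by simp
  qed
  define X where "X = (\<lambda>i j. lim (\<lambda>n. Y n i j))"
  have lim: "(\<lambda>n. Y n i j) \<longlonglongrightarrow> X i j" if "i < p" "j < p" for i j
    using conv[OF that] by (simp add: X_def convergent_LIMSEQ_iff)
  show ?thesis
  proof
    show "op_le p X q" unfolding op_le_def
    proof
      fix v
      have "(\<lambda>n. norm2 p (mv p (Y n) v)) \<longlonglongrightarrow> norm2 p (mv p X v)"
        unfolding L2_set_def mv_def by (intro tendsto_intros lim) auto
      then show "norm2 p (mv p X v) \<le> q * norm2 p v"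
        by (rule LIMSEQ_le_const2) (use op_leD[OF Yb] in auto)
    qed
    show "X i j = X j i" for i j unfolding X_def using Ysym[of _ i j] by presburger
    fix i j assume ij: "i < p" "j < p"
    have "(\<lambda>n. Y (Suc n) i j) \<longlonglongrightarrow> X i j" using lim[OF ij] by (rule LIMSEQ_Suc)
    moreover have "(\<lambda>n. Y (Suc n) i j) \<longlonglongrightarrow> (B i j + mm p X X i j) / 2"
      unfolding Ysuc mm_def using ij by (intro tendsto_intros lim) auto
    ultimately have "X i j = (B i j + mm p X X i j) / 2" by (rule LIMSEQ_unique)
    then show "2 * X i j = B i j + mm p X X i j" by simp
  qed
qed

text \<open>
  With \<open>w = A v\<close>, evaluating the nonnegative form at \<open>v - w / M\<close> gives \<open>|w|\<^sup>2 / M \<le> \<langle>v, w\<rangle>\<close>. Therefore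
  \<open>|v - w / M|\<^sup>2 \<le> |v|\<^sup>2 - |w|\<^sup>2 / M\<^sup>2\<close>, and \<open>|w|\<close> is at least \<open>|v| / K\<close>. So a suitable multiple of a
  positive-definite matrix has the form \<open>I - B\<close> required by the iteration.
\<close>

lemma op_le_identity_minus:
  assumes sym: "\<And>u v. ip p u (mv p A v) = ip p (mv p A u) v"
    and psd: "\<And>v. 0 \<le> ip p v (mv p A v)"
    and M: "op_le p A M" "0 < M"
    and K: "\<And>v. norm2 p v \<le> K * norm2 p (mv p A v)" "1 \<le> M * K"
  shows "op_le p (\<lambda>i j. (if i = j then 1 else 0) - A i j / M) (sqrt (1 - 1 / (M * K)\<^sup>2))"
  unfolding op_le_def
proof
  fix v
  let ?B = "\<lambda>i j. (if i = j then 1 else 0) - A i j / M"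
  define w where "w = mv p A v"
  have Mv: "mv p A (\<lambda>j. v j - (1/M) * w j) i = w i - (1/M) * mv p A w i" for i
    by (simp add: mv_def w_def algebra_simps sum_subtractf sum_distrib_left)
  have "0 \<le> ip p (\<lambda>j. v j - (1/M) * w j) (mv p A (\<lambda>j. v j - (1/M) * w j))" by (rule psd)
  also have "\<dots> = ip p v w - (2/M) * ip p w w + (1/M)\<^sup>2 * ip p w (mv p A w)"
    unfolding Mv ip_simps using sym[of v w] M(2) by (simp add: w_def power2_eq_square field_simps)
  also have "ip p w (mv p A w) \<le> M * ip p w w"
  proof -
    have "ip p w (mv p A w) \<le> norm2 p w * norm2 p (mv p A w)" using abs_ip_le[of p w "mv p A w"] by simp
    also have "\<dots> \<le> norm2 p w * (M * norm2 p w)" by (intro mult_left_mono op_leD[OF M(1)]) simp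
    finally show ?thesis by (simp flip: norm2_sq add: power2_eq_square mult_ac)
  qed
  finally have 1: "ip p w w / M \<le> ip p v w"
    using M(2) by (simp add: power2_eq_square field_simps)
  have 2: "ip p v v \<le> K\<^sup>2 * ip p w w"
    using power_mono[OF K(1)[of v], of 2] by (simp add: w_def power_mult_distrib flip: norm2_sq)
  have MK: "0 < M * K" using K(2) by simp
  have "K > 0" using MK M(2) by (simp add: zero_less_mult_iff)
  have Bv: "norm2 p (mv p ?B v) = norm2 p (\<lambda>i. v i - (1/M) * w i)"
  proof (rule L2_set_cong)
    fix i assume "i \<in> {..<p}"
    then have "(\<Sum>j<p. (if i = j then 1 else 0) * v j) = v i"
      by (simp add: if_distrib[of "\<lambda>x. x * _"] cong: if_cong)
    then show "mv p ?B v i = v i - (1/M) * w i"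
      by (simp add: mv_def w_def left_diff_distrib sum_subtractf sum_divide_distrib sum_distrib_left)
  qed simp
  have "(norm2 p (\<lambda>i. v i - (1/M) * w i))\<^sup>2 = ip p v v - (2/M) * ip p v w + (1/M)\<^sup>2 * ip p w w"
    unfolding norm2_sq ip_simps using M(2)
    by (simp add: ip_commute[of p w v] power2_eq_square field_simps)
  also have "\<dots> \<le> ip p v v - (2/M) * (ip p w w / M) + (1/M)\<^sup>2 * ip p w w"
    using mult_left_mono[OF 1, of "2/M"] M(2) by simp
  also have "\<dots> = ip p v v - (1/M)\<^sup>2 * ip p w w" by (simp add: power2_eq_square)
  also have "\<dots> \<le> ip p v v - (1/M)\<^sup>2 * (ip p v v / K\<^sup>2)"
    using 2 \<open>K > 0\<close> by (intro diff_left_mono mult_left_mono) (auto simp: divide_le_eq mult.commute)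
  also have "\<dots> = (1 - 1 / (M * K)\<^sup>2) * (norm2 p v)\<^sup>2"
    by (simp add: norm2_sq left_diff_distrib power_mult_distrib power_divide)
  finally have "sqrt ((norm2 p (\<lambda>i. v i - (1/M) * w i))\<^sup>2) \<le> sqrt ((1 - 1 / (M * K)\<^sup>2) * (norm2 p v)\<^sup>2)"
    by (rule real_sqrt_le_mono)
  then show "norm2 p (mv p ?B v) \<le> sqrt (1 - 1 / (M * K)\<^sup>2) * norm2 p v"
    by (simp add: Bv real_sqrt_mult)
qed

text \<open>
  For \<open>D = R - S\<close> equality of the squares gives \<open>R D + D S = 0\<close>. The trace of \<open>D (R D + D S)\<close> is the sum over
  the columns of \<open>D\<close> of their values under the two quadratic forms, so every column of \<open>D\<close> is zero.
\<close>

lemma square_root_unique: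
  assumes sym: "\<And>i j. i < p \<Longrightarrow> j < p \<Longrightarrow> R i j = R j i" "\<And>i j. i < p \<Longrightarrow> j < p \<Longrightarrow> S i j = S j i"
    and psd: "\<And>v. 0 \<le> ip p v (mv p R v)" "\<And>v. 0 \<le> ip p v (mv p S v)"
    and pd: "\<And>v. ip p v (mv p R v) = 0 \<Longrightarrow> \<forall>i<p. v i = 0"
    and eq: "\<And>i j. i < p \<Longrightarrow> j < p \<Longrightarrow> mm p R R i j = mm p S S i j"
    and ij: "i < p" "j < p"
  shows "R i j = S i j"
proof -
  define D where "D = (\<lambda>i j. R i j - S i j)"
  have Dsym: "D i j = D j i" if "i < p" "j < p" for i j using sym that by (simp add: D_def)
  have zero: "mm p R D i j + mm p D S i j = 0" if "i < p" "j < p" for i j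
  proof -
    have "mm p R D i j + mm p D S i j = mm p R R i j - mm p S S i j"
      by (simp add: mm_def D_def algebra_simps flip: sum_subtractf sum.distrib)
    then show ?thesis using eq[OF that] by simp
  qed
  have "0 = (\<Sum>j<p. \<Sum>i<p. D i j * (mm p R D i j + mm p D S i j))"
    using zero by simp
  also have "\<dots> = (\<Sum>j<p. \<Sum>i<p. D i j * mm p R D i j) + (\<Sum>j<p. \<Sum>i<p. D i j * mm p D S i j)"
    by (simp add: distrib_left sum.distrib)
  also have "(\<Sum>j<p. \<Sum>i<p. D i j * mm p R D i j) = (\<Sum>j<p. ip p (\<lambda>i. D i j) (mv p R (\<lambda>i. D i j)))"
    by (simp add: ip_def mv_def mm_def)
  also have "(\<Sum>j<p. \<Sum>i<p. D i j * mm p D S i j) = (\<Sum>i<p. \<Sum>j<p. D i j * mm p D S i j)"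
    by (rule sum.swap)
  also have "\<dots> = (\<Sum>i<p. ip p (\<lambda>j. D j i) (mv p S (\<lambda>j. D j i)))"
  proof (intro sum.cong refl)
    fix i assume i: "i \<in> {..<p}"
    have "(\<Sum>j<p. D i j * mm p D S i j) = (\<Sum>j<p. D j i * (\<Sum>k<p. S j k * D k i))"
    proof (rule sum.cong)
      fix j assume j: "j \<in> {..<p}"
      have "mm p D S i j = (\<Sum>k<p. S j k * D k i)"
        unfolding mm_def
      proof (rule sum.cong)
        fix k assume "k \<in> {..<p}"
        then show "D i k * S k j = S j k * D k i" using i j Dsym[of i k] sym(2)[of j k] by simp
      qed simp
      then show "D i j * mm p D S i j = D j i * (\<Sum>k<p. S j k * D k i)" using i j Dsym[of i j] by simp
    qed simp
    then show "(\<Sum>j<p. D i j * mm p D S i j) = ip p (\<lambda>j. D j i) (mv p S (\<lambda>j. D j i))"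
      by (simp add: ip_def mv_def)
  qed
  finally have "(\<Sum>j<p. ip p (\<lambda>i. D i j) (mv p R (\<lambda>i. D i j))) = 0"
    using sum_nonneg[of "{..<p}" "\<lambda>j. ip p (\<lambda>i. D i j) (mv p R (\<lambda>i. D i j))"]
      sum_nonneg[of "{..<p}" "\<lambda>j. ip p (\<lambda>i. D i j) (mv p S (\<lambda>i. D i j))"] psd by simp
  then have "ip p (\<lambda>i. D i j) (mv p R (\<lambda>i. D i j)) = 0"
    using ij(2) psd by (subst (asm) sum_nonneg_eq_0_iff) auto
  then show ?thesis using pd ij(1) by (force simp: D_def)
qed

section \<open>Sub-Gaussian variables\<close>

text \<open>
  The \<open>\<psi>\<^sub>2\<close> norm is at most \<open>s\<close>. Quantifying over \<open>l\<close> instead of writing \<open>f\<^sup>2 / s\<^sup>2\<close> covers \<open>s = 0\<close>, where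
  the condition says that \<open>f\<close> vanishes almost everywhere; this occurs for \<open>y = 0\<close> and for a zero estimator.
\<close>

definition subgaussian :: "'a measure \<Rightarrow> ('a \<Rightarrow> real) \<Rightarrow> real \<Rightarrow> bool" where
  "subgaussian M f s \<longleftrightarrow> f \<in> borel_measurable M \<and> 0 \<le> s \<and>
     (\<forall>l\<ge>0. l * s\<^sup>2 \<le> 1 \<longrightarrow> (\<integral>\<^sup>+ x. ennreal (exp (l * (f x)\<^sup>2)) \<partial>M) \<le> ennreal (exp 1))"

lemma subgaussianD: "subgaussian M f s \<Longrightarrow> 0 \<le> l \<Longrightarrow> l * s\<^sup>2 \<le> 1 \<Longrightarrow>
    (\<integral>\<^sup>+ x. ennreal (exp (l * (f x)\<^sup>2)) \<partial>M) \<le> ennreal (exp 1)"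
  by (simp add: subgaussian_def)

lemma subgaussian_mono: "subgaussian M f s \<Longrightarrow> s \<le> s' \<Longrightarrow> subgaussian M f s'"
  unfolding subgaussian_def
proof (elim conjE, intro conjI allI impI)
  fix l assume *: "0 \<le> s" "s \<le> s'" "0 \<le> l" "l * s'\<^sup>2 \<le> (1::real)"
    and sg: "\<forall>l\<ge>0. l * s\<^sup>2 \<le> 1 \<longrightarrow> (\<integral>\<^sup>+ x. ennreal (exp (l * (f x)\<^sup>2)) \<partial>M) \<le> ennreal (exp 1)"
  have "l * s\<^sup>2 \<le> l * s'\<^sup>2" using * by (intro mult_left_mono power_mono) auto
  then show "(\<integral>\<^sup>+ x. ennreal (exp (l * (f x)\<^sup>2)) \<partial>M) \<le> ennreal (exp 1)" using sg * by auto
qed auto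

lemma subgaussian_scale:
  assumes "subgaussian M f s"
  shows "subgaussian M (\<lambda>x. c * f x) (\<bar>c\<bar> * s)"
  unfolding subgaussian_def
proof (intro conjI allI impI)
  fix l :: real assume "0 \<le> l" "l * (\<bar>c\<bar> * s)\<^sup>2 \<le> 1"
  then have "(\<integral>\<^sup>+ x. ennreal (exp ((l * c\<^sup>2) * (f x)\<^sup>2)) \<partial>M) \<le> ennreal (exp 1)"
    by (intro subgaussianD[OF assms]) (auto simp: power_mult_distrib mult_ac)
  then show "(\<integral>\<^sup>+ x. ennreal (exp (l * (c * f x)\<^sup>2)) \<partial>M) \<le> ennreal (exp 1)"
    by (simp add: power_mult_distrib mult_ac)
qed (use assms in \<open>auto simp: subgaussian_def\<close>)

lemma psi2_norm_le:
  assumes "subgaussian M f s" "s < t"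
  shows "psi2_norm M f \<le> ennreal t"
proof -
  have s: "0 \<le> s" using assms by (simp add: subgaussian_def)
  have t: "0 < t" using s assms by simp
  have "s\<^sup>2 \<le> t\<^sup>2" using s assms by (intro power_mono) auto
  then have "(\<integral>\<^sup>+ x. ennreal (exp ((1 / t\<^sup>2) * (f x)\<^sup>2)) \<partial>M) \<le> ennreal (exp 1)"
    using t by (intro subgaussianD[OF assms(1)]) (auto simp: divide_le_eq)
  then show ?thesis unfolding psi2_norm_def using t by (intro INF_lower) auto
qed

text \<open>
  The infimum in the norm is attained: for \<open>l s\<^sup>2 < 1\<close> some admissible \<open>u\<close> has \<open>l \<le> 1 / u\<^sup>2\<close>, and Fatou's lemma
  extends the bound to \<open>l s\<^sup>2 = 1\<close>.
\<close>

lemma subgaussian_of_psi2_norm: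
  assumes "f \<in> borel_measurable M" "psi2_norm M f \<le> ennreal s" "0 \<le> s"
  shows "subgaussian M f s"
proof -
  have strict: "(\<integral>\<^sup>+ x. ennreal (exp (l * (f x)\<^sup>2)) \<partial>M) \<le> ennreal (exp 1)"
    if "0 \<le> l" "l * s\<^sup>2 < 1" for l
  proof (cases "l = 0")
    case True
    define t where "t = s + 1"
    have "psi2_norm M f < ennreal t" using assms by (auto simp: t_def ennreal_lessI intro: le_less_trans)
    then obtain u where u: "0 < u" "(\<integral>\<^sup>+ x. ennreal (exp ((f x)\<^sup>2 / u\<^sup>2)) \<partial>M) \<le> ennreal (exp 1)"
      unfolding psi2_norm_def INF_less_iff by auto
    have "(\<integral>\<^sup>+ x. ennreal (exp (l * (f x)\<^sup>2)) \<partial>M) \<le> (\<integral>\<^sup>+ x. ennreal (exp ((f x)\<^sup>2 / u\<^sup>2)) \<partial>M)"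
      using True by (intro nn_integral_mono ennreal_leI) simp
    then show ?thesis using u by simp
  next
    case False
    then have l: "l > 0" using that by simp
    define t where "t = 1 / sqrt l"
    have t: "t > 0" "t\<^sup>2 = 1 / l" using l by (auto simp: t_def power_divide)
    have "s\<^sup>2 < t\<^sup>2" using that l t by (simp add: less_divide_eq mult.commute)
    then have "s < t" using t(1) by (simp add: power_less_imp_less_base)
    then have "psi2_norm M f < ennreal t" using assms(2,3) by (auto intro: le_less_trans ennreal_lessI)
    then obtain u where u: "0 < u" "u < t" "(\<integral>\<^sup>+ x. ennreal (exp ((f x)\<^sup>2 / u\<^sup>2)) \<partial>M) \<le> ennreal (exp 1)"
      unfolding psi2_norm_def INF_less_iff using t(1) by (auto simp: ennreal_less_iff)
    have "u\<^sup>2 \<le> t\<^sup>2" using u by (intro power_mono) auto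
    then have "l \<le> 1 / u\<^sup>2" using t(2) u(1) l by (simp add: field_simps)
    then have "(\<integral>\<^sup>+ x. ennreal (exp (l * (f x)\<^sup>2)) \<partial>M) \<le> (\<integral>\<^sup>+ x. ennreal (exp ((f x)\<^sup>2 / u\<^sup>2)) \<partial>M)"
      by (intro nn_integral_mono ennreal_leI) (auto dest: mult_right_mono[of l _ "(f _)\<^sup>2"])
    then show ?thesis using u by simp
  qed
  show ?thesis unfolding subgaussian_def
  proof (intro conjI allI impI assms)
    fix l :: real assume l: "0 \<le> l" "l * s\<^sup>2 \<le> 1"
    define r where "r = (\<lambda>n. 1 - 1 / real (Suc n))"
    have r: "0 \<le> r n" "r n < 1" for n by (simp_all add: r_def)
    have rlim: "r \<longlonglongrightarrow> 1"
      unfolding r_def using tendsto_diff[OF tendsto_const LIMSEQ_Suc[OF lim_1_over_n], of 1] by simp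
    have bnd: "(\<integral>\<^sup>+ x. ennreal (exp (r n * l * (f x)\<^sup>2)) \<partial>M) \<le> ennreal (exp 1)" for n
    proof (rule strict)
      show "0 \<le> r n * l" using r l by simp
      have "r n * (l * s\<^sup>2) \<le> r n * 1" using r l by (intro mult_left_mono) auto
      then show "r n * l * s\<^sup>2 < 1" using r[of n] by (simp add: mult.assoc)
    qed
    have "(\<integral>\<^sup>+ x. ennreal (exp (l * (f x)\<^sup>2)) \<partial>M)
        = (\<integral>\<^sup>+ x. liminf (\<lambda>n. ennreal (exp (r n * l * (f x)\<^sup>2))) \<partial>M)"
    proof (rule nn_integral_cong)
      fix x
      have "(\<lambda>n. ennreal (exp (r n * l * (f x)\<^sup>2))) \<longlonglongrightarrow> ennreal (exp (1 * l * (f x)\<^sup>2))"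
        by (intro tendsto_ennrealI tendsto_exp tendsto_mult rlim tendsto_const)
      then show "ennreal (exp (l * (f x)\<^sup>2)) = liminf (\<lambda>n. ennreal (exp (r n * l * (f x)\<^sup>2)))"
        using lim_imp_Liminf[OF sequentially_bot] by (metis mult_1)
    qed
    also have "\<dots> \<le> liminf (\<lambda>n. \<integral>\<^sup>+ x. ennreal (exp (r n * l * (f x)\<^sup>2)) \<partial>M)"
      using assms(1) by (intro nn_integral_liminf) measurable
    also have "\<dots> \<le> liminf (\<lambda>n. ennreal (exp 1))"
      by (intro Liminf_mono always_eventually allI bnd)
    finally show "(\<integral>\<^sup>+ x. ennreal (exp (l * (f x)\<^sup>2)) \<partial>M) \<le> ennreal (exp 1)" by (simp add: Liminf_const)
  qed
qed

lemma subgaussian_zero_AE: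
  assumes "subgaussian M f 0"
  shows "AE x in M. f x = 0"
proof -
  have f[measurable]: "f \<in> borel_measurable M" using assms by (simp add: subgaussian_def)
  define I where "I = (\<integral>\<^sup>+ x. ennreal ((f x)\<^sup>2) \<partial>M)"
  have le: "ennreal (real n) * I \<le> ennreal (exp 1)" for n
  proof -
    have "ennreal (real n) * I = (\<integral>\<^sup>+ x. ennreal (real n * (f x)\<^sup>2) \<partial>M)"
      unfolding I_def by (simp add: nn_integral_cmult ennreal_mult'')
    also have "\<dots> \<le> (\<integral>\<^sup>+ x. ennreal (exp (real n * (f x)\<^sup>2)) \<partial>M)"
      by (intro nn_integral_mono ennreal_leI) (use exp_ge_add_one_self in \<open>smt (verit)\<close>)
    also have "\<dots> \<le> ennreal (exp 1)" by (intro subgaussianD[OF assms]) auto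
    finally show ?thesis .
  qed
  have "I < \<infinity>" using le[of 1] by (auto simp: less_top intro: le_less_trans)
  then obtain a where a: "I = ennreal a" "0 \<le> a" by (cases I) auto
  have "a = 0"
  proof (rule ccontr)
    assume "a \<noteq> 0"
    then obtain n where "exp 1 < real n * a" using a(2) reals_Archimedean3[of a] by auto
    moreover have "real n * a \<le> exp 1" using le[of n] a by (simp add: ennreal_mult''[symmetric])
    ultimately show False by simp
  qed
  then have "I = 0" using a by simp
  then have "AE x in M. ennreal ((f x)\<^sup>2) = 0" unfolding I_def by (subst (asm) nn_integral_0_iff_AE) auto
  then show ?thesis by eventually_elim simp
qed

lemma subgaussian_integrable_square:
  assumes "subgaussian M f s"
  shows "integrable M (\<lambda>x. (f x)\<^sup>2)"
proof (rule integrableI_bounded)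
  have [measurable]: "f \<in> borel_measurable M" using assms by (simp add: subgaussian_def)
  show "(\<lambda>x. (f x)\<^sup>2) \<in> borel_measurable M" by measurable
  define l where "l = 1 / (s\<^sup>2 + 1)"
  have pos: "0 < s\<^sup>2 + 1" by (simp add: add_nonneg_pos)
  then have l: "0 < l" "l * s\<^sup>2 \<le> 1" by (simp_all add: l_def divide_le_eq)
  have fin: "(\<integral>\<^sup>+ x. ennreal (exp (l * (f x)\<^sup>2)) \<partial>M) \<le> ennreal (exp 1)"
    using l by (intro subgaussianD[OF assms]) auto
  have "(\<integral>\<^sup>+ x. ennreal (norm ((f x)\<^sup>2)) \<partial>M) \<le> (\<integral>\<^sup>+ x. ennreal (1 / l) * ennreal (exp (l * (f x)\<^sup>2)) \<partial>M)"
  proof (rule nn_integral_mono)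
    fix x
    have "l * (f x)\<^sup>2 \<le> exp (l * (f x)\<^sup>2)" using exp_ge_add_one_self[of "l * (f x)\<^sup>2"] by linarith
    then have "(f x)\<^sup>2 \<le> 1 / l * exp (l * (f x)\<^sup>2)" using l by (simp add: le_divide_eq mult.commute)
    then show "ennreal (norm ((f x)\<^sup>2)) \<le> ennreal (1 / l) * ennreal (exp (l * (f x)\<^sup>2))"
      by (simp add: ennreal_leI flip: ennreal_mult'')
  qed
  also have "\<dots> = ennreal (1 / l) * (\<integral>\<^sup>+ x. ennreal (exp (l * (f x)\<^sup>2)) \<partial>M)"
    by (rule nn_integral_cmult) measurable
  also have "\<dots> \<le> ennreal (1 / l) * ennreal (exp 1)" by (rule mult_left_mono[OF fin]) simp
  also have "\<dots> < \<infinity>" by (simp flip: ennreal_mult'')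
  finally show "(\<integral>\<^sup>+ x. ennreal (norm ((f x)\<^sup>2)) \<partial>M) < \<infinity>" .
qed

text \<open>
  Since \<open>e a \<le> exp a\<close>, the bound \<open>e\<close> on the exponential moment gives the constant one. For isotropic vectors
  this implies \<open>\<omega> \<ge> 1\<close>.
\<close>

lemma subgaussian_second_moment:
  assumes "subgaussian M f s"
  shows "(\<integral>x. (f x)\<^sup>2 \<partial>M) \<le> s\<^sup>2"
proof (cases "s = 0")
  case True
  then have "AE x in M. (f x)\<^sup>2 = 0" using subgaussian_zero_AE[of M f] assms by auto
  then have "(\<integral>x. (f x)\<^sup>2 \<partial>M) = (\<integral>x. 0 \<partial>M)"
    using subgaussian_integrable_square[OF assms] by (intro integral_cong_AE) auto
  then show ?thesis by simp
next
  case False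
  then have s: "s > 0" using assms by (simp add: subgaussian_def)
  have "ennreal (exp 1 / s\<^sup>2 * (\<integral>x. (f x)\<^sup>2 \<partial>M)) = (\<integral>\<^sup>+x. ennreal (exp 1 / s\<^sup>2 * (f x)\<^sup>2) \<partial>M)"
    using subgaussian_integrable_square[OF assms] by (subst nn_integral_eq_integral) auto
  also have "\<dots> \<le> (\<integral>\<^sup>+ x. ennreal (exp ((1 / s\<^sup>2) * (f x)\<^sup>2)) \<partial>M)"
  proof (intro nn_integral_mono ennreal_leI)
    fix x
    define a where "a = (f x)\<^sup>2 / s\<^sup>2"
    have "exp 1 * a \<le> exp 1 * exp (a - 1)" using exp_ge_add_one_self[of "a - 1"] by simp
    also have "\<dots> = exp a" by (simp flip: exp_add)
    finally show "exp 1 / s\<^sup>2 * (f x)\<^sup>2 \<le> exp ((1 / s\<^sup>2) * (f x)\<^sup>2)" by (simp add: a_def)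
  qed
  also have "\<dots> \<le> ennreal (exp 1)" using s by (intro subgaussianD[OF assms]) auto
  finally have "exp 1 * ((\<integral>x. (f x)\<^sup>2 \<partial>M) / s\<^sup>2) \<le> exp 1 * 1" by simp
  then have "(\<integral>x. (f x)\<^sup>2 \<partial>M) / s\<^sup>2 \<le> 1" by (subst (asm) mult_le_cancel_left_pos) auto
  then show ?thesis using s by (simp add: divide_le_eq)
qed

lemma exp_le_quadratic: "exp (a::real) \<le> 1 + a + a\<^sup>2 / 2 * exp \<bar>a\<bar>"
proof -
  obtain t where t: "\<bar>t\<bar> \<le> \<bar>a\<bar>" "exp a = (\<Sum>m<2. a ^ m / fact m) + exp t / fact 2 * a ^ 2"
    using Maclaurin_exp_le[of a 2] by auto
  have "exp t * a\<^sup>2 \<le> exp \<bar>a\<bar> * a\<^sup>2" using t(1) by (intro mult_right_mono) auto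
  then show ?thesis using t(2) by (simp add: numeral_2_eq_2 fact_numeral field_simps)
qed

text \<open>
  With \<open>X = f\<^sup>2\<close>, \<open>exp_le_quadratic\<close> reduces the claim to \<open>X\<^sup>2 exp(|l| X) \<le> 8 s\<^sup>4 exp(X / s\<^sup>2)\<close>, which holds for
  \<open>|l| \<le> 1 / (2 s\<^sup>2)\<close> because \<open>u\<^sup>2 \<le> 2 exp u\<close> at \<open>u = X / (2 s\<^sup>2)\<close>. Both signs of \<open>l\<close> are covered, so the same bound
  serves for the upper and the lower tail. The constant \<open>11\<close> bounds \<open>4 e\<close>.
\<close>

lemma subgaussian_square_mgf:
  assumes M: "prob_space M" and sg: "subgaussian M f s" and s: "0 < s"
    and l: "2 * \<bar>l\<bar> * s\<^sup>2 \<le> 1"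
  shows "(\<integral>\<^sup>+ x. ennreal (exp (l * ((f x)\<^sup>2 - (\<integral>x. (f x)\<^sup>2 \<partial>M)))) \<partial>M) \<le> ennreal (exp (11 * l\<^sup>2 * s ^ 4))"
proof -
  interpret prob_space M by fact
  have f[measurable]: "f \<in> borel_measurable M" using sg by (simp add: subgaussian_def)
  have int: "integrable M (\<lambda>x. (f x)\<^sup>2)" by (rule subgaussian_integrable_square[OF sg])
  define m where "m = (\<integral>x. (f x)\<^sup>2 \<partial>M)"
  define E where "E = (\<lambda>x. exp ((1 / s\<^sup>2) * (f x)\<^sup>2))"
  have Ele: "(\<integral>\<^sup>+ x. ennreal (E x) \<partial>M) \<le> ennreal (exp 1)"
    unfolding E_def using s by (intro subgaussianD[OF sg]) auto
  have intE: "integrable M E"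
    by (rule integrableI_bounded) (use Ele in \<open>auto simp: E_def less_top[symmetric] top_unique\<close>)
  have "ennreal (\<integral>x. E x \<partial>M) \<le> ennreal (exp 1)"
    using Ele intE by (subst (asm) nn_integral_eq_integral) (auto simp: E_def)
  then have EE: "(\<integral>x. E x \<partial>M) \<le> exp 1" by simp
  have pw: "exp (l * (f x)\<^sup>2) \<le> 1 + l * (f x)\<^sup>2 + 4 * l\<^sup>2 * s ^ 4 * E x" for x
  proof -
    define u where "u = (f x)\<^sup>2 / (2 * s\<^sup>2)"
    have u: "0 \<le> u" "(f x)\<^sup>2 = 2 * s\<^sup>2 * u" using s by (auto simp: u_def)
    have "u\<^sup>2 / 2 \<le> exp u" using exp_lower_Taylor_quadratic[OF u(1)] u(1) by simp
    then have "u\<^sup>2 \<le> 2 * exp u" by simp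
    moreover have "exp (\<bar>l\<bar> * (f x)\<^sup>2) \<le> exp u"
      using mult_right_mono[OF l u(1)] u by (simp add: mult_ac)
    ultimately have "u\<^sup>2 * exp (\<bar>l\<bar> * (f x)\<^sup>2) \<le> 2 * exp u * exp u" by (intro mult_mono) auto
    also have "\<dots> = 2 * E x" using s by (simp add: E_def u_def flip: exp_add)
    finally have "2 * l\<^sup>2 * s ^ 4 * (u\<^sup>2 * exp (\<bar>l\<bar> * (f x)\<^sup>2)) \<le> 2 * l\<^sup>2 * s ^ 4 * (2 * E x)"
      by (intro mult_left_mono) auto
    moreover have "(l * (f x)\<^sup>2)\<^sup>2 / 2 = 2 * l\<^sup>2 * s ^ 4 * u\<^sup>2"
      by (simp add: u(2) power_mult_distrib flip: power_mult)
    ultimately show ?thesis using exp_le_quadratic[of "l * (f x)\<^sup>2"] by (simp add: abs_mult mult_ac)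
  qed
  have "(\<integral>\<^sup>+ x. ennreal (exp (l * ((f x)\<^sup>2 - m))) \<partial>M)
     \<le> (\<integral>\<^sup>+ x. ennreal (exp (- l * m) * (1 + l * (f x)\<^sup>2 + 4 * l\<^sup>2 * s ^ 4 * E x)) \<partial>M)"
  proof (intro nn_integral_mono ennreal_leI)
    fix x
    have "exp (l * ((f x)\<^sup>2 - m)) = exp (- l * m) * exp (l * (f x)\<^sup>2)"
      by (simp add: right_diff_distrib flip: exp_add)
    then show "exp (l * ((f x)\<^sup>2 - m)) \<le> exp (- l * m) * (1 + l * (f x)\<^sup>2 + 4 * l\<^sup>2 * s ^ 4 * E x)"
      using pw[of x] by simp
  qed
  also have "\<dots> = ennreal (\<integral>x. exp (- l * m) * (1 + l * (f x)\<^sup>2 + 4 * l\<^sup>2 * s ^ 4 * E x) \<partial>M)"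
    using int intE by (intro nn_integral_eq_integral) (auto intro!: mult_nonneg_nonneg order_trans[OF _ pw] )
  finally have A: "(\<integral>\<^sup>+ x. ennreal (exp (l * ((f x)\<^sup>2 - m))) \<partial>M) \<le> \<dots>" .
  have "(\<integral>x. exp (- l * m) * (1 + l * (f x)\<^sup>2 + 4 * l\<^sup>2 * s ^ 4 * E x) \<partial>M)
     = exp (- l * m) * (1 + l * m + 4 * l\<^sup>2 * s ^ 4 * (\<integral>x. E x \<partial>M))"
    using int intE by (simp add: m_def prob_space)
  also have "\<dots> \<le> exp (11 * l\<^sup>2 * s ^ 4)"
  proof -
    have "exp (1::real) \<le> 11 / 4" using e_less_272 by simp
    then have "4 * l\<^sup>2 * s ^ 4 * (\<integral>x. E x \<partial>M) \<le> 4 * l\<^sup>2 * s ^ 4 * (11 / 4)"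
      using EE by (intro mult_left_mono) auto
    then have "1 + l * m + 4 * l\<^sup>2 * s ^ 4 * (\<integral>x. E x \<partial>M) \<le> 1 + (l * m + 11 * l\<^sup>2 * s ^ 4)" by simp
    also have "\<dots> \<le> exp (l * m + 11 * l\<^sup>2 * s ^ 4)" by (rule exp_ge_add_one_self)
    finally have "exp (- l * m) * (1 + l * m + 4 * l\<^sup>2 * s ^ 4 * (\<integral>x. E x \<partial>M))
      \<le> exp (- l * m) * exp (l * m + 11 * l\<^sup>2 * s ^ 4)" by (intro mult_left_mono) auto
    then show ?thesis by (simp flip: exp_add)
  qed
  finally show ?thesis using A unfolding m_def by (meson ennreal_leI order_trans)
qed

section \<open>Tail bounds for blocks of independent samples\<close>

lemma prod_exp_tail:
  fixes P :: "'a measure" and g :: "'a \<Rightarrow> real" and R :: "'i set"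
  assumes prob_P: "prob_space P" and R: "finite R" and g[measurable]: "g \<in> borel_measurable P"
    and mgf: "(\<integral>\<^sup>+ s. ennreal (exp (g s)) \<partial>P) \<le> ennreal B" and B: "0 \<le> B"
  shows "emeasure (PiM R (\<lambda>_. P)) {d \<in> space (PiM R (\<lambda>_. P)). a \<le> (\<Sum>i\<in>R. g (d i))}
    \<le> ennreal (B ^ card R * exp (- a))"
proof -
  interpret prob_space P by (rule prob_P)
  interpret product_sigma_finite "\<lambda>_::'i. P" by standard
  let ?Q = "PiM R (\<lambda>_. P)"
  let ?E = "{d \<in> space ?Q. a \<le> (\<Sum>i\<in>R. g (d i))}"
  have [measurable]: "?E \<in> sets ?Q" by measurable
  have "emeasure ?Q ?E = (\<integral>\<^sup>+ d. indicator ?E d \<partial>?Q)" by simp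
  also have "\<dots> \<le> (\<integral>\<^sup>+ d. ennreal (exp (- a)) * (\<Prod>i\<in>R. ennreal (exp (g (d i)))) \<partial>?Q)"
  proof (rule nn_integral_mono)
    fix d
    have "(\<Prod>i\<in>R. ennreal (exp (g (d i)))) = ennreal (exp (\<Sum>i\<in>R. g (d i)))"
      using R by (simp add: exp_sum prod_ennreal)
    moreover have "1 \<le> ennreal (exp (- a) * exp (\<Sum>i\<in>R. g (d i)))" if "d \<in> ?E"
      using that by (simp flip: exp_add ennreal_1)
    ultimately show "indicator ?E d \<le> ennreal (exp (- a)) * (\<Prod>i\<in>R. ennreal (exp (g (d i))))"
      by (simp add: indicator_def ennreal_mult'')
  qed
  also have "\<dots> = ennreal (exp (- a)) * (\<integral>\<^sup>+ d. (\<Prod>i\<in>R. ennreal (exp (g (d i)))) \<partial>?Q)"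
    by (intro nn_integral_cmult) measurable
  also have "(\<integral>\<^sup>+ d. (\<Prod>i\<in>R. ennreal (exp (g (d i)))) \<partial>?Q) = (\<Prod>i\<in>R. \<integral>\<^sup>+ s. ennreal (exp (g s)) \<partial>P)"
    using R by (intro product_nn_integral_prod) auto
  also have "\<dots> \<le> (\<Prod>i\<in>R. ennreal B)" by (intro prod_mono_ennreal mgf)
  also have "ennreal (exp (- a)) * \<dots> = ennreal (B ^ card R * exp (- a))"
    using B by (simp add: ennreal_power ennreal_mult'' mult.commute)
  finally show ?thesis by (simp add: mult_left_mono)
qed

lemma subgaussian_tail:
  fixes P :: "'a measure" and R :: "'i set"
  assumes prob_P: "prob_space P" and R: "finite R" and sg: "subgaussian P f s"
  shows "emeasure (PiM R (\<lambda>_. P)) {d \<in> space (PiM R (\<lambda>_. P)). s\<^sup>2 * u < (\<Sum>i\<in>R. (f (d i))\<^sup>2)}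
    \<le> ennreal (exp (real (card R) - u))"
proof -
  interpret prob_space P by (rule prob_P)
  interpret product_prob_space "\<lambda>_::'i. P" by standard
  let ?Q = "PiM R (\<lambda>_. P)"
  have f[measurable]: "f \<in> borel_measurable P" using sg by (simp add: subgaussian_def)
  show ?thesis
  proof (cases "s = 0")
    case True
    have "AE x in P. f x = 0" using subgaussian_zero_AE sg True by blast
    then have "AE d in ?Q. f (d i) = 0" if "i \<in> R" for i
      using that \<open>AE x in P. f x = 0\<close> prob_P by (intro AE_PiM_component)
    then have "AE d in ?Q. \<forall>i\<in>R. f (d i) = 0" using R by (intro AE_finite_allI) auto
    then have "AE d in ?Q. \<not> s\<^sup>2 * u < (\<Sum>i\<in>R. (f (d i))\<^sup>2)"
      by (rule eventually_mono) (use True in simp)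
    then have "emeasure ?Q {d \<in> space ?Q. s\<^sup>2 * u < (\<Sum>i\<in>R. (f (d i))\<^sup>2)} = 0"
      by (subst (asm) AE_iff_measurable[OF _ refl]) auto
    then show ?thesis by simp
  next
    case False
    then have s: "s > 0" using sg by (simp add: subgaussian_def)
    have "emeasure ?Q {d \<in> space ?Q. s\<^sup>2 * u < (\<Sum>i\<in>R. (f (d i))\<^sup>2)}
       \<le> emeasure ?Q {d \<in> space ?Q. u \<le> (\<Sum>i\<in>R. (1 / s\<^sup>2) * (f (d i))\<^sup>2)}"
      using s by (intro emeasure_mono) (auto simp: sum_divide_distrib[symmetric] field_simps)
    also have "\<dots> \<le> ennreal (exp 1 ^ card R * exp (- u))"
      using s by (intro prod_exp_tail prob_P R subgaussianD[OF sg]) auto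
    also have "exp 1 ^ card R * exp (- u) = exp (real (card R) - u)"
      by (simp add: exp_diff exp_minus field_simps flip: exp_of_nat_mult)
    finally show ?thesis .
  qed
qed

text \<open>
  Fubini's theorem in the form of conditioning on the coordinates in \<open>S\<close>.
\<close>

lemma emeasure_le_of_sections:
  fixes P :: "'a measure"
  assumes prob_P: "prob_space P" and fin: "finite S" "finite R" "S \<inter> R = {}"
    and E: "E \<in> sets (PiM (S \<union> R) (\<lambda>_. P))"
    and sec: "\<And>e. e \<in> space (PiM S (\<lambda>_. P)) \<Longrightarrow>
      emeasure (PiM R (\<lambda>_. P)) {d \<in> space (PiM R (\<lambda>_. P)). merge S R (e, d) \<in> E} \<le> q"
  shows "emeasure (PiM (S \<union> R) (\<lambda>_. P)) E \<le> q"
proof -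
  interpret prob_space P by (rule prob_P)
  interpret product_prob_space "\<lambda>_. P" by standard
  interpret S: prob_space "PiM S (\<lambda>_. P)" by (intro prob_space_PiM prob_P)
  have "emeasure (PiM (S \<union> R) (\<lambda>_. P)) E = (\<integral>\<^sup>+ d. indicator E d \<partial>PiM (S \<union> R) (\<lambda>_. P))"
    using E by simp
  also have "\<dots> = (\<integral>\<^sup>+ e. (\<integral>\<^sup>+ d. indicator E (merge S R (e, d)) \<partial>PiM R (\<lambda>_. P)) \<partial>PiM S (\<lambda>_. P))"
    using fin E by (intro product_nn_integral_fold) auto
  also have "\<dots> \<le> (\<integral>\<^sup>+ e. q \<partial>PiM S (\<lambda>_. P))"
  proof (rule nn_integral_mono)
    fix e assume e: "e \<in> space (PiM S (\<lambda>_. P))"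
    have m: "(\<lambda>d. merge S R (e, d)) \<in> measurable (PiM R (\<lambda>_. P)) (PiM (S \<union> R) (\<lambda>_. P))"
      using e by (intro measurable_compose[OF _ measurable_merge]) auto
    have "(\<integral>\<^sup>+ d. indicator E (merge S R (e, d)) \<partial>PiM R (\<lambda>_. P))
        = (\<integral>\<^sup>+ d. indicator {d \<in> space (PiM R (\<lambda>_. P)). merge S R (e, d) \<in> E} d \<partial>PiM R (\<lambda>_. P))"
      by (intro nn_integral_cong) (auto simp: indicator_def)
    also have "\<dots> = emeasure (PiM R (\<lambda>_. P)) {d \<in> space (PiM R (\<lambda>_. P)). merge S R (e, d) \<in> E}"
      using measurable_sets[OF m E] by (intro nn_integral_indicator) (simp add: vimage_def Int_def conj_commute)
    finally show "(\<integral>\<^sup>+ d. indicator E (merge S R (e, d)) \<partial>PiM R (\<lambda>_. P)) \<le> q" using sec[OF e] by simp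
  qed
  also have "\<dots> = q" by (simp add: S.emeasure_space_1)
  finally show ?thesis .
qed

text \<open>
  The variable whose squares are summed may depend on the samples outside the block. This is how the
  independence of a leave-out estimator from the rows that were left out enters the proof.
\<close>

lemma conditional_block_tail:
  fixes P :: "'a measure" and f :: "('i \<Rightarrow> 'a) \<Rightarrow> 'a \<Rightarrow> real" and s :: "('i \<Rightarrow> 'a) \<Rightarrow> real"
    and u :: real
  assumes prob_P: "prob_space P" and I: "finite I" "R \<subseteq> I"
    and loc: "\<And>d d'. (\<And>i. i \<in> I - R \<Longrightarrow> d i = d' i) \<Longrightarrow> f d = f d' \<and> s d = s d'"
    and meas: "\<And>i. i \<in> R \<Longrightarrow> (\<lambda>d. f d (d i)) \<in> borel_measurable (PiM I (\<lambda>_. P))"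
      "s \<in> borel_measurable (PiM I (\<lambda>_. P))"
    and sg: "\<And>d. subgaussian P (f d) (s d)"
  defines "E \<equiv> {d \<in> space (PiM I (\<lambda>_. P)). (s d)\<^sup>2 * u < (\<Sum>i\<in>R. (f d (d i))\<^sup>2)}"
  shows "E \<in> sets (PiM I (\<lambda>_. P))" "measure (PiM I (\<lambda>_. P)) E \<le> exp (real (card R) - u)"
proof -
  note meas[measurable]
  show E: "E \<in> sets (PiM I (\<lambda>_. P))" unfolding E_def by measurable
  define S where "S = I - R"
  have IS: "I = S \<union> R" and dis: "S \<inter> R = {}" and fin: "finite S" "finite R"
    using I finite_subset by (auto simp: S_def)
  have "emeasure (PiM (S \<union> R) (\<lambda>_. P)) E \<le> ennreal (exp (real (card R) - u))"
  proof (rule emeasure_le_of_sections[OF prob_P fin dis])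
    show "E \<in> sets (PiM (S \<union> R) (\<lambda>_. P))" using E IS by simp
    fix e assume "e \<in> space (PiM S (\<lambda>_. P))"
    have "{d \<in> space (PiM R (\<lambda>_. P)). merge S R (e, d) \<in> E}
        \<subseteq> {d \<in> space (PiM R (\<lambda>_. P)). (s e)\<^sup>2 * u < (\<Sum>i\<in>R. (f e (d i))\<^sup>2)}"
    proof safe
      fix d assume "merge S R (e, d) \<in> E"
      then have "(s (merge S R (e, d)))\<^sup>2 * u < (\<Sum>i\<in>R. (f (merge S R (e, d)) (merge S R (e, d) i))\<^sup>2)"
        by (simp add: E_def)
      moreover have "f (merge S R (e, d)) = f e \<and> s (merge S R (e, d)) = s e"
        using dis by (intro loc) (simp add: S_def[symmetric])
      moreover have "merge S R (e, d) i = d i" if "i \<in> R" for i using that dis by simp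
      ultimately show "(s e)\<^sup>2 * u < (\<Sum>i\<in>R. (f e (d i))\<^sup>2)" by simp
    qed
    then have "emeasure (PiM R (\<lambda>_. P)) {d \<in> space (PiM R (\<lambda>_. P)). merge S R (e, d) \<in> E}
        \<le> emeasure (PiM R (\<lambda>_. P)) {d \<in> space (PiM R (\<lambda>_. P)). (s e)\<^sup>2 * u < (\<Sum>i\<in>R. (f e (d i))\<^sup>2)}"
    proof (rule emeasure_mono)
      have [measurable]: "f e \<in> borel_measurable P" using sg[of e] by (simp add: subgaussian_def)
      show "{d \<in> space (PiM R (\<lambda>_. P)). (s e)\<^sup>2 * u < (\<Sum>i\<in>R. (f e (d i))\<^sup>2)} \<in> sets (PiM R (\<lambda>_. P))"
        by measurable
    qed
    also have "\<dots> \<le> ennreal (exp (real (card R) - u))" by (rule subgaussian_tail[OF prob_P fin(2) sg])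
    finally show "emeasure (PiM R (\<lambda>_. P)) {d \<in> space (PiM R (\<lambda>_. P)). merge S R (e, d) \<in> E}
        \<le> ennreal (exp (real (card R) - u))" .
  qed
  then show "measure (PiM I (\<lambda>_. P)) E \<le> exp (real (card R) - u)"
    unfolding IS measure_def by (rule enn2real_leI[rotated]) simp
qed

text \<open>
  With \<open>x = k / n \<le> 1\<close>, the number of sets times \<open>x\<^sup>k\<close> is at most \<open>(1 + x)\<^sup>n \<le> e\<^sup>k\<close>.
\<close>

lemma card_small_subsets:
  assumes "1 \<le> k" "k \<le> n"
  shows "real (card {R. R \<subseteq> {..<n} \<and> card R \<le> k}) \<le> exp (real k * ln (exp 1 * real n / real k))"
proof -
  define x where "x = real k / real n"
  have x: "0 < x" "x \<le> 1" using assms by (simp_all add: x_def)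
  have "{R. R \<subseteq> {..<n} \<and> card R \<le> k} = (\<Union>j\<in>{..k}. {R. R \<subseteq> {..<n} \<and> card R = j})" by auto
  also have "card \<dots> = (\<Sum>j\<le>k. card {R. R \<subseteq> {..<n} \<and> card R = j})"
    by (intro card_UN_disjoint) (auto intro: finite_subset[of _ "Pow {..<n}"])
  also have "\<dots> = (\<Sum>j\<le>k. n choose j)" by (simp add: n_subsets)
  finally have card: "card {R. R \<subseteq> {..<n} \<and> card R \<le> k} = (\<Sum>j\<le>k. n choose j)" .
  have "real (\<Sum>j\<le>k. n choose j) * x ^ k \<le> (\<Sum>j\<le>k. real (n choose j) * x ^ j)"
    unfolding of_nat_sum sum_distrib_right
    by (intro sum_mono mult_left_mono power_decreasing) (use x in auto)
  also have "\<dots> \<le> (\<Sum>j\<le>n. real (n choose j) * x ^ j)"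
    using assms x by (intro sum_mono2) auto
  also have "\<dots> = (x + 1) ^ n" by (subst binomial_ring) simp
  also have "\<dots> \<le> exp x ^ n" using x exp_ge_add_one_self[of x] by (intro power_mono) (auto simp: add.commute)
  also have "\<dots> = exp (real k)" using assms by (simp add: x_def flip: exp_of_nat_mult)
  finally have *: "real (\<Sum>j\<le>k. n choose j) \<le> exp (real k) / x ^ k" using x by (simp add: le_divide_eq)
  have "ln (exp 1 * real n / real k) = 1 - ln x"
    using assms by (simp add: x_def ln_div ln_mult)
  then have "exp (real k * ln (exp 1 * real n / real k)) = exp (real k) / exp (real k * ln x)"
    by (simp add: right_diff_distrib exp_diff)
  also have "exp (real k * ln x) = x ^ k" using x by (simp add: exp_of_nat_mult)
  finally show ?thesis using * card by simp
qed

section \<open>Removing rows from a least-squares problem\<close>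

lemma L2_set_sq: "(L2_set f A)\<^sup>2 = (\<Sum>i\<in>A. (f i)\<^sup>2)"
  by (simp add: L2_set_def sum_nonneg)

lemma abs_sum_mult_le_L2: "\<bar>\<Sum>i\<in>A. f i * g i\<bar> \<le> L2_set f A * L2_set g A"
proof -
  have "\<bar>\<Sum>i\<in>A. f i * g i\<bar> \<le> (\<Sum>i\<in>A. \<bar>f i\<bar> * \<bar>g i\<bar>)"
    by (rule order_trans[OF sum_abs]) (simp add: abs_mult)
  also have "\<dots> \<le> L2_set f A * L2_set g A" by (rule L2_set_mult_ineq)
  finally show ?thesis .
qed

text \<open>
  The normal equations in weak form, tested against every direction. In this form they are stable under a
  change of coordinates, and sums over rows can be split without matrices.
\<close>

definition normal_eq :: "nat \<Rightarrow> (nat \<Rightarrow> nat \<Rightarrow> real) \<Rightarrow> (nat \<Rightarrow> real) \<Rightarrow> nat set \<Rightarrow> (nat \<Rightarrow> real) \<Rightarrow> bool" where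
  "normal_eq p x y S b \<longleftrightarrow> (\<forall>h. (\<Sum>i\<in>S. ip p h (x i) * (ip p b (x i) - y i)) = 0)"

text \<open>
  Testing with \<open>b\<close> itself shows that the fitted values are orthogonal to the residuals.
\<close>

lemma normal_eq_fit_le:
  assumes "normal_eq p x y S b"
  shows "(\<Sum>i\<in>S. (ip p b (x i))\<^sup>2) \<le> (\<Sum>i\<in>S. (y i)\<^sup>2)"
proof -
  let ?f = "\<lambda>i. ip p b (x i)"
  have "(L2_set ?f S)\<^sup>2 = (\<Sum>i\<in>S. ?f i * (?f i - y i)) + (\<Sum>i\<in>S. ?f i * y i)"
    unfolding L2_set_sq by (simp add: algebra_simps power2_eq_square flip: sum.distrib)
  also have "\<dots> = (\<Sum>i\<in>S. ?f i * y i)" using assms by (simp add: normal_eq_def)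
  also have "\<dots> \<le> L2_set ?f S * L2_set y S" using abs_sum_mult_le_L2[of ?f y S] by simp
  finally have "L2_set ?f S * L2_set ?f S \<le> L2_set ?f S * L2_set y S" by (simp add: power2_eq_square)
  then have "L2_set ?f S \<le> L2_set y S"
    using L2_set_nonneg[of ?f S] L2_set_nonneg[of y S] by (cases "L2_set ?f S = 0") (auto simp: mult_le_cancel_left)
  then have "(L2_set ?f S)\<^sup>2 \<le> (L2_set y S)\<^sup>2" by (intro power_mono) auto
  then show ?thesis by (simp add: L2_set_sq)
qed

text \<open>
  Both equations are tested with \<open>h\<close>. The residual of \<open>a\<close> is the residual of \<open>b\<close> plus the fit of \<open>h\<close>, and the
  residuals of \<open>b\<close> cancel on \<open>S\<close>; those on \<open>R\<close> remain.
\<close>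

lemma normal_eq_difference:
  assumes fin: "finite S" "finite R" "S \<inter> R = {}"
    and a: "normal_eq p x y (S \<union> R) a" and b: "normal_eq p x y S b"
  defines "h \<equiv> \<lambda>j. a j - b j"
  shows "(\<Sum>i\<in>S \<union> R. (ip p h (x i))\<^sup>2) = (\<Sum>i\<in>R. ip p h (x i) * (y i - ip p b (x i)))"
proof -
  have "(\<Sum>i\<in>S \<union> R. (ip p h (x i))\<^sup>2)
      = (\<Sum>i\<in>S \<union> R. ip p h (x i) * (ip p a (x i) - y i)) - (\<Sum>i\<in>S \<union> R. ip p h (x i) * (ip p b (x i) - y i))"
    by (simp add: h_def ip_simps algebra_simps power2_eq_square flip: sum_subtractf)
  also have "\<dots> = - (\<Sum>i\<in>S \<union> R. ip p h (x i) * (ip p b (x i) - y i))"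
    using a by (simp add: normal_eq_def)
  also have "\<dots> = - (\<Sum>i\<in>R. ip p h (x i) * (ip p b (x i) - y i))"
    using b fin by (simp add: normal_eq_def sum.union_disjoint)
  also have "\<dots> = (\<Sum>i\<in>R. ip p h (x i) * (y i - ip p b (x i)))"
    by (simp add: algebra_simps flip: sum_negf)
  finally show ?thesis .
qed

text \<open>
  Cauchy-Schwarz in \<open>normal_eq_difference\<close>. The norm of \<open>b\<close> is controlled by \<open>m |b|\<^sup>2 \<le> |X\<^sub>S b|\<^sup>2 \<le> |y\<^sub>S|\<^sup>2\<close>.
\<close>

lemma ols_removal_bound:
  assumes fin: "finite S" "finite R" "S \<inter> R = {}" and m: "0 < m"
    and low: "\<And>v. m * ip p v v \<le> (\<Sum>i\<in>S. (ip p v (x i))\<^sup>2)"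
    and up: "\<And>v. (\<Sum>i\<in>R. (ip p v (x i))\<^sup>2) \<le> A * ip p v v"
    and yR: "(\<Sum>i\<in>R. (y i)\<^sup>2) \<le> B" and yS: "(\<Sum>i\<in>S. (y i)\<^sup>2) \<le> Y"
    and bR: "(\<Sum>i\<in>R. (ip p b (x i))\<^sup>2) \<le> D * ip p b b" and A: "0 \<le> A" and D: "0 \<le> D"
    and a: "normal_eq p x y (S \<union> R) a" and b: "normal_eq p x y S b"
  shows "m * norm2 p (\<lambda>j. a j - b j) \<le> sqrt A * (sqrt B + sqrt (D * (Y / m)))"
proof -
  define h where "h = (\<lambda>j. a j - b j)"
  have "m * ip p b b \<le> Y"
    using low[of b] normal_eq_fit_le[OF b] yS by linarith
  then have bb: "ip p b b \<le> Y / m" using m by (simp add: le_divide_eq mult.commute)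
  have 1: "L2_set (\<lambda>i. ip p h (x i)) R \<le> sqrt A * norm2 p h"
  proof -
    have "L2_set (\<lambda>i. ip p h (x i)) R \<le> sqrt (A * ip p h h)"
      unfolding L2_set_def by (intro real_sqrt_le_mono up)
    then show ?thesis by (simp add: real_sqrt_mult flip: norm2_sq)
  qed
  have 2: "L2_set y R \<le> sqrt B" unfolding L2_set_def by (intro real_sqrt_le_mono yR)
  have 3: "L2_set (\<lambda>i. ip p b (x i)) R \<le> sqrt (D * (Y / m))"
    unfolding L2_set_def by (intro real_sqrt_le_mono order_trans[OF bR] mult_left_mono bb D)
  have "L2_set (\<lambda>i. y i - ip p b (x i)) R \<le> L2_set y R + L2_set (\<lambda>i. - ip p b (x i)) R"
    using L2_set_triangle_ineq[of y "\<lambda>i. - ip p b (x i)" R] by simp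
  also have "L2_set (\<lambda>i. - ip p b (x i)) R = L2_set (\<lambda>i. ip p b (x i)) R" by (simp add: L2_set_def)
  finally have 4: "L2_set (\<lambda>i. y i - ip p b (x i)) R \<le> sqrt B + sqrt (D * (Y / m))"
    using 2 3 by linarith
  have "m * (norm2 p h)\<^sup>2 \<le> (\<Sum>i\<in>S. (ip p h (x i))\<^sup>2)" unfolding norm2_sq by (rule low)
  also have "\<dots> \<le> (\<Sum>i\<in>S \<union> R. (ip p h (x i))\<^sup>2)" using fin by (intro sum_mono2) auto
  also have "\<dots> = (\<Sum>i\<in>R. ip p h (x i) * (y i - ip p b (x i)))"
    unfolding h_def by (rule normal_eq_difference[OF fin a b])
  also have "\<dots> \<le> L2_set (\<lambda>i. ip p h (x i)) R * L2_set (\<lambda>i. y i - ip p b (x i)) R"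
    using abs_sum_mult_le_L2[of "\<lambda>i. ip p h (x i)" "\<lambda>i. y i - ip p b (x i)" R] by simp
  also have "\<dots> \<le> (sqrt A * norm2 p h) * (sqrt B + sqrt (D * (Y / m)))"
    by (rule mult_mono[OF 1 4]) (use 1 order_trans[OF L2_set_nonneg 1] in auto)
  finally have *: "norm2 p h * (m * norm2 p h) \<le> norm2 p h * (sqrt A * (sqrt B + sqrt (D * (Y / m))))"
    by (simp add: power2_eq_square mult_ac)
  show ?thesis
  proof (cases "norm2 p h = 0")
    case True
    have "0 \<le> sqrt B + sqrt (D * (Y / m))" using order_trans[OF L2_set_nonneg 4] .
    then have "0 \<le> sqrt A * (sqrt B + sqrt (D * (Y / m)))" using A by (intro mult_nonneg_nonneg) auto
    then show ?thesis using True by (simp add: h_def)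
  next
    case False
    then have "0 < norm2 p h" by (simp add: less_le)
    then show ?thesis using * by (simp add: h_def)
  qed
qed

text \<open>
  The bound of \<open>ols_removal_bound\<close> with \<open>m = n / 4\<close>, \<open>Y = 2 n \<sigma>\<^sup>2\<close> and the values of \<open>A\<close>, \<open>B\<close>, \<open>D\<close> that hold with high
  probability, where \<open>K\<close> stands for \<open>k log(en/k)\<close>. The product of the two factors carries \<open>\<omega>\<^sup>2\<close>,
  which is at most \<open>1 + \<omega>\<^sup>3\<close>.
\<close>

lemma removal_rate_arith:
  fixes \<omega> \<sigma> K p n t :: real
  assumes \<omega>: "1 \<le> \<omega>" and \<sigma>: "0 \<le> \<sigma>" and K: "1 \<le> K" and p: "1 \<le> p" and n: "0 < n" and t: "0 < t"
  shows "sqrt (2 * \<omega>\<^sup>2 * (2 * K + 18 * p + K * t\<^sup>2)) *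
       (sqrt (\<sigma>\<^sup>2 * (2 * K + K * t\<^sup>2)) + sqrt (\<omega>\<^sup>2 * (2 * K + K * t\<^sup>2) * (2 * n * \<sigma>\<^sup>2 / (n / 4))))
     \<le> 40 * ((1 + \<omega> ^ 3) * \<sigma> * (K + sqrt (K * p)) * (1 + t)\<^sup>2)"
proof -
  define U where "U = sqrt (2 * K + K * t\<^sup>2)"
  have U0: "0 \<le> U" using K by (simp add: U_def)
  have t2: "0 \<le> t\<^sup>2" by simp
  have U: "U \<le> sqrt 2 * (sqrt K * (1 + t))"
  proof -
    have "2 * K + K * t\<^sup>2 \<le> 2 * (K * (1 + t)\<^sup>2)"
      using K t by (simp add: power2_eq_square algebra_simps)
    then have "U \<le> sqrt (2 * (K * (1 + t)\<^sup>2))" unfolding U_def by (rule real_sqrt_le_mono)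
    then show ?thesis using t by (simp add: real_sqrt_mult)
  qed
  have V: "sqrt (2 * K + 18 * p + K * t\<^sup>2) \<le> 5 * ((sqrt K + sqrt p) * (1 + t))"
  proof -
    have "sqrt (2 * K + 18 * p + K * t\<^sup>2) \<le> U + sqrt (18 * p)"
      using sqrt_add_le_add_sqrt[of "2 * K + K * t\<^sup>2" "18 * p"] K p by (simp add: U_def algebra_simps)
    also have "\<dots> \<le> sqrt 2 * (sqrt K * (1 + t)) + sqrt 18 * sqrt p"
      using U by (simp add: real_sqrt_mult)
    also have "\<dots> \<le> 5 * (sqrt K * (1 + t)) + 5 * (sqrt p * (1 + t))"
    proof (intro add_mono mult_mono)
      show "sqrt 2 \<le> 5" "sqrt 18 \<le> 5" by (auto intro: real_le_lsqrt)
      show "sqrt p \<le> sqrt p * (1 + t)" using p t by simp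
    qed (use K p t in auto)
    finally show ?thesis by (simp add: algebra_simps)
  qed
  have e1: "sqrt (2 * \<omega>\<^sup>2 * (2 * K + 18 * p + K * t\<^sup>2)) = sqrt 2 * \<omega> * sqrt (2 * K + 18 * p + K * t\<^sup>2)"
    using \<omega> by (simp add: real_sqrt_mult)
  have e2: "sqrt (\<sigma>\<^sup>2 * (2 * K + K * t\<^sup>2)) = \<sigma> * U"
    using \<sigma> by (simp add: real_sqrt_mult U_def)
  have e3: "sqrt (\<omega>\<^sup>2 * (2 * K + K * t\<^sup>2) * (2 * n * \<sigma>\<^sup>2 / (n / 4))) = \<omega> * U * (sqrt 8 * \<sigma>)"
  proof -
    have "2 * n * \<sigma>\<^sup>2 / (n / 4) = 8 * \<sigma>\<^sup>2" using n by simp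
    then show ?thesis using \<omega> \<sigma> by (simp add: real_sqrt_mult U_def)
  qed
  have s8: "sqrt 8 \<le> 3" by (rule real_le_lsqrt) auto
  have "\<sigma> * U + \<omega> * U * (sqrt 8 * \<sigma>) \<le> 4 * \<omega> * (\<sigma> * U)"
  proof -
    have "1 * (\<sigma> * U) \<le> \<omega> * (\<sigma> * U)" using \<omega> \<sigma> U0 by (intro mult_right_mono) auto
    moreover have "sqrt 8 * (\<omega> * U * \<sigma>) \<le> 3 * (\<omega> * U * \<sigma>)"
      using s8 \<omega> \<sigma> U0 by (intro mult_right_mono) auto
    ultimately show ?thesis by (simp add: mult_ac)
  qed
  also have "\<dots> \<le> 4 * \<omega> * (\<sigma> * (sqrt 2 * (sqrt K * (1 + t))))"
    using U \<omega> \<sigma> by (intro mult_left_mono) auto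
  finally have r: "\<sigma> * U + \<omega> * U * (sqrt 8 * \<sigma>) \<le> 4 * \<omega> * (\<sigma> * (sqrt 2 * (sqrt K * (1 + t))))" .
  have "sqrt 2 * \<omega> * sqrt (2 * K + 18 * p + K * t\<^sup>2) * (\<sigma> * U + \<omega> * U * (sqrt 8 * \<sigma>))
     \<le> (sqrt 2 * \<omega> * (5 * ((sqrt K + sqrt p) * (1 + t)))) * (4 * \<omega> * (\<sigma> * (sqrt 2 * (sqrt K * (1 + t)))))"
    using \<omega> \<sigma> U0 V K p t by (intro mult_mono r mult_left_mono V) auto
  also have "\<dots> = (sqrt 2 * sqrt 2) * 20 * \<omega>\<^sup>2 * (\<sigma> * ((sqrt K * sqrt K + sqrt K * sqrt p) * (1 + t)\<^sup>2))"
  proof -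
    have "a * \<omega> * (5 * ((b + c) * (1 + t))) * (4 * \<omega> * (\<sigma> * (a * (b * (1 + t)))))
        = (a * a) * 20 * \<omega>\<^sup>2 * (\<sigma> * ((b * b + b * c) * (1 + t)\<^sup>2))" for a b c :: real
      by (simp add: power2_eq_square algebra_simps)
    then show ?thesis .
  qed
  also have "\<dots> = 40 * (\<omega>\<^sup>2 * (\<sigma> * ((K + sqrt (K * p)) * (1 + t)\<^sup>2)))"
  proof -
    have s: "sqrt 2 * sqrt 2 = 2" "sqrt K * sqrt K = K" using K by simp_all
    show ?thesis unfolding s real_sqrt_mult by (simp only: mult_ac)
  qed
  also have "\<dots> \<le> 40 * ((1 + \<omega> ^ 3) * (\<sigma> * ((K + sqrt (K * p)) * (1 + t)\<^sup>2)))"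
  proof (intro mult_left_mono mult_right_mono)
    have "\<omega>\<^sup>2 * 1 \<le> \<omega>\<^sup>2 * \<omega>" using \<omega> by (intro mult_left_mono) auto
    then show "\<omega>\<^sup>2 \<le> 1 + \<omega> ^ 3" by (simp add: power2_eq_square power3_eq_cube)
  qed (use \<sigma> K p in auto)
  finally show ?thesis unfolding e1 e2 e3 by (simp add: mult.assoc)
qed

definition gram :: "(nat \<Rightarrow> nat \<Rightarrow> real) \<Rightarrow> nat set \<Rightarrow> nat \<Rightarrow> nat \<Rightarrow> real" where
  "gram x S i j = (\<Sum>s\<in>S. x s i * x s j)"

definition gram_mat :: "nat \<Rightarrow> (nat \<Rightarrow> nat \<Rightarrow> real) \<Rightarrow> nat set \<Rightarrow> real mat" where
  "gram_mat p x S = Matrix.mat p p (\<lambda>(i, j). gram x S i j)"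

text \<open>
  Cramer's rule without the division: \<open>adj(G) X\<^sup>T y = det(G) b\<close> for the least-squares solution \<open>b\<close>. It is polynomial
  in the data, hence measurable, and for invertible \<open>G\<close> it is a nonzero multiple of \<open>b\<close>. The bounds for \<open>Z\<^sub>R b\<close> are homogeneous in
  \<open>b\<close>, so it can be used in place of \<open>b\<close>.
\<close>

definition cramer :: "nat \<Rightarrow> (nat \<Rightarrow> nat \<Rightarrow> real) \<Rightarrow> (nat \<Rightarrow> real) \<Rightarrow> nat set \<Rightarrow> nat \<Rightarrow> real" where
  "cramer p x y S i = (\<Sum>j<p. adj_mat (gram_mat p x S) $$ (i, j) * (\<Sum>s\<in>S. x s j * y s))"

lemma sum_ip_sq: "(\<Sum>s\<in>S. (ip p v (x s))\<^sup>2) = qform p (gram x S) v"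
proof -
  have "(\<Sum>s\<in>S. (ip p v (x s))\<^sup>2) = (\<Sum>s\<in>S. \<Sum>i<p. \<Sum>j<p. v i * (x s i * x s j) * v j)"
    by (simp add: ip_def power2_eq_square sum_product mult_ac)
  also have "\<dots> = (\<Sum>i<p. \<Sum>j<p. \<Sum>s\<in>S. v i * (x s i * x s j) * v j)"
    by (subst sum.swap, rule sum.cong[OF refl], rule sum.swap)
  also have "\<dots> = qform p (gram x S) v"
    by (simp add: qform_def gram_def sum_distrib_left sum_distrib_right)
  finally show ?thesis .
qed

lemma gram_normal_eq:
  assumes b: "normal_eq p x y S b" and j: "j < p"
  shows "(\<Sum>k<p. gram x S j k * b k) = (\<Sum>s\<in>S. x s j * y s)"
proof -
  define e where "e = (\<lambda>i. if i = j then 1 else 0 :: real)"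
  have e: "ip p e u = u j" for u
    using j by (simp add: e_def ip_def if_distrib[of "\<lambda>x. x * _"] cong: if_cong)
  have "(\<Sum>s\<in>S. ip p e (x s) * (ip p b (x s) - y s)) = 0" using b by (simp add: normal_eq_def)
  then have "(\<Sum>s\<in>S. x s j * ip p b (x s)) = (\<Sum>s\<in>S. x s j * y s)"
    by (simp add: e algebra_simps sum_subtractf)
  moreover have "(\<Sum>s\<in>S. x s j * ip p b (x s)) = (\<Sum>s\<in>S. \<Sum>k<p. x s j * x s k * b k)"
    by (simp add: ip_def sum_distrib_left mult_ac)
  moreover have "\<dots> = (\<Sum>k<p. gram x S j k * b k)"
    by (subst sum.swap) (simp add: gram_def sum_distrib_right)
  ultimately show ?thesis by simp
qed

lemma cramer_eq:
  assumes b: "normal_eq p x y S b" and i: "i < p"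
  shows "cramer p x y S i = det (gram_mat p x S) * b i"
proof -
  let ?G = "gram_mat p x S"
  have G: "?G \<in> carrier_mat p p" by (simp add: gram_mat_def)
  note adj = adj_mat[OF G]
  have ent: "(\<Sum>j<p. adj_mat ?G $$ (i, j) * gram x S j k) = (if i = k then det ?G else 0)" if k: "k < p" for k
  proof -
    have "(adj_mat ?G * ?G) $$ (i, k) = (\<Sum>j<p. adj_mat ?G $$ (i, j) * gram x S j k)"
      using adj(1) G i k by (simp add: scalar_prod_def gram_mat_def lessThan_atLeast0)
    moreover have "(adj_mat ?G * ?G) $$ (i, k) = (if i = k then det ?G else 0)"
      unfolding adj(3) using i k by simp
    ultimately show ?thesis by simp
  qed
  have "cramer p x y S i = (\<Sum>j<p. adj_mat ?G $$ (i, j) * (\<Sum>k<p. gram x S j k * b k))"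
    unfolding cramer_def using gram_normal_eq[OF b] by (intro sum.cong refl) auto
  also have "\<dots> = (\<Sum>j<p. \<Sum>k<p. adj_mat ?G $$ (i, j) * gram x S j k * b k)"
    by (simp add: sum_distrib_left mult.assoc)
  also have "\<dots> = (\<Sum>k<p. (\<Sum>j<p. adj_mat ?G $$ (i, j) * gram x S j k) * b k)"
    by (subst sum.swap) (simp add: sum_distrib_right)
  also have "\<dots> = (\<Sum>k<p. (if i = k then det ?G else 0) * b k)" by (intro sum.cong refl) (simp add: ent)
  also have "\<dots> = det ?G * b i" using i by (simp add: if_distrib[of "\<lambda>x. x * _"] cong: if_cong)
  finally show ?thesis .
qed

lemma det_gram_nonzero:
  assumes m: "0 < m" and low: "\<And>v. m * ip p v v \<le> (\<Sum>i\<in>S. (ip p v (x i))\<^sup>2)"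
  shows "det (gram_mat p x S) \<noteq> 0"
proof
  let ?G = "gram_mat p x S"
  assume "det ?G = 0"
  have G: "?G \<in> carrier_mat p p" by (simp add: gram_mat_def)
  obtain v where v: "v \<in> carrier_vec p" "v \<noteq> 0\<^sub>v p" "?G *\<^sub>v v = 0\<^sub>v p"
    using \<open>det ?G = 0\<close> unfolding det_0_iff_vec_prod_zero[OF G] by blast
  define u where "u = (\<lambda>j. vec_index v j)"
  have "(\<Sum>j<p. gram x S i j * u j) = 0" if "i < p" for i
  proof -
    have "vec_index (?G *\<^sub>v v) i = (\<Sum>j<p. gram x S i j * u j)"
      using v(1) that by (auto simp: gram_mat_def scalar_prod_def u_def lessThan_atLeast0)
    then show ?thesis using v(3) that by simp
  qed
  moreover have "qform p (gram x S) u = (\<Sum>i<p. u i * (\<Sum>j<p. gram x S i j * u j))"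
    by (simp add: qform_def sum_distrib_left mult.assoc)
  ultimately have "qform p (gram x S) u = 0" by simp
  then have "m * ip p u u \<le> 0" using low[of u] sum_ip_sq[where x=x and S=S] by simp
  then have "norm2 p u = 0" using m by (simp add: mult_le_0_iff flip: norm2_sq)
  then have "v = 0\<^sub>v p" using v(1) by (intro eq_vecI) (auto simp: norm2_eq_0 u_def)
  then show False using v(2) by simp
qed

lemma borel_measurable_det [measurable (raw)]:
  fixes G :: "'a \<Rightarrow> nat \<Rightarrow> nat \<Rightarrow> real"
  assumes "\<And>i j. i < p \<Longrightarrow> j < p \<Longrightarrow> (\<lambda>d. G d i j) \<in> borel_measurable M"
  shows "(\<lambda>d. det (Matrix.mat p p (\<lambda>(i, j). G d i j))) \<in> borel_measurable M"
proof -
  have perm: "q i < p" if "q permutes {0..<p}" "i < p" for q i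
    using permutes_in_image[OF that(1), of i] that(2) by simp
  have "det (Matrix.mat p p (\<lambda>(i, j). G d i j))
     = (\<Sum>q\<in>{q. q permutes {0..<p}}. signof q * (\<Prod>i=0..<p. G d i (q i)))" for d
  proof (subst det_def'[of _ p])
    show "(\<Sum>q\<in>{q. q permutes {0..<p}}. signof q * (\<Prod>i=0..<p. Matrix.mat p p (\<lambda>(i, j). G d i j) $$ (i, q i)))
      = (\<Sum>q\<in>{q. q permutes {0..<p}}. signof q * (\<Prod>i=0..<p. G d i (q i)))"
      by (intro sum.cong prod.cong refl arg_cong2[where f="(*)"]) (auto simp: perm)
  qed simp
  moreover have "(\<lambda>d. \<Sum>q\<in>{q. q permutes {0..<p}}. signof q * (\<Prod>i=0..<p. G d i (q i))) \<in> borel_measurable M"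
    by (intro borel_measurable_sum borel_measurable_times borel_measurable_prod assms borel_measurable_const)
      (auto simp: perm)
  ultimately show ?thesis by simp
qed

lemma borel_measurable_cramer:
  fixes x :: "'a \<Rightarrow> nat \<Rightarrow> nat \<Rightarrow> real"
  assumes x: "\<And>s j. s \<in> S \<Longrightarrow> j < p \<Longrightarrow> (\<lambda>d. x d s j) \<in> borel_measurable M"
    and y: "\<And>s. s \<in> S \<Longrightarrow> (\<lambda>d. y d s) \<in> borel_measurable M" and i: "i < p"
  shows "(\<lambda>d. cramer p (x d) (y d) S i) \<in> borel_measurable M"
proof -
  have g: "(\<lambda>d. gram (x d) S i j) \<in> borel_measurable M" if "i < p" "j < p" for i j
    unfolding gram_def by (intro borel_measurable_sum borel_measurable_times x that)
  have "(\<lambda>d. adj_mat (gram_mat p (x d) S) $$ (i, j)) \<in> borel_measurable M" if j: "j < p" for j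
  proof -
    have "adj_mat (gram_mat p (x d) S) $$ (i, j) = (- 1) ^ (j + i) *
        det (Matrix.mat (p - 1) (p - 1) (\<lambda>(i', j'). gram (x d) S (if i' < j then i' else Suc i') (if j' < i then j' else Suc j')))" for d
      using i j by (simp add: adj_mat_def gram_mat_def cofactor_def mat_delete_def)
        (auto intro!: arg_cong[where f=det] eq_matI)
    moreover have "(\<lambda>d. (- 1) ^ (j + i) *
        det (Matrix.mat (p - 1) (p - 1) (\<lambda>(i', j'). gram (x d) S (if i' < j then i' else Suc i') (if j' < i then j' else Suc j')))) \<in> borel_measurable M"
      by (intro borel_measurable_times borel_measurable_const borel_measurable_det g) auto
    ultimately show ?thesis by simp
  qed
  then show ?thesis unfolding cramer_def
    by (intro borel_measurable_sum borel_measurable_times x y) auto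
qed

section \<open>Uniform events for isotropic sub-Gaussian designs\<close>

text \<open>
  An outer-probability statement: the exceptional set itself may fail to be measurable, for instance
  when it involves a quantifier over all vectors.
\<close>

definition rare :: "'a measure \<Rightarrow> real \<Rightarrow> ('a \<Rightarrow> bool) \<Rightarrow> bool" where
  "rare M q F \<longleftrightarrow> (\<exists>E\<in>sets M. (\<forall>d\<in>space M. F d \<longrightarrow> d \<in> E) \<and> measure M E \<le> q)"

lemma rare_mono:
  "rare M q F \<Longrightarrow> (\<And>d. d \<in> space M \<Longrightarrow> G d \<Longrightarrow> F d) \<Longrightarrow> q \<le> q' \<Longrightarrow> rare M q' G"
  unfolding rare_def by (meson order_trans)

context prob_space begin

lemma rare_disj:
  assumes "rare M a F" "rare M b G"
  shows "rare M (a + b) (\<lambda>d. F d \<or> G d)"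
proof -
  obtain E E' where "E \<in> sets M" "\<forall>d\<in>space M. F d \<longrightarrow> d \<in> E" "measure M E \<le> a"
    "E' \<in> sets M" "\<forall>d\<in>space M. G d \<longrightarrow> d \<in> E'" "measure M E' \<le> b"
    using assms unfolding rare_def by blast
  then show ?thesis unfolding rare_def
    by (intro bexI[of _ "E \<union> E'"]) (auto intro: order_trans[OF measure_Un_le])
qed

lemma rare_Bex:
  assumes "finite J" "\<And>j. j \<in> J \<Longrightarrow> rare M q (F j)" "real (card J) \<le> N" "0 \<le> q"
  shows "rare M (N * q) (\<lambda>d. \<exists>j\<in>J. F j d)"
proof -
  have "\<forall>j\<in>J. \<exists>E. E \<in> sets M \<and> (\<forall>d\<in>space M. F j d \<longrightarrow> d \<in> E) \<and> measure M E \<le> q"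
    using assms(2) unfolding rare_def by blast
  then obtain E where E: "\<And>j. j \<in> J \<Longrightarrow> E j \<in> sets M \<and> (\<forall>d\<in>space M. F j d \<longrightarrow> d \<in> E j) \<and> measure M (E j) \<le> q"
    by metis
  have "measure M (\<Union>j\<in>J. E j) \<le> (\<Sum>j\<in>J. measure M (E j))"
    using assms(1) E by (intro finite_measure_subadditive_finite) auto
  also have "\<dots> \<le> real (card J) * q" using E sum_bounded_above[of J "\<lambda>j. measure M (E j)" q] by simp
  also have "\<dots> \<le> N * q" using assms by (intro mult_right_mono) auto
  finally show ?thesis unfolding rare_def
    using E assms(1) by (intro bexI[of _ "\<Union>j\<in>J. E j"]) auto
qed

lemma holds_of_rare:
  assumes "rare M q F" "\<And>d. d \<in> space M \<Longrightarrow> \<not> F d \<Longrightarrow> G d" "q' \<le> 1 - q"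
  shows "holds_with_prob_at_least M q' G"
proof -
  obtain E where E: "E \<in> sets M" "\<forall>d\<in>space M. F d \<longrightarrow> d \<in> E" "measure M E \<le> q"
    using assms(1) unfolding rare_def by blast
  then have "measure M (space M - E) = 1 - measure M E" by (simp add: prob_compl)
  then show ?thesis unfolding holds_with_prob_at_least_def
    using E assms(2,3) by (intro bexI[of _ "space M - E"]) auto
qed

end

text \<open>
  The model in whitened coordinates; \<open>\<omega>\<close> and \<open>\<sigma>\<close> bound the \<open>\<psi>\<^sub>2\<close> norms of the design vector and the response.
\<close>

locale isotropic_model =
  fixes P :: "'a measure" and p :: nat and z :: "'a \<Rightarrow> nat \<Rightarrow> real" and y :: "'a \<Rightarrow> real"
    and \<omega> \<sigma> :: real
  assumes prob_P: "prob_space P" and p: "1 \<le> p"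
    and z_subgaussian: "\<And>v. subgaussian P (\<lambda>s. ip p v (z s)) (\<omega> * norm2 p v)"
    and z_iso: "\<And>v. (\<integral>s. (ip p v (z s))\<^sup>2 \<partial>P) = ip p v v"
    and y_subgaussian: "subgaussian P y \<sigma>"
begin

abbreviation data :: "nat set \<Rightarrow> (nat \<Rightarrow> 'a) measure" where
  "data I \<equiv> PiM I (\<lambda>_. P)"

abbreviation energy :: "(nat \<Rightarrow> 'a) \<Rightarrow> nat set \<Rightarrow> (nat \<Rightarrow> real) \<Rightarrow> real" where
  "energy d R v \<equiv> (\<Sum>i\<in>R. (ip p v (z (d i)))\<^sup>2)"

lemma prob_data: "prob_space (data I)"
  by (intro prob_space_PiM prob_P)

lemma sigma_nonneg: "0 \<le> \<sigma>"
  using y_subgaussian by (simp add: subgaussian_def)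

lemma measurable_y: "y \<in> borel_measurable P"
  using y_subgaussian by (simp add: subgaussian_def)

lemma measurable_ip: "(\<lambda>s. ip p v (z s)) \<in> borel_measurable P"
  using z_subgaussian by (simp add: subgaussian_def)

lemma measurable_coordinate: "j < p \<Longrightarrow> (\<lambda>s. z s j) \<in> borel_measurable P"
  using measurable_ip[of "\<lambda>i. if i = j then 1 else 0"]
  by (simp add: ip_def if_distrib[of "\<lambda>x. x * _"] cong: if_cong)

lemma omega_ge_1: "1 \<le> \<omega>"
proof -
  define e where "e = (\<lambda>i::nat. if i = 0 then 1 else 0 :: real)"
  have e: "ip p e e = 1" using p by (simp add: ip_def e_def if_distrib[of "\<lambda>x. x * _"] cong: if_cong)
  then have n: "norm2 p e = 1" using norm2_sq[of e p] L2_set_nonneg[of e "{..<p}"] by (simp add: power2_eq_1_iff)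
  have e_subgaussian: "subgaussian P (\<lambda>s. ip p e (z s)) \<omega>" using z_subgaussian[of e] n by simp
  then have "1 \<le> \<omega>\<^sup>2" using subgaussian_second_moment[OF e_subgaussian] z_iso[of e] e by simp
  moreover have "0 \<le> \<omega>" using e_subgaussian by (simp add: subgaussian_def)
  ultimately show ?thesis using power2_le_imp_le[of 1 \<omega>] by simp
qed

lemma subgaussian_ip_unit: "norm2 p v \<le> 1 \<Longrightarrow> subgaussian P (\<lambda>s. ip p v (z s)) \<omega>"
  by (rule subgaussian_mono[OF z_subgaussian]) (use omega_ge_1 mult_left_le[of "norm2 p v" \<omega>] in \<open>simp add: mult.commute\<close>)

lemma subgaussian_block_rare:
  assumes "subgaussian P f s" "R \<subseteq> {..<n}" "real (card R) \<le> m"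
  shows "rare (data {..<n}) (exp (m - u)) (\<lambda>d. s\<^sup>2 * u < (\<Sum>i\<in>R. (f (d i))\<^sup>2))"
proof -
  have [measurable]: "f \<in> borel_measurable P" using assms(1) by (simp add: subgaussian_def)
  have meas: "(\<lambda>d. f (d i)) \<in> borel_measurable (data {..<n})" if "i \<in> R" for i
  proof -
    have "i \<in> {..<n}" using that assms(2) by auto
    then show ?thesis by measurable
  qed
  note tail = conditional_block_tail[OF prob_P finite_lessThan assms(2), of "\<lambda>_. f" "\<lambda>_. s" u]
  show ?thesis unfolding rare_def
    by (rule bexI[of _ "{d \<in> space (data {..<n}). s\<^sup>2 * u < (\<Sum>i\<in>R. (f (d i))\<^sup>2)}"])
      (use tail assms meas in \<open>auto intro: order_trans[of _ "exp (real (card R) - u)"]\<close>)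
qed

lemma small_blocks_rare:
  assumes k: "1 \<le> k" "k \<le> n" and q: "0 \<le> q"
    and F: "\<And>R. R \<subseteq> {..<n} \<Longrightarrow> card R \<le> k \<Longrightarrow> rare (data {..<n}) q (F R)"
  shows "rare (data {..<n}) (exp (real k * ln (exp 1 * real n / real k)) * q)
    (\<lambda>d. \<exists>R. R \<subseteq> {..<n} \<and> card R \<le> k \<and> F R d)"
proof -
  interpret D: prob_space "data {..<n}" by (rule prob_data)
  have "rare (data {..<n}) (exp (real k * ln (exp 1 * real n / real k)) * q)
    (\<lambda>d. \<exists>R\<in>{R. R \<subseteq> {..<n} \<and> card R \<le> k}. F R d)"
    by (rule D.rare_Bex) (use F q card_small_subsets[OF k] in \<open>auto intro: finite_subset[of _ "Pow {..<n}"]\<close>)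
  then show ?thesis by (rule rare_mono) auto
qed

text \<open>
  On the net the form \<open>|Z\<^sub>R v|\<^sup>2\<close> has the tail of a sum of at most \<open>k\<close> squares; the net bound costs the factor \<open>2\<close>
  and the terms \<open>18 p\<close> and \<open>K\<close> in the exponent pay for the two union bounds.
\<close>

lemma design_block_rare:
  assumes k: "1 \<le> k" "k \<le> n"
  defines "K \<equiv> real k * ln (exp 1 * real n / real k)"
  shows "rare (data {..<n}) (exp (real k - u + 18 * real p + K))
    (\<lambda>d. \<exists>R. R \<subseteq> {..<n} \<and> card R \<le> k \<and> (\<exists>v. 2 * \<omega>\<^sup>2 * u * ip p v v < energy d R v))"
proof -
  interpret D: prob_space "data {..<n}" by (rule prob_data)
  obtain N where N: "finite N" "N \<noteq> {}" "real (card N) \<le> exp (18 * real p)" "\<And>v. v \<in> N \<Longrightarrow> norm2 p v \<le> 1"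
    "\<And>v. norm2 p v \<le> 1 \<Longrightarrow> \<exists>u\<in>N. norm2 p (\<lambda>j. v j - u j) \<le> 1 / 4"
    using grid_net[OF p] by blast
  have "rare (data {..<n}) (exp K * (exp (18 * real p) * exp (real k - u)))
      (\<lambda>d. \<exists>R. R \<subseteq> {..<n} \<and> card R \<le> k \<and> (\<exists>v\<in>N. \<omega>\<^sup>2 * u < energy d R v))"
    unfolding K_def
    by (intro small_blocks_rare k D.rare_Bex N subgaussian_block_rare subgaussian_ip_unit) auto
  then show ?thesis
  proof (rule rare_mono)
    show "exp K * (exp (18 * real p) * exp (real k - u)) \<le> exp (real k - u + 18 * real p + K)"
      by (simp flip: exp_add add: algebra_simps)
    fix d assume "\<exists>R. R \<subseteq> {..<n} \<and> card R \<le> k \<and> (\<exists>v. 2 * \<omega>\<^sup>2 * u * ip p v v < energy d R v)"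
    then obtain R v where R: "R \<subseteq> {..<n}" "card R \<le> k" "2 * \<omega>\<^sup>2 * u * ip p v v < energy d R v" by blast
    have "\<exists>v\<in>N. \<omega>\<^sup>2 * u < energy d R v"
    proof (rule ccontr)
      assume "\<not> ?thesis"
      then have b: "\<bar>qform p (gram (\<lambda>i. z (d i)) R) v\<bar> \<le> \<omega>\<^sup>2 * u" if "v \<in> N" for v
        using that sum_nonneg[of R "\<lambda>i. (ip p v (z (d i)))\<^sup>2"] by (auto simp: not_less simp flip: sum_ip_sq)
      have "\<bar>qform p (gram (\<lambda>i. z (d i)) R) v\<bar> \<le> 2 * (\<omega>\<^sup>2 * u) * ip p v v"
        by (rule qform_le_twice_net[where N=N, OF _ N(5) N(4) b]) (auto simp: gram_def mult.commute)
      then show False using R(3) by (simp flip: sum_ip_sq)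
    qed
    then show "\<exists>R. R \<subseteq> {..<n} \<and> card R \<le> k \<and> (\<exists>v\<in>N. \<omega>\<^sup>2 * u < energy d R v)" using R by blast
  qed
qed

lemma response_block_rare:
  assumes k: "1 \<le> k" "k \<le> n"
  defines "K \<equiv> real k * ln (exp 1 * real n / real k)"
  shows "rare (data {..<n}) (exp (real k - u + K))
    (\<lambda>d. \<exists>R. R \<subseteq> {..<n} \<and> card R \<le> k \<and> \<sigma>\<^sup>2 * u < (\<Sum>i\<in>R. (y (d i))\<^sup>2))"
proof -
  have "rare (data {..<n}) (exp K * exp (real k - u))
      (\<lambda>d. \<exists>R. R \<subseteq> {..<n} \<and> card R \<le> k \<and> \<sigma>\<^sup>2 * u < (\<Sum>i\<in>R. (y (d i))\<^sup>2))"
    unfolding K_def by (intro small_blocks_rare k subgaussian_block_rare y_subgaussian) auto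
  then show ?thesis by (rule rare_mono) (auto simp flip: exp_add simp: algebra_simps)
qed

text \<open>
  The least-squares estimator on the rows in \<open>S\<close>, multiplied by the determinant of its Gram matrix.
\<close>

abbreviation cramer_fit :: "(nat \<Rightarrow> 'a) \<Rightarrow> nat set \<Rightarrow> nat \<Rightarrow> real" where
  "cramer_fit d S \<equiv> cramer p (\<lambda>i. z (d i)) (\<lambda>i. y (d i)) S"

text \<open>
  For a fixed \<open>R\<close> the estimator depends on the samples outside \<open>R\<close> only, so \<open>conditional_block_tail\<close> applies with the
  random scale \<open>\<omega> |\<theta>|\<close>. There is no net over directions, hence no term \<open>p\<close> in the exponent.
\<close>

lemma left_out_fit_rare:
  assumes k: "1 \<le> k" "k \<le> n"
  defines "K \<equiv> real k * ln (exp 1 * real n / real k)"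
  shows "rare (data {..<n}) (exp (real k - u + K))
    (\<lambda>d. \<exists>R. R \<subseteq> {..<n} \<and> card R \<le> k \<and>
      \<omega>\<^sup>2 * u * ip p (cramer_fit d ({..<n} - R)) (cramer_fit d ({..<n} - R)) < energy d R (cramer_fit d ({..<n} - R)))"
proof -
  have "rare (data {..<n}) (exp (real k - u)) (\<lambda>d.
      \<omega>\<^sup>2 * u * ip p (cramer_fit d ({..<n} - R)) (cramer_fit d ({..<n} - R)) < energy d R (cramer_fit d ({..<n} - R)))"
    if R: "R \<subseteq> {..<n}" "card R \<le> k" for R
  proof -
    let ?th = "\<lambda>d. cramer_fit d ({..<n} - R)"
    let ?s = "\<lambda>d. \<omega> * norm2 p (?th d)"
    note measurable_coordinate[measurable] measurable_y[measurable]
    have zm: "(\<lambda>d. z (d i) j) \<in> borel_measurable (data {..<n})" if "i \<in> {..<n}" "j < p" for i j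
      using that by measurable
    have thetam: "(\<lambda>d. ?th d i) \<in> borel_measurable (data {..<n})" if "i < p" for i
      by (rule borel_measurable_cramer) (use that zm in \<open>auto\<close>)
    have m1: "(\<lambda>d. ip p (?th d) (z (d i))) \<in> borel_measurable (data {..<n})" if "i \<in> R" for i
      unfolding ip_def using that R(1)
      by (intro borel_measurable_sum borel_measurable_times thetam zm) auto
    have [measurable]: "(\<lambda>d. \<Sum>i<p. (?th d i)\<^sup>2) \<in> borel_measurable (data {..<n})"
      by (intro borel_measurable_sum borel_measurable_power thetam) auto
    have m2: "?s \<in> borel_measurable (data {..<n})" unfolding L2_set_def by measurable
    have loc: "(\<lambda>s. ip p (?th d) (z s)) = (\<lambda>s. ip p (?th d') (z s)) \<and> ?s d = ?s d'"
      if "\<And>i. i \<in> {..<n} - R \<Longrightarrow> d i = d' i" for d d'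
    proof -
      have "gram (\<lambda>i. z (d i)) ({..<n} - R) = gram (\<lambda>i. z (d' i)) ({..<n} - R)"
        unfolding gram_def using that by (intro ext sum.cong) auto
      moreover have "(\<Sum>s\<in>{..<n} - R. z (d s) j * y (d s)) = (\<Sum>s\<in>{..<n} - R. z (d' s) j * y (d' s))" for j
        using that by (intro sum.cong) auto
      ultimately have "?th d = ?th d'" unfolding cramer_def[abs_def] gram_mat_def by simp
      then show ?thesis by simp
    qed
    note tail = conditional_block_tail[OF prob_P finite_lessThan R(1), where f="\<lambda>d s. ip p (?th d) (z s)" and s="?s" and u=u,
      OF loc m1 m2 z_subgaussian]
    have sq: "(?s d)\<^sup>2 * u = \<omega>\<^sup>2 * u * ip p (?th d) (?th d)" for d
      by (simp add: power_mult_distrib norm2_sq)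
    have "exp (real (card R) - u) \<le> exp (real k - u)" using R(2) by simp
    then show ?thesis unfolding rare_def
      by (intro bexI[OF _ tail(1)[unfolded sq]] conjI order_trans[OF tail(2)[unfolded sq]]) auto
  qed
  then have "rare (data {..<n}) (exp K * exp (real k - u))
    (\<lambda>d. \<exists>R. R \<subseteq> {..<n} \<and> card R \<le> k \<and>
      \<omega>\<^sup>2 * u * ip p (cramer_fit d ({..<n} - R)) (cramer_fit d ({..<n} - R)) < energy d R (cramer_fit d ({..<n} - R)))"
    unfolding K_def by (intro small_blocks_rare k) auto
  then show ?thesis by (rule rare_mono) (auto simp flip: exp_add simp: algebra_simps)
qed

text \<open>
  The deviation \<open>|Z v|\<^sup>2 - n |v|\<^sup>2\<close> is a quadratic form in \<open>v\<close>. If it is below \<open>n / 8\<close> on the net, it is at most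
  \<open>n / 4 |v|\<^sup>2\<close> everywhere. Both tails are needed on the net, since a net controls the absolute value of a form only.
\<close>

lemma covariance_rare:
  shows "rare (data {..<n}) (2 * exp (18 * real p - real n / (2816 * \<omega> ^ 4)))
    (\<lambda>d. \<exists>v. energy d {..<n} v < 3/4 * real n * ip p v v)"
proof -
  interpret D: prob_space "data {..<n}" by (rule prob_data)
  obtain N where N: "finite N" "N \<noteq> {}" "real (card N) \<le> exp (18 * real p)" "\<And>v. v \<in> N \<Longrightarrow> norm2 p v \<le> 1"
    "\<And>v. norm2 p v \<le> 1 \<Longrightarrow> \<exists>u\<in>N. norm2 p (\<lambda>j. v j - u j) \<le> 1 / 4"
    using grid_net[OF p] by blast
  \<comment> \<open>The minimizer of \<open>11 l\<^sup>2 \<omega>\<^sup>4 - l / 8\<close>, the exponent per sample.\<close>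
  define l where "l = 1 / (176 * \<omega> ^ 4)"
  have \<omega>: "1 \<le> \<omega>" by (rule omega_ge_1)
  have l0: "0 < l" using \<omega> by (simp add: l_def)
  have one: "rare (data {..<n}) (exp (- real n / (2816 * \<omega> ^ 4)))
      (\<lambda>d. real n / 8 \<le> c * (energy d {..<n} v - real n * ip p v v))"
    if v: "norm2 p v \<le> 1" and c: "c = 1 \<or> c = -1" for v and c :: real
  proof -
    let ?g = "\<lambda>s. (c * l) * ((ip p v (z s))\<^sup>2 - (\<integral>s. (ip p v (z s))\<^sup>2 \<partial>P))"
    let ?E = "{d \<in> space (data {..<n}). l * real n / 8 \<le> (\<Sum>i\<in>{..<n}. ?g (d i))}"
    note measurable_ip[measurable]
    have l2: "2 * \<bar>c * l\<bar> * \<omega>\<^sup>2 \<le> 1"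
    proof -
      have "\<omega>\<^sup>2 \<le> \<omega> ^ 4" using \<omega> by (intro power_increasing) auto
      then have "2 * \<omega>\<^sup>2 \<le> 176 * \<omega> ^ 4" using zero_le_power2[of \<omega>] by linarith
      then show ?thesis using \<omega> c l0 by (auto simp: l_def divide_le_eq)
    qed
    have "emeasure (data {..<n}) ?E \<le> ennreal (exp (11 * (c * l)\<^sup>2 * \<omega> ^ 4) ^ card {..<n} * exp (- (l * real n / 8)))"
      by (intro prod_exp_tail prob_P subgaussian_square_mgf[OF prob_P subgaussian_ip_unit[OF v] _ l2]) (use \<omega> in auto)
    also have "exp (11 * (c * l)\<^sup>2 * \<omega> ^ 4) ^ card {..<n} * exp (- (l * real n / 8)) = exp (- real n / (2816 * \<omega> ^ 4))"
    proof -
      have "(c * l)\<^sup>2 * \<omega> ^ 4 = l / 176"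
        using c \<omega> by (auto simp: l_def power2_eq_square field_simps)
      then have "11 * (c * l)\<^sup>2 * \<omega> ^ 4 = l / 16" by simp
      then have "exp (11 * (c * l)\<^sup>2 * \<omega> ^ 4) ^ card {..<n} * exp (- (l * real n / 8))
          = exp (real n * (l / 16) + - (l * real n / 8))"
        unfolding exp_add by (simp only: exp_of_nat_mult card_lessThan)
      also have "real n * (l / 16) + - (l * real n / 8) = - (real n * l) / 16" by simp
      also have "\<dots> = - real n / (2816 * \<omega> ^ 4)" by (simp add: l_def)
      finally show ?thesis .
    qed
    finally have m: "measure (data {..<n}) ?E \<le> exp (- real n / (2816 * \<omega> ^ 4))"
      unfolding measure_def by (rule enn2real_leI[rotated]) simp
    show ?thesis unfolding rare_def
    proof (intro bexI[of _ ?E] conjI ballI impI m)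
      fix d assume d: "d \<in> space (data {..<n})"
        and le: "real n / 8 \<le> c * (energy d {..<n} v - real n * ip p v v)"
      have "(\<Sum>i\<in>{..<n}. ?g (d i)) = l * (c * (energy d {..<n} v - real n * ip p v v))"
        unfolding z_iso by (simp add: sum_subtractf mult_ac flip: sum_distrib_left)
      then show "d \<in> ?E" using d mult_left_mono[OF le, of l] l0 by simp
    next
      show "?E \<in> sets (data {..<n})" by measurable
    qed
  qed
  have two: "rare (data {..<n}) (2 * exp (- real n / (2816 * \<omega> ^ 4)))
      (\<lambda>d. real n / 8 \<le> \<bar>energy d {..<n} v - real n * ip p v v\<bar>)" if v: "v \<in> N" for v
    by (rule rare_mono[OF D.rare_disj[OF one[of v 1] one[of v "-1"]]]) (use N(4) v in \<open>auto simp: abs_if split: if_splits\<close>)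
  have "rare (data {..<n}) (exp (18 * real p) * (2 * exp (- real n / (2816 * \<omega> ^ 4))))
      (\<lambda>d. \<exists>v\<in>N. real n / 8 \<le> \<bar>energy d {..<n} v - real n * ip p v v\<bar>)"
    by (intro D.rare_Bex N two) auto
  then show ?thesis
  proof (rule rare_mono)
    show "exp (18 * real p) * (2 * exp (- real n / (2816 * \<omega> ^ 4))) \<le> 2 * exp (18 * real p - real n / (2816 * \<omega> ^ 4))"
      by (simp add: exp_diff exp_minus field_simps)
    fix d assume "\<exists>v. energy d {..<n} v < 3/4 * real n * ip p v v"
    then obtain v where v: "energy d {..<n} v < 3/4 * real n * ip p v v" by blast
    define A where "A = (\<lambda>i j. gram (\<lambda>i. z (d i)) {..<n} i j - (if i = j then real n else 0))"
    have A: "qform p A v = energy d {..<n} v - real n * ip p v v" for v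
    proof -
      have "qform p A v = qform p (gram (\<lambda>i. z (d i)) {..<n}) v - (\<Sum>i<p. \<Sum>j<p. v i * (if i = j then real n else 0) * v j)"
        by (simp add: qform_def A_def algebra_simps sum_subtractf)
      also have "(\<Sum>i<p. \<Sum>j<p. v i * (if i = j then real n else 0) * v j) = (\<Sum>i<p. real n * (v i * v i))"
        by (intro sum.cong refl) (simp add: if_distrib[of "\<lambda>x. _ * x"] if_distrib[of "\<lambda>x. x * _"] cong: if_cong)
      also have "\<dots> = real n * ip p v v" by (simp add: ip_def sum_distrib_left)
      finally show ?thesis by (simp add: sum_ip_sq)
    qed
    show "\<exists>v\<in>N. real n / 8 \<le> \<bar>energy d {..<n} v - real n * ip p v v\<bar>"
    proof (rule ccontr)
      assume "\<not> ?thesis"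
      then have b: "\<bar>qform p A v\<bar> \<le> real n / 8" if "v \<in> N" for v
        using that unfolding A by force
      have "\<bar>qform p A v\<bar> \<le> 2 * (real n / 8) * ip p v v"
        by (rule qform_le_twice_net[where N=N, OF _ N(5) N(4) b]) (auto simp: A_def gram_def mult.commute)
      then show False using v unfolding A by linarith
    qed
  qed
qed

end

context isotropic_model begin

text \<open>
  The assumption of smallness in the form in which it enters exponents. Its consequences for \<open>K\<close> and for \<open>p\<close> are
  both instances, by symmetry of the sum.
\<close>

lemma scaled_condition:
  assumes "0 < n" "0 \<le> a" "0 \<le> b" "\<omega>\<^sup>2 * (sqrt (a / n) + sqrt (b / n)) \<le> c"
  shows "\<omega> ^ 4 * a \<le> c\<^sup>2 * n"
proof -
  have "\<omega>\<^sup>2 * sqrt (a / n) \<le> c"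
    using assms mult_left_mono[of "sqrt (a / n)" "sqrt (a / n) + sqrt (b / n)" "\<omega>\<^sup>2"]
    by (intro order_trans[OF _ assms(4)] mult_left_mono) auto
  then have "(\<omega>\<^sup>2 * sqrt (a / n))\<^sup>2 \<le> c\<^sup>2" using assms by (intro power_mono) auto
  moreover have "(\<omega>\<^sup>2 * sqrt (a / n))\<^sup>2 = \<omega> ^ 4 * (a / n)"
    using assms by (simp add: power_mult_distrib flip: power_mult)
  ultimately show ?thesis using assms(1) by (simp add: divide_le_eq)
qed

text \<open>
  The union of six bad events. Three of them have level \<open>exp(-K t\<^sup>2)\<close>: large \<open>\<parallel>Z\<^sub>R\<parallel>\<close>, large \<open>|y\<^sub>R|\<close> and large \<open>|Z\<^sub>R \<theta>\<^sub>S|\<close>.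
  The others have level \<open>exp(-c n / \<omega>\<^sup>4)\<close>: \<open>\<parallel>Z\<^sub>R\<parallel>\<^sup>2 > n / 2\<close>, \<open>|y|\<^sup>2 > 2 n \<sigma>\<^sup>2\<close> and the two tails of the covariance.
  Outside them \<open>|Z v|\<^sup>2 \<ge> 3/4 n |v|\<^sup>2\<close>, of which the rows in \<open>S\<close> retain \<open>n / 4 |v|\<^sup>2\<close>, and \<open>ols_removal_bound\<close> applies.
  The value of \<open>c\<close> makes \<open>18 p - e / 2816 \<le> -c e\<close> for \<open>e = n / \<omega>\<^sup>4\<close>.
\<close>

lemma stable_removal_rare:
  fixes n k :: nat and t :: real
  assumes k: "1 \<le> k" "k \<le> n" and t: "0 < t"
  defines "K \<equiv> real k * ln (exp 1 * real n / real k)" and "c \<equiv> 1 / 6000 :: real"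
  assumes cond: "\<omega>\<^sup>2 * (sqrt (K / real n) + sqrt (real p / real n)) \<le> c"
  shows "rare (data {..<n}) (3 * exp (- (K * t\<^sup>2)) + 4 * exp (- (c * real n / \<omega> ^ 4)))
    (\<lambda>d. \<exists>S\<subseteq>{..<n}. n \<le> card S + k \<and> \<not> (
      (\<forall>v. real n / 4 * ip p v v \<le> energy d S v) \<and>
      (\<forall>a b. normal_eq p (\<lambda>i. z (d i)) (\<lambda>i. y (d i)) {..<n} a \<longrightarrow>
             normal_eq p (\<lambda>i. z (d i)) (\<lambda>i. y (d i)) S b \<longrightarrow>
        real n / 4 * norm2 p (\<lambda>j. a j - b j)
          \<le> 40 * ((1 + \<omega> ^ 3) * \<sigma> * (K + sqrt (K * real p)) * (1 + t)\<^sup>2))))"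
proof -
  interpret D: prob_space "data {..<n}" by (rule prob_data)
  have n: "0 < n" using k by simp
  have \<omega>: "1 \<le> \<omega>" by (rule omega_ge_1)
  have w24: "1 \<le> \<omega>\<^sup>2" "\<omega>\<^sup>2 \<le> \<omega> ^ 4" "1 \<le> \<omega> ^ 4" using \<omega> by (auto intro: power_increasing one_le_power)
  have kK: "real k \<le> K"
  proof -
    have "1 = ln (exp 1 :: real)" by simp
    also have "\<dots> \<le> ln (exp 1 * real n / real k)"
      using k n by (subst ln_le_cancel_iff) (auto simp: field_simps)
    finally show ?thesis using k mult_left_mono[of 1 "ln (exp 1 * real n / real k)" "real k"] by (simp add: K_def)
  qed
  have K1: "1 \<le> K" using kK k by linarith
  have wK: "\<omega> ^ 4 * K \<le> c\<^sup>2 * n" using scaled_condition[of n K p c] cond n K1 by simp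
  have wp: "\<omega> ^ 4 * real p \<le> c\<^sup>2 * n" using scaled_condition[of n "real p" K c] cond n K1 by (simp add: add.commute)
  define e where "e = real n / \<omega> ^ 4"
  have e: "0 \<le> e" "e \<le> real n" "e \<le> real n / \<omega>\<^sup>2"
    using \<omega> w24 divide_left_mono[of 1 "\<omega> ^ 4" "real n"] divide_left_mono[of "\<omega>\<^sup>2" "\<omega> ^ 4" "real n"]
    by (simp_all add: e_def)
  have pe: "real p \<le> c\<^sup>2 * e" using wp \<omega> w24 by (simp add: e_def pos_le_divide_eq mult_ac)
  \<comment> \<open>A sum of \<open>k\<close> squares exceeds level \<open>u\<close> with probability at most \<open>exp(k - u)\<close>, and \<open>k \<le> K\<close>. One \<open>K\<close> pays for
    \<open>k\<close>, the other for the union over \<open>R\<close>.\<close>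
  define u where "u = 2 * K + K * t\<^sup>2"
  define u' where "u' = 2 * K + 18 * real p + real n / (16 * \<omega>\<^sup>2)"
  define q where "q = exp (- (K * t\<^sup>2))"
  define r where "r = exp (- (c * e))"
  have B: "rare (data {..<n}) q (\<lambda>d. \<exists>R. R \<subseteq> {..<n} \<and> card R \<le> k \<and>
      (\<exists>v. 2 * \<omega>\<^sup>2 * (u + 18 * real p) * ip p v v < energy d R v))"
    by (rule rare_mono[OF design_block_rare[OF k, of "u + 18 * real p"]])
      (use kK in \<open>auto simp: q_def u_def K_def\<close>)
  have C: "rare (data {..<n}) q (\<lambda>d. \<exists>R. R \<subseteq> {..<n} \<and> card R \<le> k \<and> \<sigma>\<^sup>2 * u < (\<Sum>i\<in>R. (y (d i))\<^sup>2))"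
    by (rule rare_mono[OF response_block_rare[OF k, of u]]) (use kK in \<open>auto simp: q_def u_def K_def\<close>)
  have D: "rare (data {..<n}) q (\<lambda>d. \<exists>R. R \<subseteq> {..<n} \<and> card R \<le> k \<and>
      \<omega>\<^sup>2 * u * ip p (cramer_fit d ({..<n} - R)) (cramer_fit d ({..<n} - R)) < energy d R (cramer_fit d ({..<n} - R)))"
    by (rule rare_mono[OF left_out_fit_rare[OF k, of u]]) (use kK in \<open>auto simp: q_def u_def K_def\<close>)
  have G: "rare (data {..<n}) r (\<lambda>d. \<exists>R. R \<subseteq> {..<n} \<and> card R \<le> k \<and>
      (\<exists>v. 2 * \<omega>\<^sup>2 * u' * ip p v v < energy d R v))"
  proof (rule rare_mono[OF design_block_rare[OF k, of u']])
    have "c * e \<le> real n / (16 * \<omega>\<^sup>2)" using e by (simp add: c_def)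
    then show "exp (real k - u' + 18 * real p + real k * ln (exp 1 * real n / real k)) \<le> r"
      unfolding r_def K_def[symmetric] exp_le_cancel_iff u'_def using kK by linarith
  qed
  have Y: "rare (data {..<n}) r (\<lambda>d. \<sigma>\<^sup>2 * (2 * real n) < (\<Sum>i<n. (y (d i))\<^sup>2))"
  proof (rule rare_mono[OF subgaussian_block_rare[OF y_subgaussian, of "{..<n}" n "real n" "2 * real n"]])
    show "exp (real n - 2 * real n) \<le> r" using e by (simp add: r_def c_def)
  qed auto
  have F: "rare (data {..<n}) (2 * r) (\<lambda>d. \<exists>v. energy d {..<n} v < 3/4 * real n * ip p v v)"
  proof (rule rare_mono[OF covariance_rare])
    have "18 * real p - real n / (2816 * \<omega> ^ 4) = 18 * real p - e / 2816" by (simp add: e_def)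
    also have "\<dots> \<le> - (c * e)" using pe e by (simp add: c_def power2_eq_square)
    finally show "2 * exp (18 * real p - real n / (2816 * \<omega> ^ 4)) \<le> 2 * r" by (simp add: r_def)
  qed auto
  note all = D.rare_disj[OF D.rare_disj[OF D.rare_disj[OF B C] D] D.rare_disj[OF D.rare_disj[OF G Y] F]]
  show ?thesis
  proof (rule rare_mono[OF all])
    show "q + q + q + (r + r + 2 * r) \<le> 3 * exp (- (K * t\<^sup>2)) + 4 * exp (- (c * real n / \<omega> ^ 4))"
      by (simp add: q_def r_def e_def)
  next
    fix d
    assume "\<exists>S\<subseteq>{..<n}. n \<le> card S + k \<and> \<not> (
      (\<forall>v. real n / 4 * ip p v v \<le> energy d S v) \<and>
      (\<forall>a b. normal_eq p (\<lambda>i. z (d i)) (\<lambda>i. y (d i)) {..<n} a \<longrightarrow>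
             normal_eq p (\<lambda>i. z (d i)) (\<lambda>i. y (d i)) S b \<longrightarrow>
        real n / 4 * norm2 p (\<lambda>j. a j - b j)
          \<le> 40 * ((1 + \<omega> ^ 3) * \<sigma> * (K + sqrt (K * real p)) * (1 + t)\<^sup>2)))"
    then obtain S where S: "S \<subseteq> {..<n}" "n \<le> card S + k" and bad: "\<not> (
      (\<forall>v. real n / 4 * ip p v v \<le> energy d S v) \<and>
      (\<forall>a b. normal_eq p (\<lambda>i. z (d i)) (\<lambda>i. y (d i)) {..<n} a \<longrightarrow>
             normal_eq p (\<lambda>i. z (d i)) (\<lambda>i. y (d i)) S b \<longrightarrow>
        real n / 4 * norm2 p (\<lambda>j. a j - b j)
          \<le> 40 * ((1 + \<omega> ^ 3) * \<sigma> * (K + sqrt (K * real p)) * (1 + t)\<^sup>2)))" by blast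
    define R where "R = {..<n} - S"
    have R: "R \<subseteq> {..<n}" "S \<union> R = {..<n}" "S \<inter> R = {}" "{..<n} - R = S" using S by (auto simp: R_def)
    have fin: "finite S" "finite R" using S(1) R(1) finite_subset by blast+
    have cR: "card R \<le> k" unfolding R_def using S fin by (simp add: card_Diff_subset)
    show "((((\<exists>R. R \<subseteq> {..<n} \<and> card R \<le> k \<and> (\<exists>v. 2 * \<omega>\<^sup>2 * (u + 18 * real p) * ip p v v < energy d R v))
      \<or> (\<exists>R. R \<subseteq> {..<n} \<and> card R \<le> k \<and> \<sigma>\<^sup>2 * u < (\<Sum>i\<in>R. (y (d i))\<^sup>2)))
      \<or> (\<exists>R. R \<subseteq> {..<n} \<and> card R \<le> k \<and>
        \<omega>\<^sup>2 * u * ip p (cramer_fit d ({..<n} - R)) (cramer_fit d ({..<n} - R)) < energy d R (cramer_fit d ({..<n} - R))))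
      \<or> (((\<exists>R. R \<subseteq> {..<n} \<and> card R \<le> k \<and> (\<exists>v. 2 * \<omega>\<^sup>2 * u' * ip p v v < energy d R v))
      \<or> \<sigma>\<^sup>2 * (2 * real n) < (\<Sum>i<n. (y (d i))\<^sup>2))
      \<or> (\<exists>v. energy d {..<n} v < 3/4 * real n * ip p v v)))"
    proof (rule ccontr)
      assume neg: "\<not> ?thesis"
      have hB: "energy d R v \<le> 2 * \<omega>\<^sup>2 * (u + 18 * real p) * ip p v v" for v
        using neg R(1) cR by (meson not_less)
      have hC: "(\<Sum>i\<in>R. (y (d i))\<^sup>2) \<le> \<sigma>\<^sup>2 * u" using neg R(1) cR by (meson not_less)
      have hD: "energy d R (cramer_fit d S) \<le> \<omega>\<^sup>2 * u * ip p (cramer_fit d S) (cramer_fit d S)"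
        using neg R(1) cR unfolding R(4)[symmetric] by (meson not_less)
      have hG: "energy d R v \<le> 2 * \<omega>\<^sup>2 * u' * ip p v v" for v
        using neg R(1) cR by (meson not_less)
      have hY: "(\<Sum>i<n. (y (d i))\<^sup>2) \<le> \<sigma>\<^sup>2 * (2 * real n)" using neg by (meson not_less)
      have hF: "3/4 * real n * ip p v v \<le> energy d {..<n} v" for v using neg by (meson not_less)
      have ip0: "0 \<le> ip p v v" for v by (simp flip: norm2_sq)
      have low: "real n / 4 * ip p v v \<le> energy d S v" for v
      proof -
        have "\<omega>\<^sup>2 * K \<le> c\<^sup>2 * n" using wK w24 K1 mult_right_mono[of "\<omega>\<^sup>2" "\<omega> ^ 4" K] by linarith
        moreover have "\<omega>\<^sup>2 * real p \<le> c\<^sup>2 * n" using wp w24 mult_right_mono[of "\<omega>\<^sup>2" "\<omega> ^ 4" "real p"] by linarith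
        moreover have "2 * \<omega>\<^sup>2 * u' = 4 * (\<omega>\<^sup>2 * K) + 36 * (\<omega>\<^sup>2 * real p) + real n / 8"
          using \<omega> by (simp add: u'_def algebra_simps)
        moreover have "40 * (c\<^sup>2 * n) \<le> real n / 8" by (simp add: c_def power2_eq_square)
        ultimately have "2 * \<omega>\<^sup>2 * u' \<le> real n / 2" by linarith
        then have "energy d R v \<le> real n / 2 * ip p v v"
          using hG[of v] mult_right_mono[OF _ ip0[of v]] by (meson order_trans)
        moreover have "energy d {..<n} v = energy d S v + energy d R v"
          unfolding R(2)[symmetric] using fin R(3) by (rule sum.union_disjoint)
        ultimately show ?thesis using hF[of v] by (simp add: algebra_simps)
      qed
      obtain a b where ab: "normal_eq p (\<lambda>i. z (d i)) (\<lambda>i. y (d i)) {..<n} a"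
          "normal_eq p (\<lambda>i. z (d i)) (\<lambda>i. y (d i)) S b"
        and far: "\<not> real n / 4 * norm2 p (\<lambda>j. a j - b j)
          \<le> 40 * ((1 + \<omega> ^ 3) * \<sigma> * (K + sqrt (K * real p)) * (1 + t)\<^sup>2)"
        using bad low by blast
      have u0: "0 \<le> u" using K1 by (simp add: u_def)
      have n4: "0 < real n / 4" using n by simp
      \<comment> \<open>The bound was established for \<open>\<delta> b\<close>; it is homogeneous, so \<open>\<delta>\<^sup>2\<close> cancels.\<close>
      define \<delta> where "\<delta> = Determinant.det (gram_mat p (\<lambda>i. z (d i)) S)"
      have \<delta>: "\<delta> \<noteq> 0" unfolding \<delta>_def using det_gram_nonzero[OF n4 low] .
      have fit: "cramer_fit d S i = \<delta> * b i" if "i < p" for i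
        unfolding \<delta>_def using cramer_eq[OF ab(2) that] .
      have "energy d R (cramer_fit d S) = energy d R (\<lambda>i. \<delta> * b i)" "ip p (cramer_fit d S) (cramer_fit d S) = ip p (\<lambda>i. \<delta> * b i) (\<lambda>i. \<delta> * b i)"
        by (simp_all add: ip_def fit)
      then have "\<delta>\<^sup>2 * energy d R b \<le> \<delta>\<^sup>2 * (\<omega>\<^sup>2 * u * ip p b b)"
        using hD by (simp add: ip_simps power_mult_distrib sum_distrib_left power2_eq_square mult_ac)
      then have bR: "energy d R b \<le> \<omega>\<^sup>2 * u * ip p b b" using \<delta> by (simp add: mult_le_cancel_left)
      have yS: "(\<Sum>i\<in>S. (y (d i))\<^sup>2) \<le> 2 * real n * \<sigma>\<^sup>2"
        using hY S(1) sum_mono2[of "{..<n}" S "\<lambda>i. (y (d i))\<^sup>2"] by (simp add: mult_ac)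
      have "real n / 4 * norm2 p (\<lambda>j. a j - b j)
        \<le> sqrt (2 * \<omega>\<^sup>2 * (u + 18 * real p)) * (sqrt (\<sigma>\<^sup>2 * u) + sqrt (\<omega>\<^sup>2 * u * (2 * real n * \<sigma>\<^sup>2 / (real n / 4))))"
        by (rule ols_removal_bound[OF fin R(3) n4 low hB hC yS bR _ _ _ ab(2)])
          (use ab(1) u0 in \<open>auto simp: R(2)\<close>)
      also have "\<dots> \<le> 40 * ((1 + \<omega> ^ 3) * \<sigma> * (K + sqrt (K * real p)) * (1 + t)\<^sup>2)"
        using removal_rate_arith[OF \<omega> sigma_nonneg K1, of "real p" "real n" t] p n t
        by (simp add: u_def add_ac)
      finally show False using far by simp
    qed
  qed
qed

end

section \<open>Positive-definite matrices and the inverse square root\<close>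

abbreviation entries :: "real Matrix.vec \<Rightarrow> nat \<Rightarrow> real" where
  "entries v \<equiv> \<lambda>j. vec_index v j"

abbreviation mentries :: "real mat \<Rightarrow> nat \<Rightarrow> nat \<Rightarrow> real" where
  "mentries A \<equiv> \<lambda>i j. A $$ (i, j)"

lemma scalar_prod_ip:
  "v \<in> carrier_vec p \<Longrightarrow> scalar_prod u v = ip p (entries u) (entries v)"
  by (auto simp: scalar_prod_def ip_def lessThan_atLeast0)

lemma vec_norm2_norm2: "v \<in> carrier_vec p \<Longrightarrow> vec_norm2 v = norm2 p (entries v)"
  by (simp add: vec_norm2_def scalar_prod_ip flip: norm2_sq)

lemma mult_mat_vec_mv:
  assumes "A \<in> carrier_mat m p" "v \<in> carrier_vec p" "i < m"
  shows "vec_index (A *\<^sub>v v) i = mv p (mentries A) (entries v) i"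
  using assms by (auto simp: scalar_prod_def mv_def lessThan_atLeast0)

lemma mult_mat_mm:
  assumes "A \<in> carrier_mat p p" "B \<in> carrier_mat p p" "i < p" "j < p"
  shows "(A * B) $$ (i, j) = mm p (mentries A) (mentries B) i j"
  using assms by (auto simp: scalar_prod_def mm_def lessThan_atLeast0)

lemma quadratic_form_mv:
  assumes "A \<in> carrier_mat p p" "v \<in> carrier_vec p"
  shows "scalar_prod v (A *\<^sub>v v) = ip p (entries v) (mv p (mentries A) (entries v))"
proof -
  have "A *\<^sub>v v \<in> carrier_vec p" using assms by simp
  then show ?thesis using mult_mat_vec_mv[OF assms] by (simp add: scalar_prod_ip) (simp add: ip_def)
qed

lemma ip_mv_symmetric:
  assumes "\<And>i j. i < p \<Longrightarrow> j < p \<Longrightarrow> A i j = A j i"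
  shows "ip p u (mv p A v) = ip p (mv p A u) v"
proof -
  have "ip p u (mv p A v) = (\<Sum>i<p. \<Sum>j<p. u i * A i j * v j)"
    by (simp add: ip_def mv_def sum_distrib_left mult.assoc)
  also have "\<dots> = (\<Sum>j<p. \<Sum>i<p. u i * A i j * v j)" by (rule sum.swap)
  also have "\<dots> = (\<Sum>j<p. \<Sum>i<p. A j i * u i * v j)"
    by (intro sum.cong refl) (simp add: assms mult_ac)
  also have "\<dots> = ip p (mv p A u) v" by (simp add: ip_def mv_def sum_distrib_right)
  finally show ?thesis .
qed

lemma mv_mult_identity:
  assumes "A \<in> carrier_mat p p" "B \<in> carrier_mat p p" "A * B = 1\<^sub>m p" "i < p"
  shows "mv p (mentries A) (mv p (mentries B) v) i = v i"
proof -
  have "mv p (mm p (mentries A) (mentries B)) v i = (\<Sum>j<p. (A * B) $$ (i, j) * v j)"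
    unfolding mv_def using assms(1,2,4) by (intro sum.cong refl) (simp add: mult_mat_mm del: index_mult_mat(1))
  also have "\<dots> = v i" using assms(3,4) by (simp add: if_distrib[of "\<lambda>x. x * _"] cong: if_cong)
  finally show ?thesis by (simp add: mv_mm)
qed

lemma pos_def_mat_iff:
  "pos_def_mat p A \<longleftrightarrow> A \<in> carrier_mat p p \<and> (\<forall>i<p. \<forall>j<p. A $$ (i, j) = A $$ (j, i)) \<and>
     (\<forall>v. norm2 p v \<noteq> 0 \<longrightarrow> 0 < ip p v (mv p (mentries A) v))"
proof (cases "A \<in> carrier_mat p p")
  case A: True
  have "transpose_mat A = A \<longleftrightarrow> (\<forall>i<p. \<forall>j<p. A $$ (i, j) = A $$ (j, i))"
    using A by (auto simp: mat_eq_iff)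
  moreover have "(\<forall>v \<in> carrier_vec p. v \<noteq> 0\<^sub>v p \<longrightarrow> 0 < scalar_prod v (A *\<^sub>v v)) \<longleftrightarrow>
     (\<forall>v. norm2 p v \<noteq> 0 \<longrightarrow> 0 < ip p v (mv p (mentries A) v))" (is "?l \<longleftrightarrow> ?r")
  proof
    assume l: ?l
    show ?r
    proof (intro allI impI)
      fix v assume v: "norm2 p v \<noteq> 0"
      let ?v = "Matrix.vec p v"
      have c: "?v \<in> carrier_vec p" by simp
      have "?v \<noteq> 0\<^sub>v p" using v by (auto simp: norm2_eq_0 vec_eq_iff)
      then have "0 < ip p (entries ?v) (mv p (mentries A) (entries ?v))"
        using l c quadratic_form_mv[OF A c] by metis
      then show "0 < ip p v (mv p (mentries A) v)" by (simp add: ip_def mv_def)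
    qed
  next
    assume r: ?r
    show ?l
    proof (intro ballI impI)
      fix v :: "real Matrix.vec" assume v: "v \<in> carrier_vec p" "v \<noteq> 0\<^sub>v p"
      then have "norm2 p (entries v) \<noteq> 0" by (auto simp: norm2_eq_0 vec_eq_iff)
      then show "0 < scalar_prod v (A *\<^sub>v v)" using r quadratic_form_mv[OF A v(1)] by simp
    qed
  qed
  ultimately show ?thesis using A by (simp add: pos_def_mat_def)
qed (simp add: pos_def_mat_def)

lemma pos_def_mat_inverse:
  assumes A: "pos_def_mat p A"
  obtains B where "mat_inverse A = Some B" "B \<in> carrier_mat p p" "A * B = 1\<^sub>m p" "B * A = 1\<^sub>m p"
proof -
  have Ac: "A \<in> carrier_mat p p" using A by (simp add: pos_def_mat_def)
  have "det A \<noteq> 0"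
  proof
    assume "det A = 0"
    then obtain v where v: "v \<in> carrier_vec p" "v \<noteq> 0\<^sub>v p" "A *\<^sub>v v = 0\<^sub>v p"
      unfolding det_0_iff_vec_prod_zero[OF Ac] by blast
    then have "0 < scalar_prod v (A *\<^sub>v v)" using A unfolding pos_def_mat_def by blast
    then show False using v by simp
  qed
  then have "A \<in> Units (ring_mat TYPE(real) p ())" by (rule det_non_zero_imp_unit[OF Ac])
  then obtain B where "mat_inverse A = Some B" using mat_inverse(1)[OF Ac, of "()"] by (cases "mat_inverse A") auto
  then show ?thesis using mat_inverse(2)[OF Ac] that by blast
qed

lemma pos_def_mat_of_inverse:
  assumes A: "pos_def_mat p A" and B: "B \<in> carrier_mat p p" "A * B = 1\<^sub>m p" "B * A = 1\<^sub>m p"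
  shows "pos_def_mat p B"
  unfolding pos_def_mat_def
proof (intro conjI ballI impI B(1))
  have Ac: "A \<in> carrier_mat p p" and At: "transpose_mat A = A" using A by (simp_all add: pos_def_mat_def)
  have tBA: "transpose_mat B * A = 1\<^sub>m p"
    using transpose_mult[OF Ac B(1)] unfolding At B(2) by simp
  have "transpose_mat B = transpose_mat B * (A * B)" using B by simp
  also have "\<dots> = (transpose_mat B * A) * B" using Ac B(1) by (simp add: assoc_mult_mat[of _ p p _ p _ p])
  also have "\<dots> = B" using tBA B(1) by simp
  finally show "transpose_mat B = B" .
  fix v :: "real Matrix.vec" assume v: "v \<in> carrier_vec p" "v \<noteq> 0\<^sub>v p"
  define u where "u = B *\<^sub>v v"
  have u: "u \<in> carrier_vec p" using B(1) v by (simp add: u_def)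
  have Au: "A *\<^sub>v u = v"
    using Ac B v by (simp add: u_def assoc_mult_mat_vec[symmetric, of A p p B p v])
  have "u \<noteq> 0\<^sub>v p" using Au v(2) Ac by auto
  then have "0 < scalar_prod u (A *\<^sub>v u)" using A u by (simp add: pos_def_mat_def)
  also have "\<dots> = scalar_prod v u" unfolding Au using u v(1) by (rule comm_scalar_prod)
  finally show "0 < scalar_prod v (B *\<^sub>v v)" by (simp add: u_def)
qed

text \<open>
  With \<open>M \<ge> \<parallel>A\<parallel>\<close> the matrix \<open>B = I - A / M\<close> has norm below one, and the fixed point \<open>X\<close> of the iteration gives
  \<open>A = (\<surd>M (I - X))\<^sup>2\<close>. The root is positive definite because \<open>\<parallel>X\<parallel> < 1\<close>.
\<close>

lemma pos_def_mat_sqrt_exists: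
  assumes A: "pos_def_mat p A"
  shows "\<exists>R. pos_def_mat p R \<and> R * R = A"
proof -
  let ?A = "mentries A"
  obtain N where N: "N \<in> carrier_mat p p" "A * N = 1\<^sub>m p" "N * A = 1\<^sub>m p"
    using pos_def_mat_inverse[OF A] by blast
  have Ac: "A \<in> carrier_mat p p" and sym: "\<And>i j. i < p \<Longrightarrow> j < p \<Longrightarrow> A $$ (i, j) = A $$ (j, i)"
    and pd: "\<And>v. norm2 p v \<noteq> 0 \<Longrightarrow> 0 < ip p v (mv p ?A v)"
    using A by (auto simp: pos_def_mat_iff)
  obtain M where M: "0 < M" "op_le p ?A M" using op_le_exists by blast
  obtain K0 where K0: "0 < K0" "op_le p (mentries N) K0" using op_le_exists by blast
  \<comment> \<open>The maximum ensures \<open>M K \<ge> 1\<close>, also for \<open>p = 0\<close>.\<close>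
  define K where "K = max K0 (1 / M)"
  have K: "op_le p (mentries N) K" "1 \<le> M * K" 
    using op_le_mono[OF K0(2)] M(1) by (auto simp: K_def max_def field_simps)
  have sa: "ip p u (mv p ?A v) = ip p (mv p ?A u) v" for u v by (rule ip_mv_symmetric[OF sym])
  have psd: "0 \<le> ip p v (mv p ?A v)" for v
    using pd[of v] by (cases "norm2 p v = 0") (auto simp: norm2_eq_0 ip_def)
  have inv: "norm2 p v \<le> K * norm2 p (mv p ?A v)" for v
  proof -
    have "mv p (mentries N) (mv p ?A v) i = v i" if "i < p" for i
      by (rule mv_mult_identity[OF N(1) Ac N(3) that])
    then have "norm2 p v = norm2 p (mv p (mentries N) (mv p ?A v))" by (intro L2_set_cong) auto
    also have "\<dots> \<le> K * norm2 p (mv p ?A v)" by (rule op_leD[OF K(1)])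
    finally show ?thesis .
  qed
  \<comment> \<open>The iteration asks for symmetry at all indices, so entries outside the matrix are set to zero.\<close>
  define A' where "A' = (\<lambda>i j. if i < p \<and> j < p then ?A i j else 0)"
  have mvA': "mv p A' v i = mv p ?A v i" if "i < p" for v i using that by (simp add: mv_def A'_def)
  have nA': "norm2 p (mv p A' v) = norm2 p (mv p ?A v)" for v by (rule L2_set_cong) (auto simp: mvA')
  define B where "B = (\<lambda>i j. (if i = j then 1 else 0) - A' i j / M)"
  define q where "q = sqrt (1 - 1 / (M * K)\<^sup>2)"
  have B: "op_le p B q" unfolding B_def q_def
  proof (rule op_le_identity_minus)
    show "ip p u (mv p A' v) = ip p (mv p A' u) v" for u v using sa[of u v] by (simp add: ip_def mvA')
    show "0 \<le> ip p v (mv p A' v)" for v using psd[of v] by (simp add: ip_def mvA')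
    show "op_le p A' M" using M(2) by (simp add: op_le_def nA')
    show "norm2 p v \<le> K * norm2 p (mv p A' v)" for v using inv[of v] by (simp add: nA')
  qed (use M K in auto)
  have q: "0 \<le> q" "q < 1"
  proof -
    have "1 \<le> (M * K)\<^sup>2" using K(2) by (simp add: one_le_power)
    then show "0 \<le> q" by (simp add: q_def divide_le_eq)
    show "q < 1" unfolding q_def using K(2) by (intro real_less_lsqrt) auto
  qed
  obtain X where X: "op_le p X q" "\<And>i j. X i j = X j i"
    "\<And>i j. i < p \<Longrightarrow> j < p \<Longrightarrow> 2 * X i j = B i j + mm p X X i j"
  proof (rule sqrt_iter_limit[OF B q])
    show "B i j = B j i" for i j using sym[of i j] by (auto simp: B_def A'_def)
  qed blast
  define T where "T = (\<lambda>i j. sqrt M * ((if i = j then 1 else 0) - X i j))"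
  have TT: "mm p T T i j = ?A i j" if "i < p" "j < p" for i j
  proof -
    have "sqrt M * a * (sqrt M * b) = M * (a * b)" for a b
    proof -
      have "sqrt M * a * (sqrt M * b) = (sqrt M * sqrt M) * (a * b)" by (simp only: mult_ac)
      then show ?thesis using M(1) by simp
    qed
    then have "mm p T T i j = (\<Sum>k<p. M * (((if i = k then 1 else 0) - X i k) * ((if k = j then 1 else 0) - X k j)))"
      unfolding mm_def T_def by (intro sum.cong refl)
    also have "\<dots> = M * (\<Sum>k<p. ((if i = k then 1 else 0) - X i k) * ((if k = j then 1 else 0) - X k j))"
      by (simp add: sum_distrib_left)
    also have "(\<Sum>k<p. ((if i = k then 1 else 0) - X i k) * ((if k = j then 1 else 0) - X k j))
        = (if i = j then 1 else 0) - 2 * X i j + mm p X X i j"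
      using that by (simp add: algebra_simps sum_subtractf sum.distrib mm_def
          if_distrib[of "\<lambda>x. x * _"] if_distrib[of "\<lambda>x. _ * x"] cong: if_cong)
    also have "\<dots> = ?A i j / M" using X(3)[OF that] that by (simp add: B_def A'_def)
    finally show ?thesis using M(1) by simp
  qed
  define R where "R = Matrix.mat p p (\<lambda>(i, j). T i j)"
  have Rc: "R \<in> carrier_mat p p" by (simp add: R_def)
  have "pos_def_mat p R" unfolding pos_def_mat_iff
  proof (intro conjI allI impI Rc)
    fix i j assume "i < p" "j < p"
    then show "R $$ (i, j) = R $$ (j, i)" using X(2)[of i j] by (simp add: R_def T_def)
  next
    fix v assume v: "norm2 p v \<noteq> 0"
    have "mv p (mentries R) v i = sqrt M * (v i - mv p X v i)" if "i < p" for i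
    proof -
      have "mv p (mentries R) v i = (\<Sum>j<p. sqrt M * (((if i = j then 1 else 0) - X i j) * v j))"
        using that by (simp add: mv_def R_def T_def mult.assoc)
      also have "\<dots> = sqrt M * (v i - mv p X v i)"
        using that by (simp add: sum_distrib_left[symmetric] left_diff_distrib sum_subtractf mv_def
            if_distrib[of "\<lambda>x. x * _"] cong: if_cong)
      finally show ?thesis .
    qed
    then have "ip p v (mv p (mentries R) v) = ip p v (\<lambda>i. sqrt M * (v i - mv p X v i))" by (simp add: ip_def)
    also have "\<dots> = sqrt M * ((norm2 p v)\<^sup>2 - ip p v (mv p X v))" by (simp add: ip_simps norm2_sq)
    also have "\<dots> > 0"
    proof -
      have "ip p v (mv p X v) \<le> norm2 p v * norm2 p (mv p X v)" using abs_ip_le[of p v "mv p X v"] by simp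
      also have "\<dots> \<le> norm2 p v * (q * norm2 p v)" by (intro mult_left_mono op_leD[OF X(1)]) simp
      also have "\<dots> = q * (norm2 p v)\<^sup>2" by (simp add: power2_eq_square)
      also have "\<dots> < 1 * (norm2 p v)\<^sup>2" using q v by (intro mult_strict_right_mono) auto
      finally show ?thesis using M(1) by simp
    qed
    finally show "0 < ip p v (mv p (mentries R) v)" .
  qed
  moreover have "R * R = A"
  proof (rule eq_matI)
    fix i j assume "i < dim_row A" "j < dim_col A"
    then have ij: "i < p" "j < p" using Ac by auto
    have "(R * R) $$ (i, j) = mm p (mentries R) (mentries R) i j" by (rule mult_mat_mm[OF Rc Rc ij])
    also have "\<dots> = mm p T T i j" using ij by (simp add: mm_def R_def)
    finally show "(R * R) $$ (i, j) = A $$ (i, j)" using TT[OF ij] by simp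
  qed (use Ac Rc in auto)
  ultimately show ?thesis by blast
qed

lemma pos_def_mat_sqrt_unique:
  assumes R: "pos_def_mat p R" and S: "pos_def_mat p S" and eq: "R * R = S * S"
  shows "R = S"
proof -
  have Rc: "R \<in> carrier_mat p p" and Sc: "S \<in> carrier_mat p p" using R S by (auto simp: pos_def_mat_def)
  have psd: "0 \<le> ip p v (mv p (mentries A) v)" if "pos_def_mat p A" for A v
    using that by (cases "norm2 p v = 0") (auto simp: pos_def_mat_iff norm2_eq_0 ip_def less_imp_le)
  have "mentries R i j = mentries S i j" if ij: "i < p" "j < p" for i j
  proof (rule square_root_unique[OF _ _ psd[OF R] psd[OF S] _ _ ij])
    fix v assume "ip p v (mv p (mentries R) v) = 0"
    then have "norm2 p v = 0" using R by (force simp: pos_def_mat_iff)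
    then show "\<forall>i<p. v i = 0" by (simp add: norm2_eq_0)
  next
    fix i j assume ij: "i < p" "j < p"
    show "mm p (mentries R) (mentries R) i j = mm p (mentries S) (mentries S) i j"
      using mult_mat_mm[OF Rc Rc ij] mult_mat_mm[OF Sc Sc ij] eq by simp
  qed (use R S in \<open>auto simp: pos_def_mat_iff\<close>)
  then show ?thesis using Rc Sc by (intro eq_matI) auto
qed

text \<open>
  Existence and uniqueness of the root identify the definite description.
\<close>

lemma inv_sqrt_mat_whitens:
  assumes A: "pos_def_mat p A"
  defines "W \<equiv> inv_sqrt_mat p A"
  shows "pos_def_mat p W" "W * A * W = 1\<^sub>m p" "W * (W * A) = 1\<^sub>m p"
proof -
  obtain B where B: "mat_inverse A = Some B" "B \<in> carrier_mat p p" "A * B = 1\<^sub>m p" "B * A = 1\<^sub>m p"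
    using pos_def_mat_inverse[OF A] by blast
  have Ac: "A \<in> carrier_mat p p" using A by (simp add: pos_def_mat_def)
  have pB: "pos_def_mat p B" using pos_def_mat_of_inverse[OF A B(2-4)] .
  obtain R where R: "pos_def_mat p R" "R * R = B" using pos_def_mat_sqrt_exists[OF pB] by blast
  have "W = R" unfolding W_def inv_sqrt_mat_def
    by (rule the_equality) (use R B(1) pos_def_mat_sqrt_unique in auto)
  then have W: "pos_def_mat p W" "W * W = B" using R by auto
  show "pos_def_mat p W" by (fact W(1))
  have Wc: "W \<in> carrier_mat p p" using W(1) by (simp add: pos_def_mat_def)
  show l: "W * (W * A) = 1\<^sub>m p"
    using Wc Ac W(2) B(4) by (simp add: assoc_mult_mat[of W p p W p A p, symmetric])
  show "W * A * W = 1\<^sub>m p"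
    using mat_mult_left_right_inverse[OF Wc _ l] Wc Ac by auto
qed

section \<open>Norms and least-squares estimators in matrix form\<close>

lemma psi2_norm_vec_subgaussian:
  assumes M: "prob_space M" and Z: "\<And>x. Z x \<in> carrier_vec p"
    and meas: "\<And>j. j < p \<Longrightarrow> (\<lambda>x. vec_index (Z x) j) \<in> borel_measurable M"
    and le: "psi2_norm_vec p M Z \<le> ennreal s" and s: "0 \<le> s"
  shows "subgaussian M (\<lambda>x. ip p v (entries (Z x))) (s * norm2 p v)"
proof (cases "norm2 p v = 0")
  case True
  interpret prob_space M by fact
  have "ip p v u = 0" for u using True by (simp add: norm2_eq_0 ip_def)
  moreover have "1 \<le> ennreal (exp 1)" by (simp flip: ennreal_1)
  ultimately show ?thesis using True by (simp add: subgaussian_def emeasure_space_1)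
next
  case False
  define a where "a = norm2 p v"
  have a: "0 < a" using False by (simp add: a_def less_le)
  define u where "u = Matrix.vec p (\<lambda>j. (1 / a) * v j)"
  have u: "u \<in> carrier_vec p" by (simp add: u_def)
  have ipu: "scalar_prod u (Z x) = (1 / a) * ip p v (entries (Z x))" for x
    using scalar_prod_ip[OF Z[of x], of u] by (simp add: u_def ip_def sum_distrib_left mult.assoc)
  have "vec_norm2 u = norm2 p (\<lambda>j. (1 / a) * v j)"
    unfolding vec_norm2_norm2[OF u] by (rule L2_set_cong) (auto simp: u_def)
  also have "\<dots> = 1" unfolding norm2_scale using a by (simp add: a_def)
  finally have "u \<in> unit_sphere p" using u by (simp add: unit_sphere_def)
  then have "psi2_norm M (\<lambda>x. scalar_prod u (Z x)) \<le> psi2_norm_vec p M Z"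
    unfolding psi2_norm_vec_def by (rule SUP_upper)
  then have "psi2_norm M (\<lambda>x. (1 / a) * ip p v (entries (Z x))) \<le> ennreal s" unfolding ipu using le by (rule order_trans)
  then have "subgaussian M (\<lambda>x. (1 / a) * ip p v (entries (Z x))) s"
    using s meas by (intro subgaussian_of_psi2_norm) (auto simp: ip_def)
  from subgaussian_scale[OF this, of a] show ?thesis using a by (simp add: a_def mult.commute)
qed

lemma psi2_norm_vec_le:
  assumes Z: "\<And>x. Z x \<in> carrier_vec p"
    and sg: "\<And>v. subgaussian M (\<lambda>x. ip p v (entries (Z x))) (s * norm2 p v)"
  shows "psi2_norm_vec p M Z \<le> ennreal (s + 1)"
  unfolding psi2_norm_vec_def
proof (rule SUP_least)
  fix v assume v: "v \<in> unit_sphere p"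
  then have "norm2 p (entries v) = 1" using vec_norm2_norm2[of v p] by (simp add: unit_sphere_def)
  then have "subgaussian M (\<lambda>x. ip p (entries v) (entries (Z x))) s" using sg[of "entries v"] by simp
  then show "psi2_norm M (\<lambda>x. scalar_prod v (Z x)) \<le> ennreal (s + 1)"
    unfolding scalar_prod_ip[OF Z] by (rule psi2_norm_le) simp
qed

lemma norm2_mv_le_spectral_norm:
  assumes A: "A \<in> carrier_mat p p"
  shows "norm2 p (mv p (mentries A) v) \<le> spectral_norm A * norm2 p v"
proof (cases "norm2 p v = 0")
  case True
  then have "mv p (mentries A) v = (\<lambda>_. 0)" by (simp add: norm2_eq_0 mv_def fun_eq_iff)
  then show ?thesis using True by (simp add: L2_set_def)
next
  case False
  define a where "a = norm2 p v"
  have a: "0 < a" using False by (simp add: a_def less_le)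
  have nrm: "vec_norm2 (A *\<^sub>v u) = norm2 p (mv p (mentries A) (entries u))" if "u \<in> carrier_vec p" for u
  proof -
    have c: "A *\<^sub>v u \<in> carrier_vec p" using A that by simp
    show ?thesis unfolding vec_norm2_norm2[OF c]
      by (intro L2_set_cong refl) (use mult_mat_vec_mv[OF A that] in \<open>auto simp del: index_mult_mat_vec\<close>)
  qed
  obtain M where M: "op_le p (mentries A) M" using op_le_exists by blast
  have "bdd_above ((\<lambda>v. vec_norm2 (A *\<^sub>v v)) ` unit_sphere p)"
  proof (rule bdd_aboveI2)
    fix u assume u: "u \<in> unit_sphere p"
    then have "norm2 p (entries u) = 1" "u \<in> carrier_vec p"
      using vec_norm2_norm2[of u p] by (auto simp: unit_sphere_def)
    then show "vec_norm2 (A *\<^sub>v u) \<le> M" using op_leD[OF M, of "entries u"] nrm by simp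
  qed
  define u where "u = Matrix.vec p (\<lambda>j. (1 / a) * v j)"
  have u: "u \<in> carrier_vec p" by (simp add: u_def)
  have "vec_norm2 u = norm2 p (\<lambda>j. (1 / a) * v j)"
    unfolding vec_norm2_norm2[OF u] by (rule L2_set_cong) (auto simp: u_def)
  also have "\<dots> = 1" unfolding norm2_scale using a by (simp add: a_def)
  finally have us: "u \<in> unit_sphere p" using u by (simp add: unit_sphere_def)
  have "vec_norm2 (A *\<^sub>v u) \<le> spectral_norm A"
    unfolding spectral_norm_def using A us \<open>bdd_above _\<close> by (auto intro!: cSUP_upper)
  moreover have "mv p (mentries A) (entries u) = (\<lambda>i. (1 / a) * mv p (mentries A) v i)"
    by (simp add: mv_def u_def fun_eq_iff sum_distrib_left mult_ac)
  ultimately have "(1 / a) * norm2 p (mv p (mentries A) v) \<le> spectral_norm A"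
    unfolding nrm[OF u] using a by (simp add: norm2_scale[of "1 / a", simplified])
  then show ?thesis using a by (simp add: a_def[symmetric] divide_le_eq)
qed

text \<open>
  Equal columns would give a kernel vector \<open>e\<^sub>i - e\<^sub>j\<close>, so the columns are distinct and a linear dependence among them
  is again a kernel vector.
\<close>

lemma full_column_rank_of_injective:
  assumes X: "X \<in> carrier_mat m p"
    and inj: "\<And>v. v \<in> carrier_vec p \<Longrightarrow> X *\<^sub>v v = 0\<^sub>v m \<Longrightarrow> v = 0\<^sub>v p"
  shows "full_column_rank X"
proof -
  interpret vec_space "TYPE(real)" m .
  have dist: "distinct (cols X)"
  proof (unfold distinct_conv_nth, intro allI impI notI)
    fix i j assume ij: "i < length (cols X)" "j < length (cols X)" "i \<noteq> j" "cols X ! i = cols X ! j"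
    then have lt: "i < p" "j < p" using X by auto
    have eq: "col X i = col X j" using ij X by simp
    define v :: "real Matrix.vec" where "v = unit_vec p i - unit_vec p j"
    have v: "v \<in> carrier_vec p" by (simp add: v_def)
    have "X *\<^sub>v v = X *\<^sub>v unit_vec p i - X *\<^sub>v unit_vec p j"
      unfolding v_def using X by (intro mult_minus_distrib_mat_vec) auto
    also have "\<dots> = 0\<^sub>v m"
      using X lt eq by (intro eq_vecI) (auto simp: mult_mat_vec_def col_def vec_eq_iff)
    finally have "v = 0\<^sub>v p" by (rule inj[OF v])
    then have "vec_index v i = 0" using lt by simp
    then show False using lt ij(3) by (simp add: v_def)
  qed
  moreover have "lin_indpt (set (cols X))"
  proof
    assume "lin_dep (set (cols X))"
    then obtain v where "v \<in> carrier_vec p" "v \<noteq> 0\<^sub>v p" "X *\<^sub>v v = 0\<^sub>v m"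
      using lin_depE[OF X _ dist] by blast
    then show False using inj by blast
  qed
  ultimately have "rank X = p" using lin_indpt_full_rank[OF X] by blast
  then show ?thesis using X by (simp add: full_column_rank_def)
qed

text \<open>
  The matrix \<open>X\<close> lists the rows \<open>x s\<close>, \<open>s \<in> S\<close>, in the order given by \<open>r\<close>. One statement covers the full design and
  its restrictions.
\<close>

lemma is_ols_normal_eq:
  assumes X: "X \<in> carrier_mat m p" and Y: "Y \<in> carrier_vec m" and ols: "is_ols X Y b"
    and bij: "bij_betw r {..<m} S"
    and rows: "\<And>i j. i < m \<Longrightarrow> j < p \<Longrightarrow> X $$ (i, j) = x (r i) j" "\<And>i. i < m \<Longrightarrow> vec_index Y i = y (r i)"
    and inj: "\<And>v. (\<Sum>s\<in>S. (ip p v (x s))\<^sup>2) = 0 \<Longrightarrow> norm2 p v = 0"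
  shows "b \<in> carrier_vec p" "normal_eq p x y S (entries b)"
proof -
  have dims: "dim_row X = m" "dim_col X = p" using X by auto
  show b: "b \<in> carrier_vec p" using ols dims by (simp add: is_ols_def)
  have Xv: "vec_index (X *\<^sub>v v) i = ip p (entries v) (x (r i))" if "v \<in> carrier_vec p" "i < m" for v i
    using that X rows(1) by (auto simp: scalar_prod_def ip_def lessThan_atLeast0 mult.commute intro!: sum.cong)
  have inj': "v = 0\<^sub>v p" if v: "v \<in> carrier_vec p" and 0: "X *\<^sub>v v = 0\<^sub>v m" for v
  proof -
    have "ip p (entries v) (x (r i)) = 0" if "i < m" for i using Xv[OF v that] 0 that by simp
    then have "(\<Sum>i<m. (ip p (entries v) (x (r i)))\<^sup>2) = 0" by simp
    then have "(\<Sum>s\<in>S. (ip p (entries v) (x s))\<^sup>2) = 0"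
      using sum.reindex_bij_betw[OF bij, of "\<lambda>s. (ip p (entries v) (x s))\<^sup>2"] by simp
    then have "norm2 p (entries v) = 0" by (rule inj)
    then show "v = 0\<^sub>v p" using v by (intro eq_vecI) (auto simp: norm2_eq_0)
  qed
  let ?Xt = "transpose_mat X"
  have Xt: "?Xt \<in> carrier_mat p m" using X by simp
  let ?G = "?Xt * X"
  have G: "?G \<in> carrier_mat p p" using X by simp
  have "det ?G \<noteq> 0"
  proof
    assume "det ?G = 0"
    then obtain v where v: "v \<in> carrier_vec p" "v \<noteq> 0\<^sub>v p" "?G *\<^sub>v v = 0\<^sub>v p"
      unfolding det_0_iff_vec_prod_zero[OF G] by blast
    have Xvc: "X *\<^sub>v v \<in> carrier_vec m" using X v by simp
    have "?Xt *\<^sub>v (X *\<^sub>v v) = 0\<^sub>v p" using v(3) assoc_mult_mat_vec[OF Xt X v(1)] by simp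
    then have "0 = scalar_prod v (?Xt *\<^sub>v (X *\<^sub>v v))" using v(1) by simp
    also have "\<dots> = scalar_prod (X *\<^sub>v v) (X *\<^sub>v v)"
      using transpose_vec_mult_scalar[OF X v(1) Xvc] comm_scalar_prod[OF v(1), of "?Xt *\<^sub>v (X *\<^sub>v v)"] X Xvc by simp
    finally have "ip m (entries (X *\<^sub>v v)) (entries (X *\<^sub>v v)) = 0" by (simp add: scalar_prod_ip[OF Xvc])
    then have "norm2 m (entries (X *\<^sub>v v)) = 0" by (simp flip: norm2_sq)
    then have "X *\<^sub>v v = 0\<^sub>v m" using Xvc by (intro eq_vecI) (auto simp: norm2_eq_0 dims simp del: index_mult_mat_vec)
    then show False using inj'[OF v(1)] v(2) by simp
  qed
  then have "?G \<in> Units (ring_mat TYPE(real) p ())" by (rule det_non_zero_imp_unit[OF G])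
  then obtain B where B: "mat_inverse ?G = Some B" using mat_inverse(1)[OF G, of "()"] by (cases "mat_inverse ?G") auto
  then have GB: "?G * B = 1\<^sub>m p" and Bc: "B \<in> carrier_mat p p" using mat_inverse(2)[OF G] by blast+
  have "full_column_rank X" using full_column_rank_of_injective[OF X inj'] .
  then have b_eq: "b = B *\<^sub>v (?Xt *\<^sub>v Y)" using ols B by (simp add: is_ols_def)
  have XtY: "?Xt *\<^sub>v Y \<in> carrier_vec p" using Xt Y by simp
  have "?Xt *\<^sub>v (X *\<^sub>v b) = ?G *\<^sub>v b" using assoc_mult_mat_vec[OF Xt X b] by simp
  also have "\<dots> = (?G * B) *\<^sub>v (?Xt *\<^sub>v Y)" unfolding b_eq using assoc_mult_mat_vec[OF G Bc XtY] by simp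
  also have "\<dots> = ?Xt *\<^sub>v Y" unfolding GB using XtY by simp
  finally have eq: "?Xt *\<^sub>v (X *\<^sub>v b) = ?Xt *\<^sub>v Y" .
  have coord: "(\<Sum>s\<in>S. x s j * (ip p (entries b) (x s) - y s)) = 0" if j: "j < p" for j
  proof -
    have t: "vec_index (?Xt *\<^sub>v u) j = (\<Sum>i<m. x (r i) j * vec_index u i)" if "u \<in> carrier_vec m" for u
      using that X j rows(1) by (auto simp: scalar_prod_def lessThan_atLeast0 intro!: sum.cong)
    have "X *\<^sub>v b \<in> carrier_vec m" using X b by simp
    then have "(\<Sum>i<m. x (r i) j * vec_index (X *\<^sub>v b) i) = (\<Sum>i<m. x (r i) j * vec_index Y i)"
      using eq t[of "X *\<^sub>v b"] t[OF Y] by simp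
    then have "(\<Sum>i<m. x (r i) j * ip p (entries b) (x (r i))) = (\<Sum>i<m. x (r i) j * y (r i))"
      using Xv[OF b] rows(2) by (simp del: index_mult_mat_vec)
    then have "(\<Sum>i<m. x (r i) j * (ip p (entries b) (x (r i)) - y (r i))) = 0"
      by (simp add: right_diff_distrib sum_subtractf)
    then show ?thesis
      using sum.reindex_bij_betw[OF bij, of "\<lambda>s. x s j * (ip p (entries b) (x s) - y s)"] by simp
  qed
  show "normal_eq p x y S (entries b)" unfolding normal_eq_def
  proof
    fix h
    have "(\<Sum>s\<in>S. ip p h (x s) * (ip p (entries b) (x s) - y s))
        = (\<Sum>s\<in>S. \<Sum>j<p. h j * (x s j * (ip p (entries b) (x s) - y s)))"
      by (simp add: ip_def[of p h] sum_distrib_right mult.assoc)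
    also have "\<dots> = (\<Sum>j<p. h j * (\<Sum>s\<in>S. x s j * (ip p (entries b) (x s) - y s)))"
      by (subst sum.swap) (simp add: sum_distrib_left)
    also have "\<dots> = 0" using coord by simp
    finally show "(\<Sum>s\<in>S. ip p h (x s) * (ip p (entries b) (x s) - y s)) = 0" .
  qed
qed

lemma bij_betw_pick:
  assumes "finite S"
  shows "bij_betw (pick S) {..<card S} S"
proof -
  have inj: "inj_on (pick S) {..<card S}"
    by (rule inj_on_inverseI[where g="\<lambda>x. card {a \<in> S. a < x}"]) (simp add: card_pick_le)
  have sub: "pick S ` {..<card S} \<subseteq> S" by (auto intro: pick_in_set_le)
  then have "pick S ` {..<card S} = S"
    using assms inj by (intro card_subset_eq) (auto simp: card_image)
  then show ?thesis using inj by (simp add: bij_betw_def)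
qed

section \<open>Whitening the model\<close>

definition whitened :: "nat \<Rightarrow> sample measure \<Rightarrow> sample \<Rightarrow> nat \<Rightarrow> real" where
  "whitened p P s = mv p (mentries (inv_sqrt_mat p (covariance p P))) (fst s)"

text \<open>
  The form of the whitened vector at \<open>v\<close> is the form of \<open>x\<close> at \<open>W v\<close>. This gives sub-Gaussianity with a finite
  constant, so that the supremum in \<open>model_omega\<close> is a real number, and \<open>W \<Sigma> W = I\<close> gives isotropy.
\<close>

lemma model1_isotropic:
  assumes m: "model1 p P" and p: "1 \<le> p"
  shows "isotropic_model P p (whitened p P) snd (model_omega p P) (enn2real (psi2_norm P snd))"
proof -
  define A where "A = covariance p P"
  define W where "W = inv_sqrt_mat p A"
  have prob: "prob_space P" and sets: "sets P = sets (sample_space p)" and A: "pos_def_mat p A"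
    and fin: "psi2_norm_vec p P (covariate p) < \<infinity>" "psi2_norm P snd < \<infinity>"
    using m by (auto simp: model1_def A_def)
  have Ac: "A \<in> carrier_mat p p" by (simp add: A_def covariance_def)
  have W: "pos_def_mat p W" "W * A * W = 1\<^sub>m p" using inv_sqrt_mat_whitens[OF A] by (simp_all add: W_def)
  have Wc: "W \<in> carrier_mat p p" and Wsym: "\<And>i j. i < p \<Longrightarrow> j < p \<Longrightarrow> mentries W i j = mentries W j i"
    using W(1) by (auto simp: pos_def_mat_iff)
  have fstm: "(\<lambda>s. fst s j) \<in> borel_measurable P" if "j < p" for j
  proof -
    have [measurable]: "j \<in> {..<p}" using that by simp
    have "(\<lambda>s. fst s j) \<in> borel_measurable (sample_space p)"
      unfolding sample_space_def by measurable
    then show ?thesis using sets by (simp cong: measurable_cong_sets)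
  qed
  have sndm: "snd \<in> borel_measurable P"
  proof -
    have "snd \<in> borel_measurable (sample_space p)" unfolding sample_space_def by measurable
    then show ?thesis using sets by (simp cong: measurable_cong_sets)
  qed
  have wz: "ip p v (whitened p P s) = ip p (mv p (mentries W) v) (fst s)" for v s
    unfolding whitened_def A_def[symmetric] W_def[symmetric] by (rule ip_mv_symmetric[OF Wsym])
  obtain \<kappa> where \<kappa>: "psi2_norm_vec p P (covariate p) = ennreal \<kappa>" "0 \<le> \<kappa>"
    using fin(1) by (cases "psi2_norm_vec p P (covariate p)") auto
  have ent: "ip p v (entries (covariate p s)) = ip p v (fst s)" for v s
    by (simp add: ip_def covariate_def)
  have sgx: "subgaussian P (\<lambda>s. ip p v (fst s)) (\<kappa> * norm2 p v)" for v
    using psi2_norm_vec_subgaussian[OF prob, of "covariate p" p \<kappa> v] \<kappa> fstm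
    unfolding ent by (simp add: covariate_def)
  define Z where "Z = (\<lambda>s. W *\<^sub>v covariate p s)"
  have Zc: "Z s \<in> carrier_vec p" for s using Wc by (simp add: Z_def covariate_def)
  have Zz: "vec_index (Z s) i = whitened p P s i" if "i < p" for s i
  proof -
    have "vec_index (Z s) i = mv p (mentries W) (entries (covariate p s)) i"
      unfolding Z_def by (rule mult_mat_vec_mv[OF Wc _ that]) (simp add: covariate_def)
    then show ?thesis by (simp add: whitened_def A_def W_def mv_def covariate_def)
  qed
  have entZ: "ip p v (entries (Z s)) = ip p v (whitened p P s)" for v s by (simp add: ip_def Zz)
  have Zm: "(\<lambda>s. vec_index (Z s) j) \<in> borel_measurable P" if "j < p" for j
    unfolding Zz[OF that] whitened_def mv_def using fstm by (intro borel_measurable_sum borel_measurable_times) auto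
  obtain M where M: "0 < M" "op_le p (mentries W) M" using op_le_exists by blast
  have "subgaussian P (\<lambda>s. ip p v (entries (Z s))) ((\<kappa> * M) * norm2 p v)" for v
    unfolding entZ wz using \<kappa>(2) op_leD[OF M(2), of v]
    by (intro subgaussian_mono[OF sgx]) (simp add: mult.assoc mult_left_mono)
  then have "psi2_norm_vec p P Z \<le> ennreal (\<kappa> * M + 1)" by (rule psi2_norm_vec_le[OF Zc])
  then have "psi2_norm_vec p P Z \<noteq> \<infinity>" by (auto simp: top_unique)
  then have om: "psi2_norm_vec p P Z = ennreal (model_omega p P)"
    unfolding model_omega_def Z_def W_def A_def by (simp add: less_top)
  have z_subgaussian: "subgaussian P (\<lambda>s. ip p v (whitened p P s)) (model_omega p P * norm2 p v)" for v
    using psi2_norm_vec_subgaussian[OF prob Zc Zm, of "model_omega p P" v] om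
    unfolding entZ by (simp add: model_omega_def)
  have y_subgaussian: "subgaussian P snd (enn2real (psi2_norm P snd))"
    using fin(2) by (intro subgaussian_of_psi2_norm sndm) (auto simp: less_top)
  have int: "integrable P (\<lambda>s. fst s i * fst s j)" if "i < p" "j < p" for i j
  proof -
    have sq: "integrable P (\<lambda>s. (fst s i)\<^sup>2)" if "i < p" for i
      using subgaussian_integrable_square[OF sgx[of "\<lambda>j. if j = i then 1 else 0"]] that
      by (simp add: ip_def if_distrib[of "\<lambda>x. x * _"] cong: if_cong)
    show ?thesis
    proof (rule Bochner_Integration.integrable_bound[OF Bochner_Integration.integrable_add[OF sq[OF that(1)] sq[OF that(2)]]])
      show "(\<lambda>s. fst s i * fst s j) \<in> borel_measurable P" using fstm that by (intro borel_measurable_times)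
      have "\<bar>a * b\<bar> \<le> a\<^sup>2 + b\<^sup>2" for a b :: real
      proof -
        have "0 \<le> (\<bar>a\<bar> - \<bar>b\<bar>)\<^sup>2" by simp
        also have "\<dots> = a\<^sup>2 + b\<^sup>2 - 2 * \<bar>a * b\<bar>" by (simp add: power2_diff abs_mult)
        finally show ?thesis using abs_ge_zero[of "a * b"] by linarith
      qed
      then show "AE s in P. norm (fst s i * fst s j) \<le> norm ((fst s i)\<^sup>2 + (fst s j)\<^sup>2)" by simp
    qed
  qed
  have cov: "(\<integral>s. (ip p u (fst s))\<^sup>2 \<partial>P) = ip p u (mv p (mentries A) u)" for u
  proof -
    have "(\<integral>s. (ip p u (fst s))\<^sup>2 \<partial>P) = (\<integral>s. (\<Sum>i<p. \<Sum>j<p. (u i * u j) * (fst s i * fst s j)) \<partial>P)"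
      by (simp add: ip_def power2_eq_square sum_product mult_ac)
    also have "\<dots> = (\<Sum>i<p. \<integral>s. (\<Sum>j<p. (u i * u j) * (fst s i * fst s j)) \<partial>P)"
      by (intro Bochner_Integration.integral_sum Bochner_Integration.integrable_sum integrable_mult_right int) auto
    also have "\<dots> = (\<Sum>i<p. \<Sum>j<p. (u i * u j) * (\<integral>s. fst s i * fst s j \<partial>P))"
      using int by (intro sum.cong refl) (simp add: Bochner_Integration.integral_sum)
    also have "\<dots> = ip p u (mv p (mentries A) u)"
      by (simp add: ip_def mv_def A_def covariance_def sum_distrib_left mult_ac)
    finally show ?thesis .
  qed
  have z_iso: "(\<integral>s. (ip p v (whitened p P s))\<^sup>2 \<partial>P) = ip p v v" for v
  proof -
    let ?W = "mentries W"
    have "(\<integral>s. (ip p v (whitened p P s))\<^sup>2 \<partial>P) = ip p (mv p ?W v) (mv p (mentries A) (mv p ?W v))"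
      unfolding wz by (rule cov)
    also have "\<dots> = ip p v (mv p ?W (mv p (mentries A) (mv p ?W v)))"
      by (rule ip_mv_symmetric[OF Wsym, symmetric])
    also have "\<dots> = ip p v v"
    proof -
      have "mv p ?W (mv p (mentries A) (mv p ?W v)) i = v i" if i: "i < p" for i
      proof -
        have "mv p ?W (mv p (mentries A) (mv p ?W v)) i = mv p (mm p ?W (mentries A)) (mv p ?W v) i"
          by (simp add: mv_mm)
        also have "\<dots> = mv p (mentries (W * A)) (mv p ?W v) i"
          unfolding mv_def using mult_mat_mm[OF Wc Ac i] by simp
        also have "\<dots> = v i" using mv_mult_identity[OF _ Wc W(2) i] Wc Ac by simp
        finally show ?thesis .
      qed
      then show ?thesis by (simp add: ip_def)
    qed
    finally show ?thesis .
  qed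
  show ?thesis by (rule isotropic_model.intro) (fact prob p z_subgaussian z_iso y_subgaussian)+
qed

text \<open>
  In whitened coordinates the estimator \<open>b\<close> becomes \<open>V b\<close> with \<open>V = W \<Sigma> = W\<^sup>-\<^sup>1\<close>, and the factor \<open>\<parallel>W\<parallel>\<close> of \<open>\<eta>\<close> comes from
  returning to the original ones. The lower bound on the design of the remaining rows also gives full
  column rank for every \<open>S\<close> in question, so the arbitrary values of the estimators do not occur on the good event.
\<close>

theorem theorem3p2:
  shows "\<exists>C c :: real. 0 < C \<and> 0 < c \<and>
    (\<forall>(n::nat) (p::nat) (k::nat) (P :: sample measure)
        (beta :: (nat \<Rightarrow> sample) \<Rightarrow> real Matrix.vec)
        (beta_sub :: (nat \<Rightarrow> sample) \<Rightarrow> nat set \<Rightarrow> real Matrix.vec) (t::real).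
      1 \<le> p \<longrightarrow> p \<le> n \<longrightarrow> 1 \<le> k \<longrightarrow>
      model1 p P \<longrightarrow>
      (\<forall>d \<in> space (iid_samples n P). is_ols (design n p d) (response n d) (beta d)) \<longrightarrow>
      (\<forall>d \<in> space (iid_samples n P). \<forall>S \<subseteq> {..<n}.
         is_ols (restrict_rows (design n p d) S) (restrict_entries (response n d) S) (beta_sub d S)) \<longrightarrow>
      real k \<le> real n / 2 \<longrightarrow>
      (model_omega p P)\<^sup>2 *
         (sqrt (real k / real n * ln (exp 1 * real n / real k)) + sqrt (real p / real n)) \<le> c \<longrightarrow>
      0 < t \<longrightarrow>
      holds_with_prob_at_least (iid_samples n P)
        (1 - 3 * (exp 1 * real n / real k) powr (- (real k * t\<^sup>2))
           - 4 * exp (- (c * real n / model_omega p P ^ 4)))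
        (\<lambda>d. (MAX S \<in> {S. S \<subseteq> {..<n} \<and> n - k \<le> card S}. vec_norm2 (beta d - beta_sub d S))
           \<le> C * model_eta p P *
             (real k / real n * ln (exp 1 * real n / real k)
               + 1 / real n * sqrt (real k * real p * ln (exp 1 * real n / real k))) *
             (1 + t)\<^sup>2))"
proof (rule exI[of _ 160], rule exI[of _ "1 / 6000"], intro conjI allI impI)
  fix n p k :: nat and P :: "sample measure" and beta :: "(nat \<Rightarrow> sample) \<Rightarrow> real Matrix.vec"
    and beta_sub :: "(nat \<Rightarrow> sample) \<Rightarrow> nat set \<Rightarrow> real Matrix.vec" and t :: real
  assume p: "1 \<le> p" and pn: "p \<le> n" and k: "1 \<le> k" and model: "model1 p P"
    and ols: "\<forall>d \<in> space (iid_samples n P). is_ols (design n p d) (response n d) (beta d)"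
    and ols_sub: "\<forall>d \<in> space (iid_samples n P). \<forall>S \<subseteq> {..<n}.
         is_ols (restrict_rows (design n p d) S) (restrict_entries (response n d) S) (beta_sub d S)"
    and kn: "real k \<le> real n / 2"
    and cond: "(model_omega p P)\<^sup>2 *
         (sqrt (real k / real n * ln (exp 1 * real n / real k)) + sqrt (real p / real n)) \<le> 1 / 6000"
    and t: "0 < t"
  define \<omega> where "\<omega> = model_omega p P"
  define \<sigma> where "\<sigma> = enn2real (psi2_norm P snd)"
  define K where "K = real k * ln (exp 1 * real n / real k)"
  define A where "A = covariance p P"
  define W where "W = inv_sqrt_mat p A"
  define V where "V = W * A"
  define Q where "Q = (1 + \<omega> ^ 3) * \<sigma> * (K + sqrt (K * real p)) * (1 + t)\<^sup>2"
  have n: "0 < n" "k \<le> n" using p pn kn by auto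
  interpret isotropic_model P p "whitened p P" snd \<omega> \<sigma>
    unfolding \<omega>_def \<sigma>_def by (rule model1_isotropic[OF model p])
  interpret D: prob_space "data {..<n}" by (rule prob_data)
  have A: "pos_def_mat p A" using model by (simp add: model1_def A_def)
  have Ac: "A \<in> carrier_mat p p" by (simp add: A_def covariance_def)
  have W: "pos_def_mat p W" "W * V = 1\<^sub>m p"
    using inv_sqrt_mat_whitens[OF A] by (simp_all add: W_def V_def)
  have Wc: "W \<in> carrier_mat p p" and Wsym: "\<And>i j. i < p \<Longrightarrow> j < p \<Longrightarrow> mentries W i j = mentries W j i"
    using W(1) by (auto simp: pos_def_mat_iff)
  have Vc: "V \<in> carrier_mat p p" using Wc Ac by (simp add: V_def)
  let ?W = "mv p (mentries W)" and ?V = "mv p (mentries V)"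
  have WV: "?W (?V v) i = v i" if "i < p" for v i by (rule mv_mult_identity[OF Wc Vc W(2) that])
  have wz: "ip p v (whitened p P s) = ip p (?W v) (fst s)" for v s
    unfolding whitened_def A_def[symmetric] W_def[symmetric] by (rule ip_mv_symmetric[OF Wsym])
  have wzV: "ip p (?V v) (whitened p P s) = ip p v (fst s)" for v s
    unfolding wz by (simp add: ip_def WV)
  have spec: "norm2 p v \<le> spectral_norm W * norm2 p (?V v)" for v
  proof -
    have "norm2 p v = norm2 p (?W (?V v))" by (intro L2_set_cong) (auto simp: WV)
    also have "\<dots> \<le> spectral_norm W * norm2 p (?V v)" by (rule norm2_mv_le_spectral_norm[OF Wc])
    finally show ?thesis .
  qed
  have spec0: "0 \<le> spectral_norm W"
  proof -
    define e where "e = (\<lambda>_::nat. 1::real)"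
    have "0 < norm2 p e" using p by (auto simp: less_le norm2_eq_0 e_def)
    then have "0 < spectral_norm W * norm2 p (?V e)" using spec[of e] by linarith
    then show ?thesis using L2_set_nonneg[of "?V e" "{..<p}"] by (auto simp: zero_less_mult_iff)
  qed
  have ols_fit: "b \<in> carrier_vec p \<and> normal_eq p (\<lambda>i. whitened p P (d i)) (\<lambda>i. snd (d i)) S (?V (entries b))"
    if low: "\<And>v. real n / 4 * ip p v v \<le> energy d S v"
      and X: "X \<in> carrier_mat m p" and Y: "Y \<in> carrier_vec m" and b: "is_ols X Y b"
      and bij: "bij_betw r {..<m} S"
      and rows: "\<And>i j. i < m \<Longrightarrow> j < p \<Longrightarrow> X $$ (i, j) = fst (d (r i)) j" "\<And>i. i < m \<Longrightarrow> vec_index Y i = snd (d (r i))"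
    for X :: "real mat" and Y b :: "real Matrix.vec" and m r S and d :: "nat \<Rightarrow> sample"
  proof -
    have inj: "norm2 p v = 0" if "(\<Sum>s\<in>S. (ip p v (fst (d s)))\<^sup>2) = 0" for v
    proof -
      have "real n / 4 * ip p (?V v) (?V v) \<le> 0" using low[of "?V v"] that by (simp add: wzV)
      then have "norm2 p (?V v) = 0" using n by (simp add: mult_le_0_iff flip: norm2_sq)
      then show ?thesis using spec[of v] L2_set_nonneg[of v "{..<p}"] by simp
    qed
    have "b \<in> carrier_vec p" "normal_eq p (\<lambda>i. fst (d i)) (\<lambda>i. snd (d i)) S (entries b)"
      by (rule is_ols_normal_eq[where x="\<lambda>i. fst (d i)" and y="\<lambda>i. snd (d i)", OF X Y b bij rows inj]; assumption)+
    then show ?thesis by (simp add: normal_eq_def wzV) (simp add: wz)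
  qed
  have cond': "\<omega>\<^sup>2 * (sqrt (K / real n) + sqrt (real p / real n)) \<le> 1 / 6000"
    using cond by (simp add: K_def \<omega>_def)
  note rare = stable_removal_rare[OF k n(2) t cond'[unfolded K_def], folded K_def]
  show "holds_with_prob_at_least (iid_samples n P)
        (1 - 3 * (exp 1 * real n / real k) powr (- (real k * t\<^sup>2))
           - 4 * exp (- (1 / 6000 * real n / model_omega p P ^ 4)))
        (\<lambda>d. (MAX S \<in> {S. S \<subseteq> {..<n} \<and> n - k \<le> card S}. vec_norm2 (beta d - beta_sub d S))
           \<le> 160 * model_eta p P *
             (real k / real n * ln (exp 1 * real n / real k)
               + 1 / real n * sqrt (real k * real p * ln (exp 1 * real n / real k))) *
             (1 + t)\<^sup>2)"
    unfolding iid_samples_def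
  proof (rule D.holds_of_rare[OF rare])
    have "(exp 1 * real n / real k) powr (- (real k * t\<^sup>2)) = exp (- (K * t\<^sup>2))"
      using n k by (simp add: powr_def K_def mult_ac)
    then show "1 - 3 * (exp 1 * real n / real k) powr (- (real k * t\<^sup>2)) - 4 * exp (- (1 / 6000 * real n / model_omega p P ^ 4))
      \<le> 1 - (3 * exp (- (K * t\<^sup>2)) + 4 * exp (- (1 / 6000 * real n / \<omega> ^ 4)))"
      by (simp add: \<omega>_def)
  next
    fix d assume d: "d \<in> space (data {..<n})" and "\<not> (\<exists>S\<subseteq>{..<n}. n \<le> card S + k \<and> \<not> (
      (\<forall>v. real n / 4 * ip p v v \<le> energy d S v) \<and>
      (\<forall>a b. normal_eq p (\<lambda>i. whitened p P (d i)) (\<lambda>i. snd (d i)) {..<n} a \<longrightarrow>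
             normal_eq p (\<lambda>i. whitened p P (d i)) (\<lambda>i. snd (d i)) S b \<longrightarrow>
        real n / 4 * norm2 p (\<lambda>j. a j - b j)
          \<le> 40 * ((1 + \<omega> ^ 3) * \<sigma> * (K + sqrt (K * real p)) * (1 + t)\<^sup>2))))"
    then have low: "\<And>S v. S \<subseteq> {..<n} \<Longrightarrow> n \<le> card S + k \<Longrightarrow> real n / 4 * ip p v v \<le> energy d S v"
      and stable: "\<And>S a b. S \<subseteq> {..<n} \<Longrightarrow> n \<le> card S + k \<Longrightarrow>
        normal_eq p (\<lambda>i. whitened p P (d i)) (\<lambda>i. snd (d i)) {..<n} a \<Longrightarrow>
        normal_eq p (\<lambda>i. whitened p P (d i)) (\<lambda>i. snd (d i)) S b \<Longrightarrow>
        real n / 4 * norm2 p (\<lambda>j. a j - b j) \<le> 40 * Q"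
      unfolding Q_def by blast+
    have ds: "d \<in> space (iid_samples n P)" using d by (simp add: iid_samples_def)
    have full: "beta d \<in> carrier_vec p \<and> normal_eq p (\<lambda>i. whitened p P (d i)) (\<lambda>i. snd (d i)) {..<n} (?V (entries (beta d)))"
    proof (rule ols_fit)
      show "real n / 4 * ip p v v \<le> energy d {..<n} v" for v by (rule low) auto
      show "is_ols (design n p d) (response n d) (beta d)" using ols ds by blast
      show "bij_betw id {..<n} {..<n}" by simp
    qed (auto simp: design_def response_def)
    have bound: "vec_norm2 (beta d - beta_sub d S) \<le> spectral_norm W * (160 * Q / real n)"
      if S: "S \<subseteq> {..<n}" "n - k \<le> card S" for S
    proof -
      have S': "n \<le> card S + k" using S by simp
      have eqS: "{i. i < n \<and> i \<in> S} = S" using S(1) by auto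
      have finS: "finite S" using S(1) finite_subset by blast
      have pick: "pick S i < n" if "i < card S" for i using pick_in_set_le[OF that] S(1) by auto
      have sub: "beta_sub d S \<in> carrier_vec p \<and>
          normal_eq p (\<lambda>i. whitened p P (d i)) (\<lambda>i. snd (d i)) S (?V (entries (beta_sub d S)))"
      proof (rule ols_fit)
        show "real n / 4 * ip p v v \<le> energy d S v" for v by (rule low[OF S(1) S'])
        show "is_ols (restrict_rows (design n p d) S) (restrict_entries (response n d) S) (beta_sub d S)"
          using ols_sub ds S(1) by blast
        show "bij_betw (pick S) {..<card S} S" by (rule bij_betw_pick[OF finS])
      qed (use pick eqS in \<open>auto simp: restrict_rows_def restrict_entries_def submatrix_def design_def response_def pick_UNIV\<close>)
      define h where "h = (\<lambda>j. entries (beta d) j - entries (beta_sub d S) j)"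
      have c: "beta d - beta_sub d S \<in> carrier_vec p" using full sub by simp
      have "vec_norm2 (beta d - beta_sub d S) = norm2 p h"
        unfolding vec_norm2_norm2[OF c] by (intro L2_set_cong) (use full sub in \<open>auto simp: h_def\<close>)
      also have "\<dots> \<le> spectral_norm W * norm2 p (?V h)" by (rule spec)
      also have "?V h = (\<lambda>j. ?V (entries (beta d)) j - ?V (entries (beta_sub d S)) j)"
        by (simp add: h_def mv_def fun_eq_iff right_diff_distrib sum_subtractf)
      also have "spectral_norm W * norm2 p \<dots> \<le> spectral_norm W * (160 * Q / real n)"
        using stable[OF S(1) S' full[THEN conjunct2] sub[THEN conjunct2]] n
        by (intro mult_left_mono spec0) (simp add: field_simps)
      finally show ?thesis .
    qed
    have "(MAX S \<in> {S. S \<subseteq> {..<n} \<and> n - k \<le> card S}. vec_norm2 (beta d - beta_sub d S)) \<le> spectral_norm W * (160 * Q / real n)"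
    proof (rule Max.boundedI)
      show "finite ((\<lambda>S. vec_norm2 (beta d - beta_sub d S)) ` {S. S \<subseteq> {..<n} \<and> n - k \<le> card S})"
        by (intro finite_imageI) (auto intro: finite_subset[of _ "Pow {..<n}"])
      have "{..<n} \<in> {S. S \<subseteq> {..<n} \<and> n - k \<le> card S}" by simp
      then show "(\<lambda>S. vec_norm2 (beta d - beta_sub d S)) ` {S. S \<subseteq> {..<n} \<and> n - k \<le> card S} \<noteq> {}" by blast
    qed (use bound in auto)
    also have "\<dots> = 160 * model_eta p P *
             (real k / real n * ln (exp 1 * real n / real k)
               + 1 / real n * sqrt (real k * real p * ln (exp 1 * real n / real k))) *
             (1 + t)\<^sup>2"
    proof -
      have e1: "sqrt (real k * real p * ln (exp 1 * real n / real k)) = sqrt (K * real p)" by (simp add: K_def mult_ac)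
      have e2: "real k / real n * ln (exp 1 * real n / real k) = K / real n" by (simp add: K_def)
      have e3: "model_eta p P = (1 + \<omega> ^ 3) * spectral_norm W * \<sigma>"
        by (simp add: model_eta_def \<omega>_def W_def A_def \<sigma>_def)
      show ?thesis unfolding e1 e2 e3 Q_def using n by (simp add: field_simps)
    qed
    finally show "(MAX S \<in> {S. S \<subseteq> {..<n} \<and> n - k \<le> card S}. vec_norm2 (beta d - beta_sub d S))
           \<le> 160 * model_eta p P *
             (real k / real n * ln (exp 1 * real n / real k)
               + 1 / real n * sqrt (real k * real p * ln (exp 1 * real n / real k))) *
             (1 + t)\<^sup>2" .
  qed
qed simp_all

end
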